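(* In the setting of the context, assume that as $p \to +\infty$: $s \to +\infty$, $s = o(p)$, $n_1 = \omega(s)$ and $n_2 = \omega(s)$. Let $n_{\mathrm{ALG}} := 2 s\log(p-s) + s + 1$. (i) If there exists $\varepsilon>0$ such that $n < (1-\varepsilon) n_{\mathrm{ALG}}$, then for any sequence $\lambda_p > 0$ such that $\frac{n_1\sigma_1^2 + n_2\sigma_2^2}{\lambda_p^2 n^2}$ has a limit in $\mathbb{R}_{\ge 0}\cup\{+\infty\}$, we have $\mathbb{P}_{X,Z}(\mathcal{R}(X,\beta^\star,Z,\lambda_p)) \to 0$. (ii) If there exists $\varepsilon > 0$ such that $n > (1+\varepsilon) n_{\mathrm{ALG}}$, and $(\lambda_p)_{p\ge1} \to 0$ is chosen such that $$ \frac{n\lambda_p^2}{\sigma_{\mathrm{avg}}^2 \log(p-s)} \to +\infty \quad\text{and}\quad \frac{1}{\rho}\left[\lambda_p\sqrt{s} + \sqrt{\frac{\sigma_{\mathrm{avg}}^2 \log s}{n}}\right] \to 0, $$ then $\mathbb{P}_{X,Z}(\mathcal{R}(X,\beta^\star,Z,\lambda_p)) \to 1$.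
   Context: All quantities ($s, n_1, n_2, \sigma_1, \sigma_2, \rho, \beta^\star, \lambda_p$) may depend on $p$; limits are as $p\to+\infty$. $n = n_1 + n_2$. The design $X \in \mathbb{R}^{n\times p}$ has i.i.d. $\mathcal{N}(0,1)$ entries; $0<\sigma_1^2<\sigma_2^2$; $\Sigma = \begin{pmatrix} \sigma_1 I_{n_1} & 0 \\ 0 & \sigma_2 I_{n_2}\end{pmatrix}$; $W \sim \mathcal{N}(0,I_n)$ independent of $X$; $Z = \Sigma W$; $Y = X\beta^\star + Z$. The signal $\beta^\star \in \mathbb{R}^p$ is deterministic with exactly $s$ nonzero coordinates, each satisfying $|\beta^\star_i| \ge \rho$ for some $\rho > 0$. $\sigma_{\mathrm{avg}}^2 := (n_1\sigma_1^2 + n_2\sigma_2^2)/n$. The Lasso solution set is $\mathcal{B}_{\mathrm{Lasso}} := \arg\min_{\beta\in\mathbb{R}^p}\{ \frac{1}{2n}\|Y - X\beta\|_2^2 + \lambda_p\|\beta\|_1\}$. With $\operatorname{sign}(0)=0$, $\operatorname{sign}(x)=x/|x|$ for $x\neq 0$ applied coordinatewise, the recovery event is $\mathcal{R}(X,\beta^\star,Z,\lambda_p) := \{\exists\, \hat\beta\in\mathcal{B}_{\mathrm{Lasso}} : \operatorname{sign}(\hat\beta) = \operatorname{sign}(\beta^\star)\}$.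
   Formalization: In part (ii) the regularization parameters are assumed positive (λ_p > 0 for all p), as part (i) already states; for negative λ_p with n < p the Lasso objective is unbounded below, the solution set is empty, and the claim would fail. *)

theory Defs
  imports "HOL-Probability.Probability" "HOL-Library.Landau_Symbols"
begin

definition std_gauss_vec :: "'a set \<Rightarrow> ('a \<Rightarrow> real) measure" where
  "std_gauss_vec I = PiM I (\<lambda>_. density lborel std_normal_density)"

text \<open>Lasso objective: vectors in R^p are functions nat => real vanishing outside {..<p};
  the design X is an n x p matrix given as a function on index pairs.\<close>
definition lasso_obj ::
  "nat \<Rightarrow> nat \<Rightarrow> (nat \<times> nat \<Rightarrow> real) \<Rightarrow> (nat \<Rightarrow> real) \<Rightarrow> real \<Rightarrow> (nat \<Rightarrow> real) \<Rightarrow> real" where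
  "lasso_obj n p X Y lam \<beta> =
     (1 / (2 * real n)) * (\<Sum>i<n. (Y i - (\<Sum>j<p. X (i, j) * \<beta> j))\<^sup>2) + lam * (\<Sum>j<p. \<bar>\<beta> j\<bar>)"

definition is_vec :: "nat \<Rightarrow> (nat \<Rightarrow> real) \<Rightarrow> bool" where
  "is_vec p \<beta> \<longleftrightarrow> (\<forall>j\<ge>p. \<beta> j = 0)"

definition lasso_set ::
  "nat \<Rightarrow> nat \<Rightarrow> (nat \<times> nat \<Rightarrow> real) \<Rightarrow> (nat \<Rightarrow> real) \<Rightarrow> real \<Rightarrow> (nat \<Rightarrow> real) set" where
  "lasso_set n p X Y lam =
     {\<beta>. is_vec p \<beta> \<and> (\<forall>\<beta>'. is_vec p \<beta>' \<longrightarrow> lasso_obj n p X Y lam \<beta> \<le> lasso_obj n p X Y lam \<beta>')}"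

definition recovery ::
  "nat \<Rightarrow> nat \<Rightarrow> (nat \<times> nat \<Rightarrow> real) \<Rightarrow> (nat \<Rightarrow> real) \<Rightarrow> (nat \<Rightarrow> real) \<Rightarrow> real \<Rightarrow> bool" where
  "recovery n p X \<beta>s Z lam \<longleftrightarrow>
     (\<exists>\<beta>\<in>lasso_set n p X (\<lambda>i. (\<Sum>j<p. X (i, j) * \<beta>s j) + Z i) lam.
        \<forall>j<p. sgn (\<beta> j) = sgn (\<beta>s j))"

text \<open>P_{X,Z}(R): X has i.i.d. N(0,1) entries, W ~ N(0,I_n) independent, Z = Sigma W with
  Sigma = diag(sigma1 I_{n1}, sigma2 I_{n2}).\<close>
definition recovery_prob ::
  "nat \<Rightarrow> nat \<Rightarrow> nat \<Rightarrow> real \<Rightarrow> real \<Rightarrow> (nat \<Rightarrow> real) \<Rightarrow> real \<Rightarrow> real" where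
  "recovery_prob n1 n2 p \<sigma>1 \<sigma>2 \<beta>s lam =
     (let n = n1 + n2;
          M = std_gauss_vec ({..<n} \<times> {..<p}) \<Otimes>\<^sub>M std_gauss_vec {..<n}
      in measure M ({(X, W). recovery n p X \<beta>s (\<lambda>i. (if i < n1 then \<sigma>1 else \<sigma>2) * W i) lam}
                    \<inter> space M))"

end

theory Submission
  imports Defs "HOL-Real_Asymp.Real_Asymp"
begin

text \<open>
  A sign-recovering solution has a residual \<open>r\<close> determined by the support columns \<open>X\<^sub>S\<close> and the
  noise alone, with \<open>X\<^sub>S\<^sup>T r = n \<lambda> sign \<beta>\<^sup>*\<close>; the remaining columns are independent of \<open>r\<close>, and
  recovery requires \<open>\<bar>X\<^sub>j\<^sup>T r\<bar> \<le> n \<lambda>\<close> for all \<open>p - s\<close> of them. Hence everything is decided by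
  comparing \<open>2 \<parallel>r\<parallel>\<^sup>2 log (p - s)\<close> with \<open>(n \<lambda>)\<^sup>2\<close>.

  Below the threshold, testing \<open>r\<close> against \<open>X\<^sub>S sign \<beta>\<^sup>*\<close>, whose squared norm is about \<open>s n\<close>, shows
  that \<open>\<parallel>r\<parallel>\<^sup>2\<close> is at least about \<open>n \<lambda>\<^sup>2 s\<close>, which is too large. Above it, a net argument shows that
  both row blocks of \<open>X\<^sub>S\<close> are nearly isometric up to scaling since \<open>n\<^sub>1\<close> and \<open>n\<^sub>2\<close> dominate \<open>s\<close>; this
  bounds \<open>\<parallel>r\<parallel>\<^sup>2\<close> from above, and, applied to each block separately, bounds the variance of every
  coordinate of the least squares fit of the noise by a multiple of \<open>\<sigma>\<^sub>a\<^sub>v\<^sub>g\<^sup>2 / n\<close> although \<open>\<sigma>\<^sub>2\<^sup>2\<close> may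
  be much larger than \<open>\<sigma>\<^sub>a\<^sub>v\<^sub>g\<^sup>2\<close>.
\<close>

subsection \<open>Normal random variables\<close>

lemma (in prob_space) nn_integral_exp_normal_tilt:
  assumes X: "distributed M lborel X (normal_density \<mu> \<sigma>)" and h: "h \<in> borel_measurable borel"
    and tilt: "\<And>y. normal_density \<mu> \<sigma> y * exp (h y) = c * normal_density \<nu> \<tau> y"
    and "\<tau> > 0" "c \<ge> 0"
  shows "(\<integral>\<^sup>+\<omega>. ennreal (exp (h (X \<omega>))) \<partial>M) = ennreal c"
proof -
  have "(\<integral>\<^sup>+\<omega>. ennreal (exp (h (X \<omega>))) \<partial>M)
      = (\<integral>\<^sup>+y. ennreal (normal_density \<mu> \<sigma> y) * ennreal (exp (h y)) \<partial>lborel)"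
    using h by (intro distributed_nn_integral[OF X, symmetric]) auto
  also have "\<dots> = (\<integral>\<^sup>+y. ennreal c * ennreal (normal_density \<nu> \<tau> y) \<partial>lborel)"
    using \<open>c \<ge> 0\<close> by (simp add: tilt flip: ennreal_mult)
  also have "\<dots> = ennreal c * (\<integral>\<^sup>+y. ennreal (normal_density \<nu> \<tau> y) \<partial>lborel)"
    by (rule nn_integral_cmult) auto
  also have "(\<integral>\<^sup>+y. ennreal (normal_density \<nu> \<tau> y) \<partial>lborel) = 1"
    using \<open>\<tau> > 0\<close> by (subst nn_integral_eq_integral) auto
  finally show ?thesis by simp
qed

lemma (in prob_space) normal_mgf:
  assumes "distributed M lborel X (normal_density 0 \<sigma>)" and \<sigma>: "\<sigma> > 0"
  shows "(\<integral>\<^sup>+\<omega>. ennreal (exp (t * X \<omega>)) \<partial>M) = ennreal (exp (t\<^sup>2 * \<sigma>\<^sup>2 / 2))"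
proof (rule nn_integral_exp_normal_tilt[OF assms(1)])
  fix y
  have "- y\<^sup>2 / (2 * \<sigma>\<^sup>2) + t * y = t\<^sup>2 * \<sigma>\<^sup>2 / 2 - (y - t * \<sigma>\<^sup>2)\<^sup>2 / (2 * \<sigma>\<^sup>2)"
    using \<sigma> by (simp add: power2_eq_square field_simps)
  then show "normal_density 0 \<sigma> y * exp (t * y)
      = exp (t\<^sup>2 * \<sigma>\<^sup>2 / 2) * normal_density (t * \<sigma>\<^sup>2) \<sigma> y"
    by (simp add: normal_density_def flip: exp_add)
qed (use \<sigma> in auto)

lemma (in prob_space) normal_square_mgf:
  assumes "distributed M lborel X (normal_density 0 \<sigma>)" and \<sigma>: "\<sigma> > 0" and t: "2 * t * \<sigma>\<^sup>2 < 1"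
  shows "(\<integral>\<^sup>+\<omega>. ennreal (exp (t * (X \<omega>)\<^sup>2)) \<partial>M) = ennreal (1 / sqrt (1 - 2 * t * \<sigma>\<^sup>2))"
proof (rule nn_integral_exp_normal_tilt[OF assms(1)])
  define d where "d = sqrt (1 - 2 * t * \<sigma>\<^sup>2)"
  have d: "d > 0" "d\<^sup>2 = 1 - 2 * t * \<sigma>\<^sup>2" using t by (auto simp: d_def)
  fix y
  have "- y\<^sup>2 / (2 * \<sigma>\<^sup>2) + t * y\<^sup>2 = - y\<^sup>2 * d\<^sup>2 / (2 * \<sigma>\<^sup>2)"
    unfolding d(2) using \<sigma> by (simp add: field_simps)
  also have "\<dots> = - y\<^sup>2 / (2 * (\<sigma> / d)\<^sup>2)" using d(1) \<sigma> by (simp add: power_divide)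
  finally show "normal_density 0 \<sigma> y * exp (t * y\<^sup>2)
      = (1 / sqrt (1 - 2 * t * \<sigma>\<^sup>2)) * normal_density 0 (\<sigma> / sqrt (1 - 2 * t * \<sigma>\<^sup>2)) y"
    using \<sigma> d(1) unfolding d_def[symmetric] normal_density_def
    by (simp add: power_divide real_sqrt_mult real_sqrt_divide flip: exp_add)
qed (use \<sigma> t in auto)

lemma (in prob_space) prob_ge_le_exp:
  fixes f :: "'a \<Rightarrow> real"
  assumes f: "f \<in> borel_measurable M" and B: "0 \<le> B"
    and mgf: "(\<integral>\<^sup>+x. ennreal (exp (f x)) \<partial>M) \<le> ennreal B"
  shows "prob {x \<in> space M. a \<le> f x} \<le> exp (- a) * B"
proof -
  have "emeasure M {x \<in> space M. a \<le> f x}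
      \<le> ennreal (exp (- 1 * a)) * (\<integral>\<^sup>+x. ennreal (exp (1 * f x)) * indicator (space M) x \<partial>M)"
    using f by (intro Chernoff_ineq_nn_integral_ge) auto
  also have "(\<integral>\<^sup>+x. ennreal (exp (1 * f x)) * indicator (space M) x \<partial>M)
      = (\<integral>\<^sup>+x. ennreal (exp (f x)) \<partial>M)"
    by (intro nn_integral_cong) simp
  also have "ennreal (exp (- 1 * a)) * \<dots> \<le> ennreal (exp (- 1 * a)) * ennreal B"
    by (intro mult_left_mono mgf) simp
  finally show ?thesis using B by (simp add: emeasure_eq_measure flip: ennreal_mult)
qed

lemma (in prob_space) prob_normal_abs_ge:
  assumes X: "distributed M lborel X (normal_density 0 \<sigma>)" and \<sigma>: "\<sigma> > 0" and y: "y \<ge> 0"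
  shows "prob {\<omega> \<in> space M. y \<le> \<bar>X \<omega>\<bar>} \<le> 2 * exp (- y\<^sup>2 / (2 * \<sigma>\<^sup>2))"
proof -
  have [measurable]: "random_variable borel X" using distributed_measurable[OF X] by simp
  have tail: "prob {\<omega> \<in> space M. y \<le> c * X \<omega>} \<le> exp (- y\<^sup>2 / (2 * \<sigma>\<^sup>2))" if c: "c * c = 1" for c
  proof (cases "y = 0")
    case False
    define t where "t = y / \<sigma>\<^sup>2"
    have "t > 0" using y False \<sigma> by (simp add: t_def)
    have "prob {\<omega> \<in> space M. t * y \<le> t * c * X \<omega>} \<le> exp (- (t * y)) * exp ((t * c)\<^sup>2 * \<sigma>\<^sup>2 / 2)"
      by (rule prob_ge_le_exp) (use normal_mgf[OF X \<sigma>, of "t * c"] in auto)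
    also have "\<dots> = exp (- y\<^sup>2 / (2 * \<sigma>\<^sup>2))"
      using \<sigma> c by (simp add: t_def power2_eq_square field_simps flip: exp_add)
    finally show ?thesis using \<open>t > 0\<close> by (simp add: mult.assoc)
  qed simp
  have "prob {\<omega> \<in> space M. y \<le> \<bar>X \<omega>\<bar>}
      \<le> prob ({\<omega> \<in> space M. y \<le> 1 * X \<omega>} \<union> {\<omega> \<in> space M. y \<le> - 1 * X \<omega>})"
    by (intro finite_measure_mono) auto
  also have "\<dots> \<le> prob {\<omega> \<in> space M. y \<le> 1 * X \<omega>} + prob {\<omega> \<in> space M. y \<le> - 1 * X \<omega>}"
    by (intro measure_Un_le) auto
  also have "\<dots> \<le> 2 * exp (- y\<^sup>2 / (2 * \<sigma>\<^sup>2))" using tail[of 1] tail[of "- 1"] by simp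
  finally show ?thesis .
qed

definition normal_tail_lower :: "real \<Rightarrow> real" where
  "normal_tail_lower t = exp (- (t + 1)\<^sup>2 / 2) / sqrt (2 * pi)"

lemma normal_tail_lower_le_1: "normal_tail_lower t \<le> 1"
proof -
  have "exp (- (t + 1)\<^sup>2 / 2) \<le> 1" by simp
  also have "1 \<le> sqrt (2 * pi)" using pi_ge_two by simp
  finally show ?thesis by (simp add: normal_tail_lower_def divide_le_eq)
qed

lemma normal_tail_lower_antimono:
  assumes "0 \<le> t" "t \<le> t'"
  shows "normal_tail_lower t' \<le> normal_tail_lower t"
proof -
  have "(t + 1)\<^sup>2 \<le> (t' + 1)\<^sup>2" using assms by (intro power_mono) auto
  then show ?thesis unfolding normal_tail_lower_def by (intro divide_right_mono) auto
qed

lemma (in prob_space) prob_normal_abs_le: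
  assumes X: "distributed M lborel X (normal_density 0 \<sigma>)" and \<sigma>: "\<sigma> > 0" and y: "y \<ge> 0"
  shows "prob {\<omega> \<in> space M. \<bar>X \<omega>\<bar> \<le> y} \<le> 1 - normal_tail_lower (y / \<sigma>)"
proof -
  have [measurable]: "random_variable borel X" using distributed_measurable[OF X] by simp
  define q where "q = normal_tail_lower (y / \<sigma>)"
  let ?E = "X -` {y<..y + \<sigma>} \<inter> space M"
  have density: "q / \<sigma> \<le> normal_density 0 \<sigma> x" if x: "y < x" "x \<le> y + \<sigma>" for x
  proof -
    have "x / \<sigma> \<le> y / \<sigma> + 1" using x \<sigma> by (simp add: field_simps)
    then have "(x / \<sigma>)\<^sup>2 \<le> (y / \<sigma> + 1)\<^sup>2" using x y \<sigma> by (intro power_mono) auto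
    then have "exp (- (y / \<sigma> + 1)\<^sup>2 / 2) \<le> exp (- x\<^sup>2 / (2 * \<sigma>\<^sup>2))" by (simp add: power_divide)
    then have "exp (- (y / \<sigma> + 1)\<^sup>2 / 2) / (sqrt (2 * pi) * \<sigma>)
        \<le> exp (- x\<^sup>2 / (2 * \<sigma>\<^sup>2)) / (sqrt (2 * pi) * \<sigma>)"
      using \<sigma> by (intro divide_right_mono) auto
    then show ?thesis
      using \<sigma> by (simp add: q_def normal_tail_lower_def normal_density_def real_sqrt_mult)
  qed
  have "ennreal q = (\<integral>\<^sup>+x. ennreal (q / \<sigma>) * indicator {y<..y + \<sigma>} x \<partial>lborel)"
    using \<sigma>
    by (simp add: q_def normal_tail_lower_def nn_integral_cmult_indicator flip: ennreal_mult)
  also have "\<dots> \<le> (\<integral>\<^sup>+x. ennreal (normal_density 0 \<sigma> x) * indicator {y<..y + \<sigma>} x \<partial>lborel)"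
    using density by (intro nn_integral_mono) (auto simp: indicator_def intro!: ennreal_leI)
  also have "\<dots> = emeasure M ?E" using distributed_emeasure[OF X, of "{y<..y + \<sigma>}"] by simp
  finally have "q \<le> prob ?E" by (simp add: emeasure_eq_measure)
  moreover have "prob {\<omega> \<in> space M. \<bar>X \<omega>\<bar> \<le> y} + prob ?E = prob ({\<omega> \<in> space M. \<bar>X \<omega>\<bar> \<le> y} \<union> ?E)"
    by (intro finite_measure_Union[symmetric]) auto
  moreover have "\<dots> \<le> 1" by simp
  ultimately show ?thesis unfolding q_def by linarith
qed

lemma (in prob_space) sum_squares_normal_mgf:
  assumes R: "finite R" and ind: "indep_vars (\<lambda>_. borel) X R" and \<sigma>: "\<sigma> > 0"
    and X: "\<And>i. i \<in> R \<Longrightarrow> distributed M lborel (X i) (normal_density 0 \<sigma>)"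
    and t: "2 * t * \<sigma>\<^sup>2 < 1"
  shows "(\<integral>\<^sup>+\<omega>. ennreal (exp (t * (\<Sum>i\<in>R. (X i \<omega>)\<^sup>2))) \<partial>M)
    = ennreal ((1 / sqrt (1 - 2 * t * \<sigma>\<^sup>2)) ^ card R)"
proof -
  have ind': "indep_vars (\<lambda>_. borel) (\<lambda>i \<omega>. ennreal (exp (t * (X i \<omega>)\<^sup>2))) R"
    by (rule indep_vars_compose2[OF ind, where Y = "\<lambda>_ y. ennreal (exp (t * y\<^sup>2))"]) auto
  have "(\<integral>\<^sup>+\<omega>. ennreal (exp (t * (\<Sum>i\<in>R. (X i \<omega>)\<^sup>2))) \<partial>M)
      = (\<integral>\<^sup>+\<omega>. (\<Prod>i\<in>R. ennreal (exp (t * (X i \<omega>)\<^sup>2))) \<partial>M)"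
    by (simp add: sum_distrib_left exp_sum[OF R] prod_ennreal)
  also have "\<dots> = (\<Prod>i\<in>R. \<integral>\<^sup>+\<omega>. ennreal (exp (t * (X i \<omega>)\<^sup>2)) \<partial>M)"
    by (rule indep_vars_nn_integral[OF R ind']) simp
  also have "\<dots> = (\<Prod>i\<in>R. ennreal (1 / sqrt (1 - 2 * t * \<sigma>\<^sup>2)))"
    using normal_square_mgf[OF X \<sigma> t] by (intro prod.cong) auto
  also have "\<dots> = ennreal ((1 / sqrt (1 - 2 * t * \<sigma>\<^sup>2)) ^ card R)"
    using t by (simp only: prod_constant) (subst ennreal_power, auto)
  finally show ?thesis .
qed

lemma inverse_sqrt_one_minus_le_exp:
  fixes x :: real
  assumes "\<bar>x\<bar> \<le> 1 / 2"
  shows "1 / sqrt (1 - x) \<le> exp (x / 2 + x\<^sup>2)"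
proof -
  have "- x - 2 * x\<^sup>2 \<le> ln (1 - x)"
    using abs_ln_one_plus_x_minus_x_bound[of "- x"] assms by (simp add: abs_le_iff)
  then have "exp (- x - 2 * x\<^sup>2) \<le> 1 - x" using assms by (simp add: ln_ge_iff)
  then have "sqrt (exp (- x - 2 * x\<^sup>2)) \<le> sqrt (1 - x)" by simp
  moreover have "sqrt (exp (- x - 2 * x\<^sup>2)) = exp (- (x / 2 + x\<^sup>2))"
    by (rule real_sqrt_unique) (simp_all add: power2_eq_square flip: exp_add)
  ultimately show ?thesis using assms by (simp add: exp_minus field_simps)
qed

lemma (in prob_space) chi_square_tail:
  fixes \<epsilon> :: real
  assumes R: "finite R" and ind: "indep_vars (\<lambda>_. borel) X R" and \<sigma>: "\<sigma> > 0"
    and X: "\<And>i. i \<in> R \<Longrightarrow> distributed M lborel (X i) (normal_density 0 \<sigma>)"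
    and \<epsilon>: "\<bar>\<epsilon>\<bar> \<le> 1"
  shows "prob {\<omega> \<in> space M. \<epsilon> * ((1 + \<epsilon>) * \<sigma>\<^sup>2 * card R) \<le> \<epsilon> * (\<Sum>i\<in>R. (X i \<omega>)\<^sup>2)}
    \<le> exp (- \<epsilon>\<^sup>2 * card R / 16)"
proof -
  define q where "q = (\<lambda>\<omega>. \<Sum>i\<in>R. (X i \<omega>)\<^sup>2)"
  have [measurable]: "random_variable borel q"
    unfolding q_def using distributed_measurable[OF X]
    by (intro borel_measurable_sum borel_measurable_power) auto
  define t where "t = \<epsilon> / (8 * \<sigma>\<^sup>2)"
  have t: "2 * t * \<sigma>\<^sup>2 = \<epsilon> / 4" using \<sigma> by (simp add: t_def)
  have t_le: "t * a \<le> t * b \<longleftrightarrow> \<epsilon> * a \<le> \<epsilon> * b" for a b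
    using \<sigma> by (simp add: t_def divide_le_cancel)
  have "(1 / sqrt (1 - \<epsilon> / 4)) ^ card R \<le> exp ((\<epsilon> / 4) / 2 + (\<epsilon> / 4)\<^sup>2) ^ card R"
    using \<epsilon> by (intro power_mono inverse_sqrt_one_minus_le_exp) auto
  moreover have "(\<integral>\<^sup>+\<omega>. ennreal (exp (t * q \<omega>)) \<partial>M)
      = ennreal ((1 / sqrt (1 - 2 * t * \<sigma>\<^sup>2)) ^ card R)"
    unfolding q_def using \<epsilon> t by (intro sum_squares_normal_mgf[OF R ind \<sigma> X]) auto
  ultimately have "(\<integral>\<^sup>+\<omega>. ennreal (exp (t * q \<omega>)) \<partial>M)
      \<le> ennreal (exp ((\<epsilon> / 4) / 2 + (\<epsilon> / 4)\<^sup>2) ^ card R)"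
    unfolding t by (metis ennreal_leI)
  then have "prob {\<omega> \<in> space M. t * ((1 + \<epsilon>) * \<sigma>\<^sup>2 * card R) \<le> t * q \<omega>}
      \<le> exp (- (t * ((1 + \<epsilon>) * \<sigma>\<^sup>2 * card R))) * exp ((\<epsilon> / 4) / 2 + (\<epsilon> / 4)\<^sup>2) ^ card R"
    by (intro prob_ge_le_exp) auto
  also have "\<dots> = exp (- \<epsilon>\<^sup>2 * card R / 16)"
    using \<sigma> by (simp add: t_def field_simps power2_eq_square flip: exp_of_nat_mult exp_add)
  finally show ?thesis unfolding t_le q_def .
qed

lemma (in prob_space) chi_square_concentration:
  assumes R: "finite R" and ind: "indep_vars (\<lambda>_. borel) X R" and \<sigma>: "\<sigma> > 0"
    and X: "\<And>i. i \<in> R \<Longrightarrow> distributed M lborel (X i) (normal_density 0 \<sigma>)"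
    and \<eta>: "0 < \<eta>" "\<eta> \<le> 1"
  shows "prob {\<omega> \<in> space M. \<eta> * \<sigma>\<^sup>2 * card R \<le> \<bar>(\<Sum>i\<in>R. (X i \<omega>)\<^sup>2) - \<sigma>\<^sup>2 * card R\<bar>}
    \<le> 2 * exp (- \<eta>\<^sup>2 * card R / 16)"
proof -
  define q where "q = (\<lambda>\<omega>. \<Sum>i\<in>R. (X i \<omega>)\<^sup>2)"
  have [measurable]: "random_variable borel q"
    unfolding q_def using distributed_measurable[OF X]
    by (intro borel_measurable_sum borel_measurable_power) auto
  let ?A = "\<lambda>\<epsilon>. {\<omega> \<in> space M. \<epsilon> * ((1 + \<epsilon>) * \<sigma>\<^sup>2 * card R) \<le> \<epsilon> * q \<omega>}"
  have tail: "prob (?A \<epsilon>) \<le> exp (- \<eta>\<^sup>2 * card R / 16)" if "\<epsilon> = \<eta> \<or> \<epsilon> = - \<eta>" for \<epsilon>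
    using chi_square_tail[OF R ind \<sigma> X, of \<epsilon>] that \<eta> by (auto simp: q_def)
  have "prob {\<omega> \<in> space M. \<eta> * \<sigma>\<^sup>2 * card R \<le> \<bar>q \<omega> - \<sigma>\<^sup>2 * card R\<bar>} \<le> prob (?A \<eta> \<union> ?A (- \<eta>))"
  proof (rule finite_measure_mono)
    have "?A \<eta> = {\<omega> \<in> space M. (1 + \<eta>) * \<sigma>\<^sup>2 * card R \<le> q \<omega>}"
      "?A (- \<eta>) = {\<omega> \<in> space M. q \<omega> \<le> (1 - \<eta>) * \<sigma>\<^sup>2 * card R}"
      using \<eta> by auto
    then show "{\<omega> \<in> space M. \<eta> * \<sigma>\<^sup>2 * card R \<le> \<bar>q \<omega> - \<sigma>\<^sup>2 * card R\<bar>} \<subseteq> ?A \<eta> \<union> ?A (- \<eta>)"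
      by (auto simp: abs_if algebra_simps split: if_splits)
  qed measurable
  also have "\<dots> \<le> prob (?A \<eta>) + prob (?A (- \<eta>))" by (intro measure_Un_le) auto
  also have "\<dots> \<le> 2 * exp (- \<eta>\<^sup>2 * card R / 16)" using tail[of \<eta>] tail[of "- \<eta>"] \<eta> by simp
  finally show ?thesis by (simp add: q_def)
qed

subsection \<open>Standard Gaussian vectors\<close>

lemma L2_set_power2: "(L2_set f A)\<^sup>2 = (\<Sum>i\<in>A. (f i)\<^sup>2)"
  by (simp add: L2_set_def sum_nonneg)

lemma prob_space_std_gauss_vec: "prob_space (std_gauss_vec I)"
  unfolding std_gauss_vec_def by (intro prob_space_PiM prob_space_normal_density) simp

lemma space_std_gauss_vec: "space (std_gauss_vec I) = extensional I"
  by (auto simp: std_gauss_vec_def space_PiM PiE_def)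

lemma sets_std_gauss_vec [measurable_cong]: "sets (std_gauss_vec I) = sets (PiM I (\<lambda>_. borel))"
  unfolding std_gauss_vec_def by (intro sets_PiM_cong) auto

lemma borel_measurable_component:
  "j \<in> J \<Longrightarrow> (\<lambda>x. x j) \<in> borel_measurable (std_gauss_vec J)"
  by measurable

lemma borel_measurable_linear_form:
  "K \<subseteq> J \<Longrightarrow> (\<lambda>x. \<Sum>j\<in>K. a j * x j) \<in> borel_measurable (std_gauss_vec J)"
  by (intro borel_measurable_sum borel_measurable_times borel_measurable_const
      borel_measurable_component) auto

lemma distr_std_gauss_vec_component:
  assumes "j \<in> J"
  shows "distr (std_gauss_vec J) borel (\<lambda>x. x j) = density lborel std_normal_density"
proof -
  let ?D = "density lborel std_normal_density"
  have "distr (std_gauss_vec J) borel (\<lambda>x. x j) = distr (std_gauss_vec J) ?D (\<lambda>x. x j)"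
    by (rule distr_cong) auto
  also have "\<dots> = ?D"
    using distr_PiM_component[of J "\<lambda>_. ?D" j] assms prob_space_normal_density[of 1 0]
    by (simp add: std_gauss_vec_def)
  finally show ?thesis .
qed

lemma borel_measurable_L2_set:
  assumes "R \<subseteq> J"
  shows "(\<lambda>x. L2_set x R) \<in> borel_measurable (std_gauss_vec J)"
  unfolding L2_set_def using assms
  by (intro measurable_compose[OF _ borel_measurable_sqrt] borel_measurable_sum
      borel_measurable_power borel_measurable_component) auto

lemma indep_vars_std_gauss_vec:
  "prob_space.indep_vars (std_gauss_vec J) (\<lambda>_. borel) (\<lambda>j x. x j) J"
proof (cases "J = {}")
  interpret prob_space "std_gauss_vec J" by (rule prob_space_std_gauss_vec)
  case True
  then show ?thesis unfolding indep_vars_def indep_sets_def by simp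
next
  interpret prob_space "std_gauss_vec J" by (rule prob_space_std_gauss_vec)
  case False
  have "distr (std_gauss_vec J) (PiM J (\<lambda>_. borel)) (\<lambda>x. \<lambda>i\<in>J. x i)
      = distr (std_gauss_vec J) (std_gauss_vec J) (\<lambda>x. x)"
    by (rule distr_cong) (auto simp: sets_std_gauss_vec space_std_gauss_vec extensional_restrict)
  also have "\<dots> = std_gauss_vec J" by (rule distr_id)
  also have "\<dots> = PiM J (\<lambda>j. distr (std_gauss_vec J) borel (\<lambda>x. x j))"
    by (subst (1) std_gauss_vec_def, rule PiM_cong) (simp_all add: distr_std_gauss_vec_component)
  finally show ?thesis by (subst indep_vars_iff_distr_eq_PiM') (auto simp: False)
qed

lemma indep_vars_linear_forms:
  assumes K: "\<And>i. i \<in> R \<Longrightarrow> K i \<subseteq> J" and dis: "disjoint_family_on K R"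
  shows "prob_space.indep_vars (std_gauss_vec J) (\<lambda>_. borel) (\<lambda>i x. \<Sum>j\<in>K i. a i j * x j) R"
proof -
  interpret prob_space "std_gauss_vec J" by (rule prob_space_std_gauss_vec)
  have "indep_vars (\<lambda>j. PiM (K j) (\<lambda>_. borel)) (\<lambda>j x. restrict (\<lambda>i. x i) (K j)) R"
    by (rule indep_vars_restrict[OF indep_vars_std_gauss_vec K dis])
  then have "indep_vars (\<lambda>_. borel)
      (\<lambda>i x. (\<lambda>y. \<Sum>j\<in>K i. a i j * y j) (restrict (\<lambda>j. x j) (K i))) R"
    by (rule indep_vars_compose2[where Y = "\<lambda>i y. \<Sum>j\<in>K i. a i j * y j"])
      (intro borel_measurable_sum borel_measurable_times borel_measurable_const
          measurable_component_singleton)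
  then show ?thesis by simp
qed

lemma distributed_linear_form:
  assumes K: "K \<subseteq> J" "finite K" and pos: "L2_set a K > 0"
  shows "distributed (std_gauss_vec J) lborel (\<lambda>x. \<Sum>j\<in>K. a j * x j) (normal_density 0 (L2_set a K))"
proof -
  interpret prob_space "std_gauss_vec J" by (rule prob_space_std_gauss_vec)
  define L where "L = {j \<in> K. a j \<noteq> 0}"
  have L: "finite L" "L \<subseteq> J" using K by (auto simp: L_def)
  have norm: "L2_set a K = sqrt (\<Sum>j\<in>L. \<bar>a j\<bar>\<^sup>2)"
    unfolding L2_set_def L_def using K
    by (intro arg_cong[of _ _ sqrt] sum.mono_neutral_cong_right) auto
  have form: "(\<lambda>x. \<Sum>j\<in>K. a j * x j) = (\<lambda>x. \<Sum>j\<in>L. a j * x j)"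
    unfolding L_def using K by (intro ext sum.mono_neutral_cong_right) auto
  have "L \<noteq> {}" using pos unfolding norm by auto
  have "distributed (std_gauss_vec J) lborel (\<lambda>x. 0 + a j * x j)
      (normal_density (0 + a j * 0) (\<bar>a j\<bar> * 1))"
    if "j \<in> L" for j
  proof (rule normal_density_affine)
    have "distr (std_gauss_vec J) lborel (\<lambda>x. x j) = distr (std_gauss_vec J) borel (\<lambda>x. x j)"
      by (rule distr_cong) auto
    then show "distributed (std_gauss_vec J) lborel (\<lambda>x. x j) std_normal_density"
      using that L distr_std_gauss_vec_component[of j J] by (auto simp: distributed_def)
  qed (use that in \<open>auto simp: L_def\<close>)
  moreover have "indep_vars (\<lambda>_. borel) (\<lambda>i x. \<Sum>j\<in>{i}. a j * x j) L"
    using L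
    by (intro indep_vars_linear_forms[where a = "\<lambda>_. a"]) (auto simp: disjoint_family_on_def)
  ultimately show ?thesis
    using sum_indep_normal[OF L(1) \<open>L \<noteq> {}\<close>, of "\<lambda>j x. a j * x j" "\<lambda>j. \<bar>a j\<bar>" "\<lambda>_. 0"]
    unfolding norm form by (simp add: L_def)
qed

lemma prob_linear_form_ge:
  assumes K: "K \<subseteq> J" "finite K" and V: "V > 0" "(L2_set a K)\<^sup>2 \<le> V" and y: "y \<ge> 0"
  shows "measure (std_gauss_vec J) {x \<in> space (std_gauss_vec J). y \<le> \<bar>\<Sum>j\<in>K. a j * x j\<bar>}
    \<le> 2 * exp (- y\<^sup>2 / (2 * V))"
proof (cases "L2_set a K > 0")
  case True
  interpret prob_space "std_gauss_vec J" by (rule prob_space_std_gauss_vec)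
  have "prob {x \<in> space (std_gauss_vec J). y \<le> \<bar>\<Sum>j\<in>K. a j * x j\<bar>}
      \<le> 2 * exp (- y\<^sup>2 / (2 * (L2_set a K)\<^sup>2))"
    by (rule prob_normal_abs_ge[OF distributed_linear_form[OF K True] True y])
  also have "\<dots> \<le> 2 * exp (- y\<^sup>2 / (2 * V))"
    using V True by (simp add: frac_le)
  finally show ?thesis .
next
  case False
  interpret prob_space "std_gauss_vec J" by (rule prob_space_std_gauss_vec)
  have "L2_set a K = 0" using False L2_set_nonneg[of a K] by linarith
  then have "(\<Sum>j\<in>K. a j * x j) = 0" for x using K by (simp add: L2_set_eq_0_iff)
  then show ?thesis using y prob_le_1 by (cases "y = 0") (auto intro: order_trans[OF prob_le_1])
qed

lemma measure_UN_le_card: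
  fixes e :: real
  assumes "finite L" and "\<And>k. k \<in> L \<Longrightarrow> E k \<in> sets M" and "\<And>k. k \<in> L \<Longrightarrow> measure M (E k) \<le> e"
  shows "measure M (\<Union>k\<in>L. E k) \<le> card L * e"
  using measure_UNION_le[of L E M] sum_bounded_above[of L "\<lambda>k. measure M (E k)" e] assms by simp

lemma prob_ex_linear_form_ge:
  fixes a :: "'b \<Rightarrow> 'a \<Rightarrow> real"
  assumes T: "finite T" and K: "\<And>j. j \<in> T \<Longrightarrow> K j \<subseteq> J" "\<And>j. j \<in> T \<Longrightarrow> finite (K j)"
    and V: "V > 0" "\<And>j. j \<in> T \<Longrightarrow> (L2_set (a j) (K j))\<^sup>2 \<le> V" and y: "y \<ge> 0"
  defines "E \<equiv> {x \<in> space (std_gauss_vec J). \<exists>j\<in>T. y \<le> \<bar>\<Sum>k\<in>K j. a j k * x k\<bar>}"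
  shows "E \<in> sets (std_gauss_vec J)"
    and "measure (std_gauss_vec J) E \<le> card T * (2 * exp (- y\<^sup>2 / (2 * V)))"
proof -
  interpret prob_space "std_gauss_vec J" by (rule prob_space_std_gauss_vec)
  define A where "A = (\<lambda>j. {x \<in> space (std_gauss_vec J). y \<le> \<bar>\<Sum>k\<in>K j. a j k * x k\<bar>})"
  have E: "E = (\<Union>j\<in>T. A j)" by (auto simp: E_def A_def)
  have A: "A j \<in> events" if "j \<in> T" for j
  proof -
    note [measurable] = borel_measurable_linear_form[OF K(1)[OF that], of "a j"]
    show ?thesis unfolding A_def by measurable
  qed
  then show "E \<in> events" unfolding E using T by (intro sets.finite_UN) auto
  have "prob (A j) \<le> 2 * exp (- y\<^sup>2 / (2 * V))" if "j \<in> T" for j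
    unfolding A_def
    by (rule prob_linear_form_ge[OF K(1)[OF that] K(2)[OF that] V(1) V(2)[OF that] y])
  then show "prob E \<le> card T * (2 * exp (- y\<^sup>2 / (2 * V)))"
    unfolding E using T A by (intro measure_UN_le_card) auto
qed

lemma prob_linear_form_le:
  assumes K: "K \<subseteq> J" "finite K" and v: "0 < v" "v \<le> L2_set a K" and y: "y \<ge> 0"
  shows "measure (std_gauss_vec J) {x \<in> space (std_gauss_vec J). \<bar>\<Sum>j\<in>K. a j * x j\<bar> \<le> y}
    \<le> 1 - normal_tail_lower (y / v)"
proof -
  interpret prob_space "std_gauss_vec J" by (rule prob_space_std_gauss_vec)
  have pos: "L2_set a K > 0" using v by simp
  have "prob {x \<in> space (std_gauss_vec J). \<bar>\<Sum>j\<in>K. a j * x j\<bar> \<le> y}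
      \<le> 1 - normal_tail_lower (y / L2_set a K)"
    by (rule prob_normal_abs_le[OF distributed_linear_form[OF K pos] pos y])
  also have "\<dots> \<le> 1 - normal_tail_lower (y / v)"
    using v y by (intro diff_left_mono normal_tail_lower_antimono divide_left_mono) auto
  finally show ?thesis .
qed

lemma std_gauss_vec_norm_concentration:
  fixes \<eta> :: real
  assumes R: "R \<subseteq> J" "finite R" and \<eta>: "0 < \<eta>" "\<eta> \<le> 1"
  shows "measure (std_gauss_vec J)
      {x \<in> space (std_gauss_vec J). \<eta> * card R \<le> \<bar>(L2_set x R)\<^sup>2 - card R\<bar>}
    \<le> 2 * exp (- \<eta>\<^sup>2 * card R / 16)"
proof -
  interpret prob_space "std_gauss_vec J" by (rule prob_space_std_gauss_vec)
  have indep: "indep_vars (\<lambda>_. borel) (\<lambda>i x. x i) R"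
    by (rule indep_vars_subset[OF indep_vars_std_gauss_vec R(1)])
  have normal: "distributed (std_gauss_vec J) lborel (\<lambda>x. x i) (normal_density 0 1)"
    if "i \<in> R" for i
    using distributed_linear_form[of "{i}" J "\<lambda>_. 1"] that R by auto
  show ?thesis
    using chi_square_concentration[OF R(2) indep zero_less_one normal \<eta>]
    by (simp add: L2_set_power2)
qed

subsection \<open>Matrices acting on vectors indexed by sets\<close>

definition mat_vec :: "('a \<times> 'b \<Rightarrow> real) \<Rightarrow> 'b set \<Rightarrow> ('b \<Rightarrow> real) \<Rightarrow> 'a \<Rightarrow> real" where
  "mat_vec x S v i = (\<Sum>j\<in>S. x (i, j) * v j)"

definition transp_mat_vec :: "('a \<times> 'b \<Rightarrow> real) \<Rightarrow> 'a set \<Rightarrow> ('a \<Rightarrow> real) \<Rightarrow> 'b \<Rightarrow> real" where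
  "transp_mat_vec x R y j = (\<Sum>i\<in>R. x (i, j) * y i)"

lemma mat_vec_add: "mat_vec x S (\<lambda>j. u j + v j) = (\<lambda>i. mat_vec x S u i + mat_vec x S v i)"
  by (simp add: mat_vec_def fun_eq_iff distrib_left sum.distrib)

lemma mat_vec_diff: "mat_vec x S (\<lambda>j. u j - v j) = (\<lambda>i. mat_vec x S u i - mat_vec x S v i)"
  by (simp add: mat_vec_def fun_eq_iff right_diff_distrib sum_subtractf)

lemma mat_vec_scale: "mat_vec x S (\<lambda>j. c * v j) = (\<lambda>i. c * mat_vec x S v i)"
  by (simp add: mat_vec_def fun_eq_iff sum_distrib_left mult_ac)

lemma transp_mat_vec_add:
  "transp_mat_vec x R (\<lambda>i. y i + z i) = (\<lambda>j. transp_mat_vec x R y j + transp_mat_vec x R z j)"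
  by (simp add: transp_mat_vec_def fun_eq_iff distrib_left sum.distrib)

lemma transp_mat_vec_diff:
  "transp_mat_vec x R (\<lambda>i. y i - z i) = (\<lambda>j. transp_mat_vec x R y j - transp_mat_vec x R z j)"
  by (simp add: transp_mat_vec_def fun_eq_iff right_diff_distrib sum_subtractf)

lemma mat_vec_adjoint: "(\<Sum>i\<in>R. mat_vec x S v i * y i) = (\<Sum>j\<in>S. v j * transp_mat_vec x R y j)"
  unfolding mat_vec_def transp_mat_vec_def sum_distrib_left sum_distrib_right
  by (subst sum.swap) (simp add: mult_ac)

abbreviation residual :: "('a \<times> 'b \<Rightarrow> real) \<Rightarrow> 'b set \<Rightarrow> ('a \<Rightarrow> real) \<Rightarrow> ('b \<Rightarrow> real) \<Rightarrow> 'a \<Rightarrow> real" where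
  "residual x S y v \<equiv> \<lambda>i. y i - mat_vec x S v i"

lemma abs_sum_mult_le_L2_set: "\<bar>\<Sum>i\<in>A. f i * g i\<bar> \<le> L2_set f A * L2_set g A"
proof -
  have "\<bar>\<Sum>i\<in>A. f i * g i\<bar> \<le> (\<Sum>i\<in>A. \<bar>f i\<bar> * \<bar>g i\<bar>)"
    using sum_abs[of "\<lambda>i. f i * g i" A] by (simp add: abs_mult)
  also have "\<dots> \<le> L2_set f A * L2_set g A" by (rule L2_set_mult_ineq)
  finally show ?thesis .
qed

lemma L2_set_scale: "L2_set (\<lambda>i. c * f i) A = \<bar>c\<bar> * L2_set f A"
  by (simp add: L2_set_def power_mult_distrib real_sqrt_mult flip: sum_distrib_left)

lemma L2_set_mat_vec_le:
  "L2_set (mat_vec x S v) R \<le> (\<Sum>i\<in>R. L2_set (\<lambda>j. x (i, j)) S) * L2_set v S"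
proof -
  have "L2_set (mat_vec x S v) R \<le> (\<Sum>i\<in>R. \<bar>mat_vec x S v i\<bar>)" by (rule L2_set_le_sum_abs)
  also have "\<dots> \<le> (\<Sum>i\<in>R. L2_set (\<lambda>j. x (i, j)) S * L2_set v S)"
    unfolding mat_vec_def by (intro sum_mono abs_sum_mult_le_L2_set)
  finally show ?thesis by (simp add: sum_distrib_right)
qed

lemma sum_row: "(\<Sum>z\<in>{i} \<times> S. f z) = (\<Sum>j\<in>S. f (i, j))"
  using sum.cartesian_product[of "\<lambda>i j. f (i, j)" S "{i}"] by simp

lemma sum_column: "(\<Sum>z\<in>R \<times> {j}. f z) = (\<Sum>i\<in>R. f (i, j))"
  using sum.cartesian_product[of "\<lambda>i j. f (i, j)" "{j}" R] by simp

subsection \<open>Nets of the Euclidean unit ball\<close>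

definition ball_net :: "real \<Rightarrow> 'a set \<Rightarrow> ('a \<Rightarrow> real) set \<Rightarrow> bool" where
  "ball_net \<eta> S N \<longleftrightarrow>
     (\<forall>v. L2_set v S \<le> 1 \<longrightarrow> (\<exists>u\<in>N. L2_set u S \<le> 1 \<and> L2_set (\<lambda>j. v j - u j) S \<le> \<eta>))"

lemma sum_half_power_abs: "(\<Sum>i\<in>{- int m..int m}. (1 / 2 :: real) ^ nat \<bar>i\<bar>) \<le> 3 - 2 * (1 / 2) ^ m"
proof (induction m)
  case (Suc m)
  have "{- int (Suc m)..int (Suc m)}
      = insert (- int (Suc m)) (insert (int (Suc m)) {- int m..int m})"
    by auto
  then have "(\<Sum>i\<in>{- int (Suc m)..int (Suc m)}. (1 / 2 :: real) ^ nat \<bar>i\<bar>)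
      = 2 * (1 / 2) ^ Suc m + (\<Sum>i\<in>{- int m..int m}. (1 / 2 :: real) ^ nat \<bar>i\<bar>)"
    by (simp add: nat_add_distrib)
  then show ?case using Suc by simp
qed simp

lemma abs_le_square_int: "\<bar>i\<bar> \<le> (i :: int)\<^sup>2"
  using mult_left_mono[of 1 "\<bar>i\<bar>" "\<bar>i\<bar>"] by (cases "i = 0") (auto simp: power2_eq_square)

lemma sum_exp_neg_square_le: "(\<Sum>i\<in>{- int m..int m}. exp (- (real_of_int i)\<^sup>2)) \<le> 3"
proof -
  have "exp (- (real_of_int i)\<^sup>2) \<le> (1 / 2) ^ nat \<bar>i\<bar>" for i
  proof -
    have "real_of_int \<bar>i\<bar> \<le> (real_of_int i)\<^sup>2"
      using abs_le_square_int[of i] by (metis of_int_le_iff of_int_power)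
    then have "exp (- (real_of_int i)\<^sup>2) \<le> exp (- real (nat \<bar>i\<bar>))" by simp
    also have "\<dots> = exp (- 1) ^ nat \<bar>i\<bar>" by (simp flip: exp_of_nat_mult)
    also have "\<dots> \<le> (1 / 2) ^ nat \<bar>i\<bar>"
      using exp_ge_add_one_self[of 1] by (intro power_mono) (simp_all add: exp_minus field_simps)
    finally show ?thesis .
  qed
  then have "(\<Sum>i\<in>{- int m..int m}. exp (- (real_of_int i)\<^sup>2))
      \<le> (\<Sum>i\<in>{- int m..int m}. (1 / 2 :: real) ^ nat \<bar>i\<bar>)" by (rule sum_mono)
  also have "\<dots> \<le> 3 - 2 * (1 / 2) ^ m" by (rule sum_half_power_abs)
  also have "\<dots> \<le> 3" by simp
  finally show ?thesis .
qed

lemma lattice_ball_finite_card: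
  fixes S :: "'a set" and r :: real
  assumes S: "finite S"
  defines "L \<equiv> {k \<in> extensional S. (\<Sum>j\<in>S. (real_of_int (k j))\<^sup>2) \<le> r}"
  shows "finite L" and "card L \<le> exp r * 3 ^ card S"
proof -
  define P where "P = PiE S (\<lambda>_. {- int (nat \<lfloor>r\<rfloor>)..int (nat \<lfloor>r\<rfloor>)})"
  have P: "finite P" unfolding P_def using S by (intro finite_PiE) auto
  have "L \<subseteq> P"
  proof
    fix k assume k: "k \<in> L"
    have "k j \<in> {- int (nat \<lfloor>r\<rfloor>)..int (nat \<lfloor>r\<rfloor>)}" if "j \<in> S" for j
    proof -
      have "real_of_int \<bar>k j\<bar> \<le> (real_of_int (k j))\<^sup>2"
        using abs_le_square_int[of "k j"] by (metis of_int_le_iff of_int_power)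
      also have "\<dots> \<le> (\<Sum>j\<in>S. (real_of_int (k j))\<^sup>2)" using S that by (intro member_le_sum) auto
      also have "\<dots> \<le> r" using k by (simp add: L_def)
      finally have "\<bar>k j\<bar> \<le> \<lfloor>r\<rfloor>" by (simp only: le_floor_iff)
      then show ?thesis by (auto simp: abs_le_iff) linarith+
    qed
    then show "k \<in> P" using k by (auto simp: P_def L_def PiE_def)
  qed
  then show L: "finite L" using P finite_subset by blast
  have "real (card L) = (\<Sum>k\<in>L. 1)" by simp
  also have "\<dots> \<le> (\<Sum>k\<in>L. exp (r + (\<Sum>j\<in>S. - (real_of_int (k j))\<^sup>2)))"
    by (intro sum_mono) (simp add: L_def sum_negf)
  also have "\<dots> \<le> (\<Sum>k\<in>P. exp (r + (\<Sum>j\<in>S. - (real_of_int (k j))\<^sup>2)))"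
    using P \<open>L \<subseteq> P\<close> by (intro sum_mono2) auto
  also have "\<dots> = exp r * (\<Prod>j\<in>S. \<Sum>i\<in>{- int (nat \<lfloor>r\<rfloor>)..int (nat \<lfloor>r\<rfloor>)}. exp (- (real_of_int i)\<^sup>2))"
    unfolding P_def using S by (subst prod_sum_PiE) (auto simp: exp_add exp_sum sum_distrib_left)
  also have "\<dots> \<le> exp r * (\<Prod>j\<in>S. 3)"
    by (intro mult_left_mono prod_mono conjI sum_exp_neg_square_le sum_nonneg) auto
  finally show "card L \<le> exp r * 3 ^ card S" by simp
qed

lemma ex_int_rounding_towards_zero: "\<exists>k::int. \<bar>real_of_int k\<bar> \<le> \<bar>x\<bar> \<and> \<bar>x - real_of_int k\<bar> \<le> 1"
proof (cases "x \<ge> 0")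
  case True
  have "real_of_int \<lfloor>x\<rfloor> \<le> x" "x < real_of_int \<lfloor>x\<rfloor> + 1" "0 \<le> real_of_int \<lfloor>x\<rfloor>" using True by auto
  then show ?thesis by (intro exI[of _ "\<lfloor>x\<rfloor>"]) linarith
next
  case False
  have "x \<le> real_of_int \<lceil>x\<rceil>" "real_of_int \<lceil>x\<rceil> < x + 1" "real_of_int \<lceil>x\<rceil> \<le> 0"
    using False by (simp_all add: ceiling_le_iff) linarith
  then show ?thesis by (intro exI[of _ "\<lceil>x\<rceil>"]) linarith
qed

lemma L2_set_mono_abs:
  "(\<And>i. i \<in> A \<Longrightarrow> \<bar>f i\<bar> \<le> \<bar>g i\<bar>) \<Longrightarrow> L2_set f A \<le> L2_set g A"
  unfolding L2_set_def by (intro real_sqrt_le_mono sum_mono) (simp add: abs_le_square_iff)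

lemma lattice_rounding_exists:
  fixes v :: "'a \<Rightarrow> real"
  assumes a: "a > 0"
  obtains k :: "'a \<Rightarrow> int" where "k \<in> extensional S"
    and "L2_set (\<lambda>j. real_of_int (k j) / a) S \<le> L2_set v S"
    and "L2_set (\<lambda>j. v j - real_of_int (k j) / a) S \<le> sqrt (card S) / a"
proof -
  have "\<forall>j. \<exists>k::int. \<bar>real_of_int k\<bar> \<le> \<bar>a * v j\<bar> \<and> \<bar>a * v j - real_of_int k\<bar> \<le> 1"
    using ex_int_rounding_towards_zero by blast
  then obtain r :: "'a \<Rightarrow> int" where
    r: "\<bar>real_of_int (r j)\<bar> \<le> \<bar>a * v j\<bar>" "\<bar>a * v j - real_of_int (r j)\<bar> \<le> 1" for j
    by metis
  show thesis
  proof (rule that[of "restrict r S"])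
    show "L2_set (\<lambda>j. real_of_int (restrict r S j) / a) S \<le> L2_set v S"
      using r(1) a by (intro L2_set_mono_abs) (simp add: abs_mult field_simps)
    have "L2_set (\<lambda>j. v j - real_of_int (restrict r S j) / a) S \<le> L2_set (\<lambda>_. 1 / a) S"
    proof (rule L2_set_mono_abs)
      fix j assume "j \<in> S"
      then have "v j - real_of_int (restrict r S j) / a = (a * v j - real_of_int (r j)) / a"
        using a by (simp add: field_simps)
      then show "\<bar>v j - real_of_int (restrict r S j) / a\<bar> \<le> \<bar>1 / a\<bar>"
        using r(2)[of j] a by (simp add: divide_right_mono)
    qed
    also have "\<dots> = sqrt (card S) / a" using a by (simp add: L2_set_constant)
    finally show "L2_set (\<lambda>j. v j - real_of_int (restrict r S j) / a) S \<le> sqrt (card S) / a" .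
  qed simp
qed

text \<open>The net consists of the points of the lattice \<open>(\<eta> / sqrt (card S)) \<int>\<^sup>S\<close> in the unit ball;
  rounding towards zero keeps points inside the ball.\<close>

lemma ball_net_exists:
  fixes S :: "'a set"
  assumes S: "finite S" "S \<noteq> {}" and \<eta>: "0 < \<eta>"
  obtains N where "finite N" "card N \<le> (3 * exp (1 / \<eta>\<^sup>2)) ^ card S" "ball_net \<eta> S N"
proof -
  define a where "a = sqrt (card S) / \<eta>"
  have a: "a > 0" using S \<eta> by (simp add: a_def card_gt_0_iff)
  define L where "L = {k \<in> extensional S. (\<Sum>j\<in>S. (real_of_int (k j))\<^sup>2) \<le> a\<^sup>2}"
  define N where "N = (\<lambda>k j. real_of_int (k j) / a) ` L"
  have L: "finite L" "card L \<le> exp (a\<^sup>2) * 3 ^ card S"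
    unfolding L_def by (rule lattice_ball_finite_card[OF S(1)])+
  have "real (card N) \<le> card L" unfolding N_def using card_image_le[OF L(1)] by simp
  also have "\<dots> \<le> exp (card S * (1 / \<eta>\<^sup>2)) * 3 ^ card S"
    using L(2) by (simp add: a_def power_divide)
  finally have card: "card N \<le> (3 * exp (1 / \<eta>\<^sup>2)) ^ card S"
    by (simp only: exp_of_nat_mult power_mult_distrib mult.commute)
  have "ball_net \<eta> S N" unfolding ball_net_def
  proof (intro allI impI)
    fix v assume v: "L2_set v S \<le> 1"
    obtain k :: "'a \<Rightarrow> int" where k: "k \<in> extensional S"
      "L2_set (\<lambda>j. real_of_int (k j) / a) S \<le> L2_set v S"
      "L2_set (\<lambda>j. v j - real_of_int (k j) / a) S \<le> sqrt (card S) / a"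
      by (rule lattice_rounding_exists[OF a])
    define u where "u = (\<lambda>j. real_of_int (k j) / a)"
    have u: "L2_set u S \<le> 1" using k(2) v by (simp add: u_def)
    have "(\<Sum>j\<in>S. (real_of_int (k j))\<^sup>2) = a\<^sup>2 * (L2_set u S)\<^sup>2"
      using a by (simp add: u_def L2_set_power2 power_divide sum_distrib_left)
    also have "\<dots> \<le> a\<^sup>2" using u by (simp add: mult_left_le power_le_one)
    finally have "k \<in> L" using k(1) by (simp add: L_def)
    then have "u \<in> N" unfolding N_def u_def by (rule imageI)
    moreover have "sqrt (card S) / a = \<eta>" using S \<eta> by (simp add: a_def card_gt_0_iff)
    ultimately show "\<exists>u\<in>N. L2_set u S \<le> 1 \<and> L2_set (\<lambda>j. v j - u j) S \<le> \<eta>"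
      using k(3) u by (intro bexI[of _ u]) (simp_all add: u_def)
  qed
  then show thesis using card L(1) by (intro that[of N]) (auto simp: N_def)
qed

definition seminorm :: "(('a \<Rightarrow> real) \<Rightarrow> real) \<Rightarrow> bool" where
  "seminorm f \<longleftrightarrow> (\<forall>u v. f (\<lambda>j. u j + v j) \<le> f u + f v) \<and> (\<forall>c v. f (\<lambda>j. c * v j) = \<bar>c\<bar> * f v)"

lemma seminorm_add: "seminorm f \<Longrightarrow> f (\<lambda>j. u j + v j) \<le> f u + f v"
  by (simp add: seminorm_def)

lemma seminorm_scale: "seminorm f \<Longrightarrow> f (\<lambda>j. c * v j) = \<bar>c\<bar> * f v"
  by (simp add: seminorm_def)

lemma seminorm_zero: "seminorm f \<Longrightarrow> f (\<lambda>_. 0) = 0"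
  using seminorm_scale[of f 0] by simp

lemma seminorm_minus: "seminorm f \<Longrightarrow> f (\<lambda>j. - v j) = f v"
  using seminorm_scale[of f "- 1" v] by simp

lemma seminorm_nonneg: "seminorm f \<Longrightarrow> 0 \<le> f v"
  using seminorm_add[of f v "\<lambda>j. - v j"] by (simp add: seminorm_minus seminorm_zero)

lemma seminorm_le_add_diff: "seminorm f \<Longrightarrow> f v \<le> f u + f (\<lambda>j. v j - u j)"
  using seminorm_add[of f u "\<lambda>j. v j - u j"] by simp

lemma seminorm_diff_le: "seminorm f \<Longrightarrow> f u - f (\<lambda>j. v j - u j) \<le> f v"
  using seminorm_add[of f v "\<lambda>j. - (v j - u j)"] seminorm_minus[of f "\<lambda>j. v j - u j"] by simp

lemma seminorm_normalize:
  assumes f: "seminorm f" and pos: "L2_set v S > 0"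
  obtains w where "L2_set w S = 1" and "f v = f w * L2_set v S"
proof (rule that[of "\<lambda>j. inverse (L2_set v S) * v j"])
  show "L2_set (\<lambda>j. inverse (L2_set v S) * v j) S = 1"
    using pos by (simp add: L2_set_scale)
  have "f (\<lambda>j. inverse (L2_set v S) * v j) = \<bar>inverse (L2_set v S)\<bar> * f v"
    using f by (rule seminorm_scale)
  then show "f v = f (\<lambda>j. inverse (L2_set v S) * v j) * L2_set v S" using pos by simp
qed

lemma seminorm_le_of_ball_net:
  assumes f: "seminorm f" and bounded: "\<And>v. f v \<le> C * L2_set v S"
    and net: "ball_net \<eta> S N" and \<eta>: "\<eta> < 1"
    and N: "\<And>u. u \<in> N \<Longrightarrow> L2_set u S \<le> 1 \<Longrightarrow> f u \<le> B"
  shows "f v \<le> B / (1 - \<eta>) * L2_set v S"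
proof -
  define U where "U = f ` {v. L2_set v S \<le> 1}"
  define \<Lambda> where "\<Lambda> = Sup U"
  have "f v \<le> \<bar>C\<bar>" if "L2_set v S \<le> 1" for v
  proof -
    have "f v \<le> \<bar>C\<bar> * L2_set v S"
      using bounded[of v] mult_right_mono[OF abs_ge_self, of "L2_set v S" C] by simp
    also have "\<dots> \<le> \<bar>C\<bar>" using that by (simp add: mult_left_le)
    finally show ?thesis .
  qed
  then have U: "bdd_above U" by (auto simp: U_def bdd_above_def)
  have "0 \<in> U" using seminorm_zero[OF f] by (force simp: U_def L2_set_def)
  then have "\<Lambda> \<ge> 0" unfolding \<Lambda>_def using U by (rule cSup_upper)
  have f_le: "f v \<le> \<Lambda> * L2_set v S" for v
  proof (cases "L2_set v S > 0")
    case True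
    then obtain w where w: "L2_set w S = 1" "f v = f w * L2_set v S"
      by (rule seminorm_normalize[OF f])
    then have "f w \<le> \<Lambda>" unfolding \<Lambda>_def using U by (intro cSup_upper) (auto simp: U_def)
    then show ?thesis unfolding w(2) using True by (intro mult_right_mono) auto
  next
    case False
    then have "L2_set v S = 0" using L2_set_nonneg[of v S] by linarith
    then show ?thesis using bounded[of v] by simp
  qed
  have "f v \<le> B + \<Lambda> * \<eta>" if v: "L2_set v S \<le> 1" for v
  proof -
    obtain u where u: "u \<in> N" "L2_set u S \<le> 1" "L2_set (\<lambda>j. v j - u j) S \<le> \<eta>"
      using net v by (auto simp: ball_net_def)
    have "f (\<lambda>j. v j - u j) \<le> \<Lambda> * \<eta>" using f_le u(3) \<open>\<Lambda> \<ge> 0\<close> by (meson mult_left_mono order_trans)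
    then show ?thesis using seminorm_le_add_diff[OF f, of v u] N[OF u(1,2)] by linarith
  qed
  then have "\<Lambda> \<le> B + \<Lambda> * \<eta>" unfolding \<Lambda>_def using \<open>0 \<in> U\<close> by (intro cSup_least) (auto simp: U_def)
  then have "\<Lambda> \<le> B / (1 - \<eta>)" using \<eta> by (simp add: field_simps)
  then show ?thesis using f_le[of v] by (meson L2_set_nonneg mult_right_mono order_trans)
qed

lemma seminorm_upper_bound_of_ball_net:
  assumes f: "seminorm f" and bounded: "\<And>v. f v \<le> C * L2_set v S"
    and net: "ball_net \<eta> S N" and \<eta>: "0 < \<eta>" "\<eta> \<le> 1 / 4" and b: "0 \<le> b"
    and upper: "\<And>u. u \<in> N \<Longrightarrow> f u \<le> (1 + \<eta>) * b * L2_set u S"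
  shows "f v \<le> (1 + 8 / 3 * \<eta>) * b * L2_set v S"
proof -
  have "f v \<le> (1 + \<eta>) * b / (1 - \<eta>) * L2_set v S"
  proof (rule seminorm_le_of_ball_net[OF f bounded net])
    fix u assume "u \<in> N" "L2_set u S \<le> 1"
    have "f u \<le> (1 + \<eta>) * b * L2_set u S" by (rule upper[OF \<open>u \<in> N\<close>])
    also have "\<dots> \<le> (1 + \<eta>) * b" using \<open>L2_set u S \<le> 1\<close> \<eta> b by (intro mult_left_le) auto
    finally show "f u \<le> (1 + \<eta>) * b" .
  qed (use \<eta> in simp)
  also have "\<dots> \<le> (1 + 8 / 3 * \<eta>) * b * L2_set v S"
  proof (intro mult_right_mono L2_set_nonneg)
    have "1 + \<eta> \<le> (1 + 8 / 3 * \<eta>) * (1 - \<eta>)" using \<eta> by (simp add: algebra_simps)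
    from mult_right_mono[OF this b] show "(1 + \<eta>) * b / (1 - \<eta>) \<le> (1 + 8 / 3 * \<eta>) * b"
      using \<eta> by (simp add: divide_le_eq mult_ac)
  qed
  finally show ?thesis .
qed

lemma seminorm_lower_bound_of_ball_net:
  assumes f: "seminorm f" and bounded: "\<And>v. f v \<le> C * L2_set v S"
    and net: "ball_net \<eta> S N" and \<eta>: "0 < \<eta>" "\<eta> \<le> 1 / 4" and b: "0 \<le> b"
    and lower: "\<And>u. u \<in> N \<Longrightarrow> (1 - \<eta>) * b * L2_set u S \<le> f u"
    and upper: "\<And>u. u \<in> N \<Longrightarrow> f u \<le> (1 + \<eta>) * b * L2_set u S"
  shows "(1 - 4 * \<eta>) * b * L2_set v S \<le> f v"
proof (cases "L2_set v S > 0")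
  case True
  then obtain w where w: "L2_set w S = 1" "f v = f w * L2_set v S"
    by (rule seminorm_normalize[OF f])
  have "L2_set w S \<le> 1" by (simp add: w(1))
  then obtain u where u: "u \<in> N" "L2_set (\<lambda>j. w j - u j) S \<le> \<eta>"
    using net unfolding ball_net_def by blast
  have "1 - \<eta> \<le> L2_set u S"
    using L2_set_triangle_ineq[of u "\<lambda>j. w j - u j" S] w(1) u(2) by simp
  then have "(1 - \<eta>) * b * (1 - \<eta>) \<le> (1 - \<eta>) * b * L2_set u S"
    using \<eta> b by (intro mult_left_mono) auto
  also have "\<dots> \<le> f u" by (rule lower[OF u(1)])
  finally have u_lower: "(1 - \<eta>) * b * (1 - \<eta>) \<le> f u" .
  have "f (\<lambda>j. w j - u j) \<le> (1 + 8 / 3 * \<eta>) * b * L2_set (\<lambda>j. w j - u j) S"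
    by (rule seminorm_upper_bound_of_ball_net[OF f bounded net \<eta> b upper])
  also have "\<dots> \<le> (1 + 8 / 3 * \<eta>) * b * \<eta>" using u(2) b \<eta> by (intro mult_left_mono) auto
  finally have "(1 - \<eta>) * b * (1 - \<eta>) - (1 + 8 / 3 * \<eta>) * b * \<eta> \<le> f w"
    using u_lower seminorm_diff_le[OF f, of u w] by linarith
  moreover have "(1 - 4 * \<eta>) * b \<le> ((1 - \<eta>) * (1 - \<eta>) - (1 + 8 / 3 * \<eta>) * \<eta>) * b"
    using \<eta> b by (intro mult_right_mono) (simp_all add: algebra_simps)
  ultimately have "(1 - 4 * \<eta>) * b \<le> f w" by (simp add: algebra_simps)
  then show ?thesis unfolding w(2) using True by (intro mult_right_mono) auto
next
  case False
  then show ?thesis using seminorm_nonneg[OF f, of v] L2_set_nonneg[of v S]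
    by (metis less_eq_real_def mult_zero_right)
qed

subsection \<open>Gaussian matrices are approximate isometries\<close>

definition approx_isometry :: "real \<Rightarrow> 'a set \<Rightarrow> 'b set \<Rightarrow> ('a \<times> 'b \<Rightarrow> real) \<Rightarrow> bool" where
  "approx_isometry \<delta> R S x \<longleftrightarrow>
     (\<forall>v. (1 - \<delta>) * sqrt (card R) * L2_set v S \<le> L2_set (mat_vec x S v) R \<and>
          L2_set (mat_vec x S v) R \<le> (1 + \<delta>) * sqrt (card R) * L2_set v S)"

lemma approx_isometry_Un:
  assumes x: "approx_isometry \<delta> R1 S x" "approx_isometry \<delta> R2 S x"
    and R: "finite R1" "finite R2" "R1 \<inter> R2 = {}" and \<delta>: "0 \<le> \<delta>" "\<delta> \<le> 1"
  shows "approx_isometry \<delta> (R1 \<union> R2) S x"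
proof -
  have split: "(L2_set f (R1 \<union> R2))\<^sup>2 = (L2_set f R1)\<^sup>2 + (L2_set f R2)\<^sup>2" for f
    unfolding L2_set_power2 using R by (rule sum.union_disjoint)
  have scale: "(c * sqrt (card (R1 \<union> R2)) * l)\<^sup>2
      = (c * sqrt (card R1) * l)\<^sup>2 + (c * sqrt (card R2) * l)\<^sup>2"
    for c l using R by (simp add: card_Un_disjoint power_mult_distrib algebra_simps)
  have bounds: "(1 - \<delta>) * sqrt (card R) * L2_set v S \<le> L2_set (mat_vec x S v) R"
    "L2_set (mat_vec x S v) R \<le> (1 + \<delta>) * sqrt (card R) * L2_set v S" if "R = R1 \<or> R = R2" for R v
    using x that by (auto simp: approx_isometry_def)
  show ?thesis unfolding approx_isometry_def
  proof (intro allI conjI; rule power2_le_imp_le)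
    fix v
    show "((1 - \<delta>) * sqrt (card (R1 \<union> R2)) * L2_set v S)\<^sup>2 \<le> (L2_set (mat_vec x S v) (R1 \<union> R2))\<^sup>2"
      unfolding split scale using \<delta> by (intro add_mono power_mono bounds) auto
    show "(L2_set (mat_vec x S v) (R1 \<union> R2))\<^sup>2 \<le> ((1 + \<delta>) * sqrt (card (R1 \<union> R2)) * L2_set v S)\<^sup>2"
      unfolding split scale by (intro add_mono power_mono bounds) auto
  qed (use \<delta> in auto)
qed

lemma abs_diff_le_of_power2:
  fixes a b \<eta> :: real
  assumes "0 \<le> a" "0 \<le> b" and \<eta>: "0 \<le> \<eta>" "\<eta> \<le> 1" and diff: "\<bar>a\<^sup>2 - b\<^sup>2\<bar> \<le> \<eta> * b\<^sup>2"
  shows "(1 - \<eta>) * b \<le> a" and "a \<le> (1 + \<eta>) * b"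
proof -
  have sq: "(1 - \<eta>) * b\<^sup>2 \<le> a\<^sup>2" "a\<^sup>2 \<le> (1 + \<eta>) * b\<^sup>2"
    using diff by (simp_all add: abs_le_iff algebra_simps)
  have "(1 - \<eta>)\<^sup>2 * b\<^sup>2 \<le> (1 - \<eta>) * b\<^sup>2"
    using \<eta> by (intro mult_right_mono) (auto simp: power2_eq_square mult_left_le)
  then have "((1 - \<eta>) * b)\<^sup>2 \<le> a\<^sup>2" using sq(1) by (simp add: power_mult_distrib)
  then show "(1 - \<eta>) * b \<le> a" using \<open>0 \<le> a\<close> by (rule power2_le_imp_le)
  have "(1 + \<eta>) * b\<^sup>2 \<le> (1 + \<eta>)\<^sup>2 * b\<^sup>2" using \<eta> by (intro mult_right_mono self_le_power) auto
  then have "a\<^sup>2 \<le> ((1 + \<eta>) * b)\<^sup>2" using sq(2) by (simp add: power_mult_distrib)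
  then show "a \<le> (1 + \<eta>) * b" by (rule power2_le_imp_le) (use \<open>0 \<le> b\<close> \<eta> in simp)
qed

lemma approx_isometry_of_ball_net:
  assumes net: "ball_net \<eta> S N" and \<eta>: "0 < \<eta>" "\<eta> \<le> 1 / 4"
    and N: "\<And>u. \<lbrakk>u \<in> N; L2_set u S > 0\<rbrakk> \<Longrightarrow>
      \<bar>(L2_set (mat_vec x S u) R)\<^sup>2 - (L2_set u S)\<^sup>2 * card R\<bar> \<le> \<eta> * (L2_set u S)\<^sup>2 * card R"
  shows "approx_isometry (4 * \<eta>) R S x"
proof -
  let ?f = "\<lambda>v. L2_set (mat_vec x S v) R"
  have f: "seminorm ?f"
    unfolding seminorm_def mat_vec_add mat_vec_scale
    by (simp add: L2_set_scale L2_set_triangle_ineq)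
  have bounds: "(1 - \<eta>) * sqrt (card R) * L2_set u S \<le> ?f u"
    "?f u \<le> (1 + \<eta>) * sqrt (card R) * L2_set u S"
    if u: "u \<in> N" for u
  proof -
    define b where "b = sqrt (card R) * L2_set u S"
    have b: "b \<ge> 0" "b\<^sup>2 = (L2_set u S)\<^sup>2 * card R" by (simp_all add: b_def power_mult_distrib)
    have "\<bar>(?f u)\<^sup>2 - b\<^sup>2\<bar> \<le> \<eta> * b\<^sup>2"
    proof (cases "L2_set u S > 0")
      case True
      then show ?thesis using N[OF u] by (simp add: b(2) mult.assoc)
    next
      case False
      then have "L2_set u S = 0" using L2_set_nonneg[of u S] by linarith
      moreover from this have "?f u = 0"
        using L2_set_mat_vec_le[of x S u R] L2_set_nonneg[of "mat_vec x S u" R] by simp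
      ultimately show ?thesis by (simp add: b(2))
    qed
    then have "(1 - \<eta>) * b \<le> ?f u" "?f u \<le> (1 + \<eta>) * b"
      using b(1) \<eta> by (auto intro: abs_diff_le_of_power2)
    then show "(1 - \<eta>) * sqrt (card R) * L2_set u S \<le> ?f u"
      "?f u \<le> (1 + \<eta>) * sqrt (card R) * L2_set u S"
      by (simp_all add: b_def mult.assoc)
  qed
  show ?thesis unfolding approx_isometry_def
  proof (intro allI conjI)
    fix v
    show "(1 - 4 * \<eta>) * sqrt (card R) * L2_set v S \<le> ?f v"
      by (rule seminorm_lower_bound_of_ball_net[OF f L2_set_mat_vec_le net \<eta> _ bounds]) simp
    have "?f v \<le> (1 + 8 / 3 * \<eta>) * sqrt (card R) * L2_set v S"
      by (rule seminorm_upper_bound_of_ball_net[OF f L2_set_mat_vec_le net \<eta> _ bounds(2)]) simp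
    also have "\<dots> \<le> (1 + 4 * \<eta>) * sqrt (card R) * L2_set v S" using \<eta> by (intro mult_right_mono) auto
    finally show "?f v \<le> (1 + 4 * \<eta>) * sqrt (card R) * L2_set v S" .
  qed
qed

lemma mat_vec_eq_linear_form: "mat_vec x S u i = (\<Sum>z\<in>{i} \<times> S. u (snd z) * x z)"
  by (simp add: mat_vec_def sum_row mult.commute)

lemma borel_measurable_L2_set_mat_vec:
  assumes "R \<times> S \<subseteq> J"
  shows "(\<lambda>x. L2_set (mat_vec x S u) R) \<in> borel_measurable (std_gauss_vec J)"
proof -
  have coord: "(\<lambda>x. mat_vec x S u i) \<in> borel_measurable (std_gauss_vec J)" if "i \<in> R" for i
    unfolding mat_vec_eq_linear_form using that assms by (intro borel_measurable_linear_form) auto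
  show ?thesis unfolding L2_set_def
    by (rule measurable_compose[OF _ borel_measurable_sqrt])
      (intro borel_measurable_sum borel_measurable_power coord)
qed

lemma mat_vec_norm_concentration:
  assumes fin: "finite R" "finite S" and J: "R \<times> S \<subseteq> J"
    and u: "L2_set u S > 0" and \<eta>: "0 < \<eta>" "\<eta> \<le> 1"
  defines "E \<equiv> {x \<in> space (std_gauss_vec J).
      \<eta> * (L2_set u S)\<^sup>2 * card R \<le> \<bar>(L2_set (mat_vec x S u) R)\<^sup>2 - (L2_set u S)\<^sup>2 * card R\<bar>}"
  shows "E \<in> sets (std_gauss_vec J)"
    and "measure (std_gauss_vec J) E \<le> 2 * exp (- \<eta>\<^sup>2 * card R / 16)"
proof -
  interpret prob_space "std_gauss_vec J" by (rule prob_space_std_gauss_vec)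
  note [measurable] = borel_measurable_L2_set_mat_vec[OF J]
  show "E \<in> events" unfolding E_def by measurable
  have norm: "L2_set (\<lambda>z. u (snd z)) ({i} \<times> S) = L2_set u S" for i :: 'a
    by (simp add: L2_set_def sum_row)
  have indep: "indep_vars (\<lambda>_. borel) (\<lambda>i x. mat_vec x S u i) R"
    unfolding mat_vec_eq_linear_form using J
    by (intro indep_vars_linear_forms[where a = "\<lambda>_ z. u (snd z)"])
      (auto simp: disjoint_family_on_def)
  have normal: "distributed (std_gauss_vec J) lborel (\<lambda>x. mat_vec x S u i)
      (normal_density 0 (L2_set u S))"
    if "i \<in> R" for i
  proof -
    have "{i} \<times> S \<subseteq> J" using that J by auto
    then show ?thesis
      unfolding mat_vec_eq_linear_form
      using distributed_linear_form[of "{i} \<times> S" J "\<lambda>z. u (snd z)"] fin u by (simp add: norm)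
  qed
  show "prob E \<le> 2 * exp (- \<eta>\<^sup>2 * card R / 16)"
    using chi_square_concentration[OF fin(1) indep u normal \<eta>]
    by (simp add: E_def L2_set_power2[of "mat_vec _ _ _"])
qed

text \<open>The union bound over the points of a \<open>\<delta> / 4\<close>-net of the unit ball.\<close>

definition non_isometry_bound :: "real \<Rightarrow> nat \<Rightarrow> nat \<Rightarrow> real" where
  "non_isometry_bound \<delta> s m = 2 * (3 * exp (16 / \<delta>\<^sup>2)) ^ s * exp (- \<delta>\<^sup>2 * m / 256)"

lemma std_gauss_approx_isometry:
  assumes R: "finite R" and S: "finite S" "S \<noteq> {}" and J: "R \<times> S \<subseteq> J" and \<delta>: "0 < \<delta>" "\<delta> \<le> 1"
  obtains B where "B \<in> sets (std_gauss_vec J)"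
    and "measure (std_gauss_vec J) B \<le> non_isometry_bound \<delta> (card S) (card R)"
    and "\<And>x. x \<in> space (std_gauss_vec J) - B \<Longrightarrow> approx_isometry \<delta> R S x"
proof -
  define \<eta> where "\<eta> = \<delta> / 4"
  have \<eta>: "0 < \<eta>" "\<eta> \<le> 1 / 4" "\<eta> \<le> 1" using \<delta> by (auto simp: \<eta>_def)
  obtain N where N: "finite N" "card N \<le> (3 * exp (1 / \<eta>\<^sup>2)) ^ card S" "ball_net \<eta> S N"
    by (rule ball_net_exists[OF S \<eta>(1)])
  define N' where "N' = {u \<in> N. L2_set u S > 0}"
  define E where "E = (\<lambda>u. {x \<in> space (std_gauss_vec J).
    \<eta> * (L2_set u S)\<^sup>2 * card R \<le> \<bar>(L2_set (mat_vec x S u) R)\<^sup>2 - (L2_set u S)\<^sup>2 * card R\<bar>})"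
  have E: "E u \<in> sets (std_gauss_vec J)"
    "measure (std_gauss_vec J) (E u) \<le> 2 * exp (- \<eta>\<^sup>2 * card R / 16)" if "u \<in> N'" for u
    unfolding E_def using that
    by (intro mat_vec_norm_concentration[OF R S(1) J _ \<eta>(1,3)]; unfold N'_def, blast)+
  have "finite N'" using N(1) by (simp add: N'_def)
  show thesis
  proof (rule that)
    show "(\<Union>u\<in>N'. E u) \<in> sets (std_gauss_vec J)" using E(1) \<open>finite N'\<close> by (intro sets.finite_UN)
    have "measure (std_gauss_vec J) (\<Union>u\<in>N'. E u) \<le> card N' * (2 * exp (- \<eta>\<^sup>2 * card R / 16))"
      by (rule measure_UN_le_card[OF \<open>finite N'\<close> E])
    also have "\<dots> \<le> (3 * exp (1 / \<eta>\<^sup>2)) ^ card S * (2 * exp (- \<eta>\<^sup>2 * card R / 16))"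
    proof (rule mult_right_mono)
      have "card N' \<le> card N" using N(1) by (auto simp: N'_def intro: card_mono)
      then show "card N' \<le> (3 * exp (1 / \<eta>\<^sup>2)) ^ card S" using N(2) by simp
    qed simp
    finally show "measure (std_gauss_vec J) (\<Union>u\<in>N'. E u) \<le> non_isometry_bound \<delta> (card S) (card R)"
      by (simp add: non_isometry_bound_def \<eta>_def power_divide)
  next
    fix x assume x: "x \<in> space (std_gauss_vec J) - (\<Union>u\<in>N'. E u)"
    have "approx_isometry (4 * \<eta>) R S x"
    proof (rule approx_isometry_of_ball_net[OF N(3) \<eta>(1,2)])
      fix u assume "u \<in> N" "L2_set u S > 0"
      then have "x \<notin> E u" using x by (simp add: N'_def)
      then show "\<bar>(L2_set (mat_vec x S u) R)\<^sup>2 - (L2_set u S)\<^sup>2 * card R\<bar>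
          \<le> \<eta> * (L2_set u S)\<^sup>2 * card R"
        using x by (simp add: E_def)
    qed
    then show "approx_isometry \<delta> R S x" by (simp add: \<eta>_def)
  qed
qed

subsection \<open>Optimality conditions of the Lasso\<close>

definition support :: "nat \<Rightarrow> (nat \<Rightarrow> real) \<Rightarrow> nat set" where
  "support p \<beta> = {j. j < p \<and> \<beta> j \<noteq> 0}"

definition zeros :: "nat \<Rightarrow> (nat \<Rightarrow> real) \<Rightarrow> nat set" where
  "zeros p \<beta> = {j. j < p \<and> \<beta> j = 0}"

definition lasso_kkt ::
  "nat \<Rightarrow> nat \<Rightarrow> (nat \<times> nat \<Rightarrow> real) \<Rightarrow> (nat \<Rightarrow> real) \<Rightarrow> real \<Rightarrow> (nat \<Rightarrow> real) \<Rightarrow> bool" where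
  "lasso_kkt n p X r lam \<beta> \<longleftrightarrow>
     (\<forall>j<p. if \<beta> j = 0 then \<bar>transp_mat_vec X {..<n} r j\<bar> \<le> real n * lam
            else transp_mat_vec X {..<n} r j = real n * lam * sgn (\<beta> j))"

lemma finite_support [simp]: "finite (support p \<beta>)" and finite_zeros [simp]: "finite (zeros p \<beta>)"
  by (auto simp: support_def zeros_def)

lemma abs_subgradient_iff:
  fixes b c \<mu> :: real
  assumes \<mu>: "0 \<le> \<mu>"
  shows "(\<forall>t. c * t \<le> \<mu> * (\<bar>b + t\<bar> - \<bar>b\<bar>)) \<longleftrightarrow> (if b = 0 then \<bar>c\<bar> \<le> \<mu> else c = \<mu> * sgn b)"
    (is "?subgradient \<longleftrightarrow> ?explicit")
proof
  assume sub: ?subgradient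
  show ?explicit
  proof (cases "b = 0")
    case True
    then show ?thesis using sub[rule_format, of 1] sub[rule_format, of "- 1"] by simp
  next
    case False
    have "c * b = \<mu> * \<bar>b\<bar>"
      using sub[rule_format, of b] sub[rule_format, of "- b"] by (simp add: abs_mult)
    then have "c * b = \<mu> * sgn b * b" by (simp add: abs_sgn mult_ac)
    then show ?thesis using False by simp
  qed
next
  assume explicit: ?explicit
  show ?subgradient
  proof (intro allI, cases "b = 0")
    fix t
    case True
    have "c * t \<le> \<bar>c\<bar> * \<bar>t\<bar>" by (metis abs_ge_self abs_mult)
    also have "\<dots> \<le> \<mu> * \<bar>t\<bar>" using explicit True by (intro mult_right_mono) auto
    finally show "c * t \<le> \<mu> * (\<bar>b + t\<bar> - \<bar>b\<bar>)" using True by simp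
  next
    fix t
    case False
    have "sgn b * t \<le> \<bar>b + t\<bar> - \<bar>b\<bar>" using False by (auto simp: sgn_if)
    then have "\<mu> * (sgn b * t) \<le> \<mu> * (\<bar>b + t\<bar> - \<bar>b\<bar>)" using \<mu> by (rule mult_left_mono)
    then show "c * t \<le> \<mu> * (\<bar>b + t\<bar> - \<bar>b\<bar>)" using explicit False by (simp add: mult.assoc)
  qed
qed

lemma nonneg_of_quadratic_perturbation:
  fixes f :: "real \<Rightarrow> real"
  assumes star: "\<And>\<epsilon>. 0 < \<epsilon> \<Longrightarrow> \<epsilon> \<le> 1 \<Longrightarrow> f (\<epsilon> * t) \<le> \<epsilon> * f t"
    and nonneg: "\<And>u. 0 \<le> u\<^sup>2 * q + f u"
  shows "0 \<le> f t"
proof (rule tendsto_lowerbound)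
  show "((\<lambda>\<epsilon>. \<epsilon> * t\<^sup>2 * q + f t) \<longlongrightarrow> f t) (at_right 0)"
    by (auto intro!: tendsto_eq_intros)
  have "0 \<le> \<epsilon> * t\<^sup>2 * q + f t" if \<epsilon>: "0 < \<epsilon>" "\<epsilon> \<le> 1" for \<epsilon>
  proof -
    have "0 \<le> \<epsilon> * (\<epsilon> * t\<^sup>2 * q + f t)"
      using nonneg[of "\<epsilon> * t"] star[OF \<epsilon>] by (simp add: power2_eq_square algebra_simps)
    then show ?thesis using \<epsilon> by (simp add: zero_le_mult_iff)
  qed
  then show "\<forall>\<^sub>F \<epsilon> in at_right 0. 0 \<le> \<epsilon> * t\<^sup>2 * q + f t"
    using eventually_at_right[of 0 1] by (auto simp: eventually_at_right_field intro!: exI[of _ 1])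
qed simp

lemma lasso_obj_add_diff:
  fixes X :: "nat \<times> nat \<Rightarrow> real" and Y \<beta> h :: "nat \<Rightarrow> real" and n p :: nat and lam :: real
  assumes n: "n > 0"
  defines "r \<equiv> \<lambda>\<beta> i. Y i - mat_vec X {..<p} \<beta> i"
  shows "2 * real n * (lasso_obj n p X Y lam (\<lambda>j. \<beta> j + h j) - lasso_obj n p X Y lam \<beta>)
    = (\<Sum>i<n. (mat_vec X {..<p} h i)\<^sup>2)
      + 2 * (\<Sum>j<p. real n * lam * (\<bar>\<beta> j + h j\<bar> - \<bar>\<beta> j\<bar>) - transp_mat_vec X {..<n} (r \<beta>) j * h j)"
proof -
  have obj: "2 * real n * lasso_obj n p X Y lam \<beta>
      = (\<Sum>i<n. (r \<beta> i)\<^sup>2) + 2 * (real n * lam * (\<Sum>j<p. \<bar>\<beta> j\<bar>))" for \<beta>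
    using n by (simp add: lasso_obj_def r_def mat_vec_def field_simps)
  have "(\<Sum>i<n. (r (\<lambda>j. \<beta> j + h j) i)\<^sup>2)
      = (\<Sum>i<n. (r \<beta> i)\<^sup>2 + (mat_vec X {..<p} h i)\<^sup>2 - 2 * (mat_vec X {..<p} h i * r \<beta> i))"
    by (simp add: r_def mat_vec_add power2_eq_square algebra_simps)
  also have "\<dots> = (\<Sum>i<n. (r \<beta> i)\<^sup>2) + (\<Sum>i<n. (mat_vec X {..<p} h i)\<^sup>2)
      - 2 * (\<Sum>j<p. h j * transp_mat_vec X {..<n} (r \<beta>) j)"
    by (simp add: sum.distrib sum_subtractf mat_vec_adjoint flip: sum_distrib_left)
  finally show ?thesis
    unfolding right_diff_distrib[of "2 * real n"] obj
    by (simp add: sum_subtractf sum.distrib sum_distrib_left algebra_simps)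
qed

lemma lasso_set_imp_subgradient:
  fixes n p :: nat and lam :: real
  assumes n: "n > 0" and lam: "lam \<ge> 0" and \<beta>: "\<beta> \<in> lasso_set n p X Y lam" and j: "j < p"
  shows "transp_mat_vec X {..<n} (residual X {..<p} Y \<beta>) j * t \<le> real n * lam * (\<bar>\<beta> j + t\<bar> - \<bar>\<beta> j\<bar>)"
proof -
  let ?c = "transp_mat_vec X {..<n} (residual X {..<p} Y \<beta>)"
  define f where "f = (\<lambda>t. 2 * (real n * lam * (\<bar>\<beta> j + t\<bar> - \<bar>\<beta> j\<bar>) - ?c j * t))"
  have "0 \<le> f t"
  proof (rule nonneg_of_quadratic_perturbation[where f = f and t = t and q = "\<Sum>i<n. (X (i, j))\<^sup>2"])
    fix \<epsilon> :: real assume \<epsilon>: "0 < \<epsilon>" "\<epsilon> \<le> 1"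
    have "\<bar>(1 - \<epsilon>) * \<beta> j + \<epsilon> * (\<beta> j + t)\<bar> \<le> (1 - \<epsilon>) * \<bar>\<beta> j\<bar> + \<epsilon> * \<bar>\<beta> j + t\<bar>"
      using abs_triangle_ineq[of "(1 - \<epsilon>) * \<beta> j" "\<epsilon> * (\<beta> j + t)"] \<epsilon> by (simp add: abs_mult)
    then have "\<bar>\<beta> j + \<epsilon> * t\<bar> - \<bar>\<beta> j\<bar> \<le> \<epsilon> * (\<bar>\<beta> j + t\<bar> - \<bar>\<beta> j\<bar>)" by (simp add: algebra_simps)
    then have "real n * lam * (\<bar>\<beta> j + \<epsilon> * t\<bar> - \<bar>\<beta> j\<bar>) \<le> real n * lam * (\<epsilon> * (\<bar>\<beta> j + t\<bar> - \<bar>\<beta> j\<bar>))"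
      using lam by (intro mult_left_mono) auto
    then show "f (\<epsilon> * t) \<le> \<epsilon> * f t" by (simp add: f_def algebra_simps)
  next
    fix u :: real
    define h where "h = (\<lambda>k. if k = j then u else 0)"
    have "is_vec p (\<lambda>k. \<beta> k + h k)" using \<beta> j by (auto simp: lasso_set_def is_vec_def h_def)
    then have "0 \<le> 2 * real n * (lasso_obj n p X Y lam (\<lambda>k. \<beta> k + h k) - lasso_obj n p X Y lam \<beta>)"
      using \<beta> by (simp add: lasso_set_def)
    also have "\<dots> = (\<Sum>i<n. (mat_vec X {..<p} h i)\<^sup>2)
        + 2 * (\<Sum>k<p. real n * lam * (\<bar>\<beta> k + h k\<bar> - \<bar>\<beta> k\<bar>) - ?c k * h k)"
      by (rule lasso_obj_add_diff[OF n])
    also have "(\<Sum>k<p. real n * lam * (\<bar>\<beta> k + h k\<bar> - \<bar>\<beta> k\<bar>) - ?c k * h k)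
        = (\<Sum>k<p. if k = j then real n * lam * (\<bar>\<beta> j + u\<bar> - \<bar>\<beta> j\<bar>) - ?c j * u else 0)"
      by (intro sum.cong) (auto simp: h_def)
    also have "(\<Sum>i<n. (mat_vec X {..<p} h i)\<^sup>2) = u\<^sup>2 * (\<Sum>i<n. (X (i, j))\<^sup>2)"
      using j
      by (simp add: mat_vec_def h_def if_distrib power_mult_distrib sum_distrib_left mult.commute
          cong: if_cong)
    finally show "0 \<le> u\<^sup>2 * (\<Sum>i<n. (X (i, j))\<^sup>2) + f u" using j by (simp add: f_def)
  qed
  then show ?thesis by (simp add: f_def)
qed

lemma lasso_set_iff_kkt:
  fixes n p :: nat and lam :: real
  assumes n: "n > 0" and lam: "lam \<ge> 0"
  shows "\<beta> \<in> lasso_set n p X Y lam \<longleftrightarrow>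
    is_vec p \<beta> \<and> lasso_kkt n p X (residual X {..<p} Y \<beta>) lam \<beta>"
proof -
  let ?c = "transp_mat_vec X {..<n} (residual X {..<p} Y \<beta>)"
  have kkt_iff: "lasso_kkt n p X (residual X {..<p} Y \<beta>) lam \<beta>
      \<longleftrightarrow> (\<forall>j<p. \<forall>t. ?c j * t \<le> real n * lam * (\<bar>\<beta> j + t\<bar> - \<bar>\<beta> j\<bar>))"
    using lam by (simp add: lasso_kkt_def abs_subgradient_iff)
  show ?thesis unfolding kkt_iff
  proof (intro iffI conjI)
    assume \<beta>: "\<beta> \<in> lasso_set n p X Y lam"
    then show "is_vec p \<beta>" by (simp add: lasso_set_def)
    show "\<forall>j<p. \<forall>t. ?c j * t \<le> real n * lam * (\<bar>\<beta> j + t\<bar> - \<bar>\<beta> j\<bar>)"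
      using lasso_set_imp_subgradient[OF n lam \<beta>] by simp
  next
    assume *: "is_vec p \<beta> \<and> (\<forall>j<p. \<forall>t. ?c j * t \<le> real n * lam * (\<bar>\<beta> j + t\<bar> - \<bar>\<beta> j\<bar>))"
    have "lasso_obj n p X Y lam \<beta> \<le> lasso_obj n p X Y lam \<beta>'" for \<beta>'
    proof -
      define h where "h = (\<lambda>j. \<beta>' j - \<beta> j)"
      have "0 \<le> (\<Sum>i<n. (mat_vec X {..<p} h i)\<^sup>2)
          + 2 * (\<Sum>j<p. real n * lam * (\<bar>\<beta> j + h j\<bar> - \<bar>\<beta> j\<bar>) - ?c j * h j)"
        using * by (intro add_nonneg_nonneg mult_nonneg_nonneg sum_nonneg) auto
      then have "0 \<le> 2 * real n * (lasso_obj n p X Y lam (\<lambda>j. \<beta> j + h j) - lasso_obj n p X Y lam \<beta>)"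
        unfolding lasso_obj_add_diff[OF n] .
      then show ?thesis using n by (simp add: h_def zero_le_mult_iff)
    qed
    then show "\<beta> \<in> lasso_set n p X Y lam" using * by (simp add: lasso_set_def)
  qed
qed

lemma mat_vec_supported:
  fixes p :: nat
  assumes "\<And>j. j < p \<Longrightarrow> j \<notin> S \<Longrightarrow> w j = 0" and "S \<subseteq> {..<p}"
  shows "mat_vec X {..<p} w = mat_vec X S w"
  unfolding mat_vec_def using assms by (intro ext sum.mono_neutral_right) simp_all

lemma recovery_iff_kkt:
  fixes n p :: nat and lam :: real and \<beta>s :: "nat \<Rightarrow> real"
  assumes n: "n > 0" and lam: "lam \<ge> 0"
  defines "S \<equiv> support p \<beta>s"
  shows "recovery n p X \<beta>s Z lam \<longleftrightarrow>
    (\<exists>w. (\<forall>j\<in>S. sgn (\<beta>s j + w j) = sgn (\<beta>s j)) \<and> lasso_kkt n p X (residual X S Z w) lam \<beta>s)"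
proof -
  define Y where "Y = (\<lambda>i. mat_vec X {..<p} \<beta>s i + Z i)"
  have recovery: "recovery n p X \<beta>s Z lam \<longleftrightarrow>
      (\<exists>\<beta>\<in>lasso_set n p X Y lam. \<forall>j<p. sgn (\<beta> j) = sgn (\<beta>s j))"
    by (simp add: recovery_def Y_def mat_vec_def)
  have kkt: "lasso_kkt n p X (residual X {..<p} Y \<beta>) lam \<beta> \<longleftrightarrow>
      lasso_kkt n p X (residual X S Z (\<lambda>j. \<beta> j - \<beta>s j)) lam \<beta>s"
    if sgn: "\<forall>j<p. sgn (\<beta> j) = sgn (\<beta>s j)" for \<beta>
  proof -
    have zero_iff: "\<beta> j = 0 \<longleftrightarrow> \<beta>s j = 0" if "j < p" for j using sgn that by (metis sgn_0_0)
    then have "mat_vec X {..<p} (\<lambda>j. \<beta> j - \<beta>s j) = mat_vec X S (\<lambda>j. \<beta> j - \<beta>s j)"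
      by (intro mat_vec_supported) (auto simp: S_def support_def)
    then have "residual X {..<p} Y \<beta> = residual X S Z (\<lambda>j. \<beta> j - \<beta>s j)"
      by (simp add: Y_def fun_eq_iff mat_vec_diff algebra_simps)
    then show ?thesis using sgn zero_iff by (simp add: lasso_kkt_def)
  qed
  show ?thesis
  proof
    assume "recovery n p X \<beta>s Z lam"
    then obtain \<beta> where \<beta>: "\<beta> \<in> lasso_set n p X Y lam" "\<forall>j<p. sgn (\<beta> j) = sgn (\<beta>s j)"
      unfolding recovery by blast
    then show "\<exists>w. (\<forall>j\<in>S. sgn (\<beta>s j + w j) = sgn (\<beta>s j))
        \<and> lasso_kkt n p X (residual X S Z w) lam \<beta>s"
      by (intro exI[of _ "\<lambda>j. \<beta> j - \<beta>s j"])
        (auto simp: lasso_set_iff_kkt[OF n lam] kkt S_def support_def)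
  next
    assume "\<exists>w. (\<forall>j\<in>S. sgn (\<beta>s j + w j) = sgn (\<beta>s j)) \<and> lasso_kkt n p X (residual X S Z w) lam \<beta>s"
    then obtain w where w: "\<forall>j\<in>S. sgn (\<beta>s j + w j) = sgn (\<beta>s j)"
      "lasso_kkt n p X (residual X S Z w) lam \<beta>s" by blast
    define \<beta> where "\<beta> = (\<lambda>j. if j \<in> S then \<beta>s j + w j else 0)"
    have sgn: "\<forall>j<p. sgn (\<beta> j) = sgn (\<beta>s j)" using w(1) by (auto simp: \<beta>_def S_def support_def)
    have "mat_vec X S (\<lambda>j. \<beta> j - \<beta>s j) = mat_vec X S w"
      by (simp add: mat_vec_def \<beta>_def fun_eq_iff)
    then have "lasso_kkt n p X (residual X {..<p} Y \<beta>) lam \<beta>"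
      unfolding kkt[OF sgn] using w(2) by simp
    moreover have "is_vec p \<beta>" by (simp add: is_vec_def \<beta>_def S_def support_def)
    ultimately have "\<beta> \<in> lasso_set n p X Y lam" unfolding lasso_set_iff_kkt[OF n lam] by blast
    then show "recovery n p X \<beta>s Z lam" unfolding recovery using sgn by blast
  qed
qed

lemma recovery_merge_iff:
  fixes n p :: nat and lam :: real and \<beta>s :: "nat \<Rightarrow> real"
  assumes n: "n > 0" and lam: "lam \<ge> 0"
  defines "S \<equiv> support p \<beta>s" and "T \<equiv> zeros p \<beta>s"
  shows "recovery n p (merge ({..<n} \<times> S) ({..<n} \<times> T) (x, y)) \<beta>s Z lam \<longleftrightarrow>
    (\<exists>w. (\<forall>j\<in>S. sgn (\<beta>s j + w j) = sgn (\<beta>s j)) \<and>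
      (\<forall>j\<in>S. transp_mat_vec x {..<n} (residual x S Z w) j = real n * lam * sgn (\<beta>s j)) \<and>
      (\<forall>j\<in>T. \<bar>transp_mat_vec y {..<n} (residual x S Z w) j\<bar> \<le> real n * lam))"
proof -
  define X where "X = merge ({..<n} \<times> S) ({..<n} \<times> T) (x, y)"
  have X: "X (i, j) = x (i, j)" if "i < n" "j \<in> S" for i j
    using that by (simp add: X_def merge_def)
  have X': "X (i, j) = y (i, j)" if "i < n" "j \<in> T" for i j
    using that by (auto simp: X_def merge_def S_def T_def support_def zeros_def)
  have residual: "Z i - mat_vec X S w i = Z i - mat_vec x S w i" if "i < n" for w i
    using that by (simp add: mat_vec_def X)
  have "lasso_kkt n p X (residual X S Z w) lam \<beta>s \<longleftrightarrow>
      (\<forall>j\<in>S. transp_mat_vec x {..<n} (residual x S Z w) j = real n * lam * sgn (\<beta>s j)) \<and>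
      (\<forall>j\<in>T. \<bar>transp_mat_vec y {..<n} (residual x S Z w) j\<bar> \<le> real n * lam)" for w
  proof -
    have "transp_mat_vec X {..<n} (residual X S Z w) j
        = transp_mat_vec x {..<n} (residual x S Z w) j" if "j \<in> S" for j
      using that by (simp add: transp_mat_vec_def residual X)
    moreover have "transp_mat_vec X {..<n} (residual X S Z w) j
        = transp_mat_vec y {..<n} (residual x S Z w) j" if "j \<in> T" for j
      using that by (simp add: transp_mat_vec_def residual X')
    ultimately show ?thesis by (auto simp: lasso_kkt_def S_def T_def support_def zeros_def)
  qed
  then show ?thesis unfolding X_def[symmetric] recovery_iff_kkt[OF n lam] S_def[symmetric] by simp
qed

subsection \<open>Normal equations\<close>

lemma mat_vec_insert_upd:
  assumes "finite S" "a \<notin> S"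
  shows "mat_vec x (insert a S) (v(a := t)) = (\<lambda>i. x (i, a) * t + mat_vec x S v i)"
proof -
  have "(\<Sum>j\<in>S. x (i, j) * (v(a := t)) j) = (\<Sum>j\<in>S. x (i, j) * v j)" for i
    using assms by (intro sum.cong) auto
  then show ?thesis using assms by (simp add: mat_vec_def fun_eq_iff)
qed

lemma transp_mat_vec_scale: "transp_mat_vec x R (\<lambda>i. c * y i) = (\<lambda>j. c * transp_mat_vec x R y j)"
  by (simp add: transp_mat_vec_def fun_eq_iff sum_distrib_left mult_ac)

definition gram_solution ::
  "('a \<times> 'b \<Rightarrow> real) \<Rightarrow> 'a set \<Rightarrow> 'b set \<Rightarrow> ('b \<Rightarrow> real) \<Rightarrow> ('b \<Rightarrow> real) \<Rightarrow> bool" where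
  "gram_solution x R S h v \<longleftrightarrow> (\<forall>k\<in>S. transp_mat_vec x R (mat_vec x S v) k = h k)"

abbreviation least_squares_fit ::
  "('a \<times> 'b \<Rightarrow> real) \<Rightarrow> 'a set \<Rightarrow> 'b set \<Rightarrow> ('a \<Rightarrow> real) \<Rightarrow> ('b \<Rightarrow> real) \<Rightarrow> bool" where
  "least_squares_fit x R S y v \<equiv> gram_solution x R S (transp_mat_vec x R y) v"

lemma gram_solutionD:
  "\<lbrakk>gram_solution x R S h v; k \<in> S\<rbrakk> \<Longrightarrow> transp_mat_vec x R (mat_vec x S v) k = h k"
  by (simp add: gram_solution_def)

lemma least_squares_fit_orthogonal:
  assumes "least_squares_fit x R S y v"
  shows "(\<Sum>i\<in>R. mat_vec x S w i * residual x S y v i) = 0"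
  unfolding mat_vec_adjoint using assms by (simp add: transp_mat_vec_diff gram_solutionD)

lemma sum_mult_least_squares_residual:
  assumes "least_squares_fit x R S y v"
  shows "(\<Sum>i\<in>R. y i * residual x S y v i) = (L2_set (residual x S y v) R)\<^sup>2"
proof -
  have "(\<Sum>i\<in>R. y i * residual x S y v i)
      = (\<Sum>i\<in>R. residual x S y v i * residual x S y v i)
        + (\<Sum>i\<in>R. mat_vec x S v i * residual x S y v i)"
    by (simp add: algebra_simps flip: sum.distrib)
  then show ?thesis
    unfolding least_squares_fit_orthogonal[OF assms]
    by (simp add: L2_set_power2 flip: power2_eq_square)
qed

lemma gram_solvable:
  fixes x :: "'a \<times> 'b \<Rightarrow> real"
  assumes "finite S" and "\<And>v. \<exists>j\<in>S. v j \<noteq> 0 \<Longrightarrow> L2_set (mat_vec x S v) R > 0"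
  shows "\<exists>v. gram_solution x R S h v"
  using assms
proof (induction S arbitrary: h rule: finite_induct)
  case empty
  then show ?case by (simp add: gram_solution_def)
next
  case (insert a S)
  note upd = mat_vec_insert_upd[OF insert.hyps, of x]
  have "L2_set (mat_vec x S v) R > 0" if "\<exists>j\<in>S. v j \<noteq> 0" for v
  proof -
    have "L2_set (mat_vec x (insert a S) (v(a := 0))) R > 0"
      using that insert.hyps by (intro insert.prems) auto
    then show ?thesis by (simp add: upd)
  qed
  note IH = insert.IH[OF this]
  obtain z where z: "least_squares_fit x R S (\<lambda>i. x (i, a)) z" using IH by blast
  define e where "e = residual x S (\<lambda>i. x (i, a)) z"
  have orth: "transp_mat_vec x R e k = 0" if "k \<in> S" for k
    using gram_solutionD[OF z that] by (simp add: e_def transp_mat_vec_diff)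
  have e_a: "transp_mat_vec x R e a = (L2_set e R)\<^sup>2"
    using sum_mult_least_squares_residual[OF z] by (simp add: e_def transp_mat_vec_def)
  define w where "w = (\<lambda>j. - 1 * z j)(a := 1)"
  have "mat_vec x (insert a S) w = e"
    unfolding w_def upd mat_vec_scale by (simp add: e_def)
  moreover have "w a \<noteq> 0" by (simp add: w_def)
  ultimately have e_pos: "L2_set e R > 0" using insert.prems[of w] by auto
  obtain y where y: "gram_solution x R S h y" using IH by blast
  define t where "t = (h a - transp_mat_vec x R (mat_vec x S y) a) / (L2_set e R)\<^sup>2"
  define v where "v = (\<lambda>j. y j - t * z j)(a := t)"
  have "mat_vec x (insert a S) v = (\<lambda>i. mat_vec x S y i + t * e i)"
    unfolding v_def upd mat_vec_diff mat_vec_scale by (simp add: e_def algebra_simps)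
  then have "transp_mat_vec x R (mat_vec x (insert a S) v) k
      = transp_mat_vec x R (mat_vec x S y) k + t * transp_mat_vec x R e k" for k
    by (simp add: transp_mat_vec_add transp_mat_vec_scale)
  then have "gram_solution x R (insert a S) h v"
    using gram_solutionD[OF y] orth e_a e_pos by (simp add: gram_solution_def t_def)
  then show ?case by blast
qed

lemma gram_solvable_of_lower_bound:
  assumes "finite S" and \<kappa>: "\<kappa> > 0" and low: "\<And>v. \<kappa> * L2_set v S \<le> L2_set (mat_vec x S v) R"
  shows "\<exists>v. gram_solution x R S h v"
proof (rule gram_solvable[OF assms(1)])
  fix v :: "_ \<Rightarrow> real" assume "\<exists>j\<in>S. v j \<noteq> 0"
  then have "L2_set v S \<noteq> 0" using \<open>finite S\<close> by (simp add: L2_set_eq_0_iff)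
  then have "0 < \<kappa> * L2_set v S" using \<kappa> L2_set_nonneg[of v S] by (simp add: less_le)
  then show "L2_set (mat_vec x S v) R > 0" using low[of v] by linarith
qed

lemma gram_solution_bounds:
  assumes \<kappa>: "\<kappa> > 0" and low: "\<And>v. \<kappa> * L2_set v S \<le> L2_set (mat_vec x S v) R"
    and v: "gram_solution x R S h v"
  shows "L2_set v S \<le> L2_set h S / \<kappa>\<^sup>2" and "L2_set (mat_vec x S v) R \<le> L2_set h S / \<kappa>"
proof -
  have sq_le: "(L2_set (mat_vec x S v) R)\<^sup>2 \<le> L2_set v S * L2_set h S"
  proof -
    have "(L2_set (mat_vec x S v) R)\<^sup>2 = (\<Sum>k\<in>S. v k * h k)"
      unfolding L2_set_power2 unfolding power2_eq_square mat_vec_adjoint using gram_solutionD[OF v]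
      by simp
    also have "\<dots> \<le> L2_set v S * L2_set h S" using abs_sum_mult_le_L2_set[of v h S] by linarith
    finally show ?thesis .
  qed
  have "(\<kappa> * L2_set v S)\<^sup>2 \<le> (L2_set (mat_vec x S v) R)\<^sup>2" using low \<kappa> by (intro power_mono) auto
  then have "L2_set v S * (\<kappa>\<^sup>2 * L2_set v S) \<le> L2_set v S * L2_set h S"
    using sq_le by (simp add: power2_eq_square mult_ac)
  then have "\<kappa>\<^sup>2 * L2_set v S \<le> L2_set h S"
    using L2_set_nonneg[of v S] by (cases "L2_set v S = 0") auto
  then show v_le: "L2_set v S \<le> L2_set h S / \<kappa>\<^sup>2" using \<kappa> by (simp add: field_simps)
  have "(L2_set (mat_vec x S v) R)\<^sup>2 \<le> L2_set h S / \<kappa>\<^sup>2 * L2_set h S"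
    using sq_le mult_right_mono[OF v_le, of "L2_set h S"] by simp
  also have "\<dots> = (L2_set h S / \<kappa>)\<^sup>2" by (simp add: power2_eq_square)
  finally show "L2_set (mat_vec x S v) R \<le> L2_set h S / \<kappa>"
    by (rule power2_le_imp_le) (use \<kappa> in simp)
qed

lemma approx_isometry_gram_solvable:
  assumes x: "approx_isometry \<delta> R S x" and "finite S" "\<delta> < 1" "card R > 0"
  shows "\<exists>v. gram_solution x R S h v"
  using assms
  by (intro gram_solvable_of_lower_bound[of S "(1 - \<delta>) * sqrt (card R)"])
    (auto simp: approx_isometry_def)

lemma approx_isometry_gram_solution_bounds:
  assumes x: "approx_isometry \<delta> R S x" and "\<delta> < 1" "card R > 0"
    and v: "gram_solution x R S h v"
  shows "L2_set v S \<le> L2_set h S / ((1 - \<delta>)\<^sup>2 * card R)"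
    and "(L2_set (mat_vec x S v) R)\<^sup>2 \<le> (L2_set h S)\<^sup>2 / ((1 - \<delta>)\<^sup>2 * card R)"
proof -
  define \<kappa> where "\<kappa> = (1 - \<delta>) * sqrt (card R)"
  have \<kappa>: "\<kappa> > 0" "\<kappa>\<^sup>2 = (1 - \<delta>)\<^sup>2 * card R" using assms by (simp_all add: \<kappa>_def power_mult_distrib)
  have "\<kappa> * L2_set v S \<le> L2_set (mat_vec x S v) R" for v
    using x by (simp add: approx_isometry_def \<kappa>_def)
  note bounds = gram_solution_bounds[OF \<kappa>(1) this v]
  show "L2_set v S \<le> L2_set h S / ((1 - \<delta>)\<^sup>2 * card R)" using bounds(1) by (simp add: \<kappa>(2))
  have "(L2_set (mat_vec x S v) R)\<^sup>2 \<le> (L2_set h S / \<kappa>)\<^sup>2" using bounds(2) by (intro power_mono) auto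
  then show "(L2_set (mat_vec x S v) R)\<^sup>2 \<le> (L2_set h S)\<^sup>2 / ((1 - \<delta>)\<^sup>2 * card R)"
    by (simp add: power_divide \<kappa>(2))
qed

lemma gram_dual_coordinate:
  assumes S: "finite S" "j \<in> S"
    and u: "gram_solution x R S (\<lambda>k. if k = j then 1 else 0) u"
    and v: "least_squares_fit x R S y v"
  shows "v j = (\<Sum>i\<in>R. mat_vec x S u i * y i)"
proof -
  have "v j = (\<Sum>k\<in>S. if k = j then v k else 0)" using S by simp
  also have "\<dots> = (\<Sum>k\<in>S. v k * transp_mat_vec x R (mat_vec x S u) k)"
    using gram_solutionD[OF u] by (intro sum.cong) auto
  also have "\<dots> = (\<Sum>i\<in>R. mat_vec x S u i * mat_vec x S v i)"
    by (simp add: mult.commute flip: mat_vec_adjoint)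
  also have "\<dots> = (\<Sum>i\<in>R. mat_vec x S u i * y i)"
    unfolding mat_vec_adjoint using gram_solutionD[OF v] by simp
  finally show ?thesis .
qed

lemma normal_equations_fit_unique:
  assumes R: "finite R"
    and eq: "\<And>k. k \<in> S
        \<Longrightarrow> transp_mat_vec x R (residual x S Z v) k = transp_mat_vec x R (residual x S Z w) k"
    and i: "i \<in> R"
  shows "mat_vec x S v i = mat_vec x S w i"
proof -
  let ?d = "mat_vec x S (\<lambda>j. v j - w j)"
  have "transp_mat_vec x R ?d k = 0" if "k \<in> S" for k
    using eq[OF that] by (simp add: mat_vec_diff transp_mat_vec_diff)
  then have "(\<Sum>i\<in>R. ?d i * ?d i) = 0" unfolding mat_vec_adjoint by simp
  then have "?d i = 0" using R i by (simp add: sum_nonneg_eq_0_iff)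
  then show ?thesis by (simp add: mat_vec_diff)
qed

lemma least_squares_residual_norm_le:
  assumes v: "least_squares_fit x R S y v"
  shows "(L2_set (\<lambda>i. residual x S y v i + mat_vec x S g i) R)\<^sup>2
    \<le> (L2_set y R)\<^sup>2 + (L2_set (mat_vec x S g) R)\<^sup>2"
proof -
  let ?e = "residual x S y v"
  have "(L2_set (\<lambda>i. ?e i + mat_vec x S g i) R)\<^sup>2
      = (\<Sum>i\<in>R. (y i)\<^sup>2 - (mat_vec x S v i)\<^sup>2 + (mat_vec x S g i)\<^sup>2
          + 2 * (mat_vec x S g i * ?e i) - 2 * (mat_vec x S v i * ?e i))"
    unfolding L2_set_power2 by (intro sum.cong) (auto simp: power2_eq_square algebra_simps)
  also have "\<dots> = (L2_set y R)\<^sup>2 - (L2_set (mat_vec x S v) R)\<^sup>2 + (L2_set (mat_vec x S g) R)\<^sup>2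
      + 2 * (\<Sum>i\<in>R. mat_vec x S g i * ?e i) - 2 * (\<Sum>i\<in>R. mat_vec x S v i * ?e i)"
    by (simp only: L2_set_power2 sum.distrib sum_subtractf sum_distrib_left)
  finally show ?thesis unfolding least_squares_fit_orthogonal[OF v] by simp
qed

subsection \<open>Measurability of recovery\<close>

lemma compact_ex_le_iff_dense:
  fixes f :: "'b :: metric_space \<Rightarrow> real"
  assumes K: "compact K" and D: "D \<subseteq> K" "K \<subseteq> closure D" and cont: "continuous_on K f"
  shows "(\<exists>b\<in>K. f b \<le> c) \<longleftrightarrow> (\<forall>k::nat. \<exists>d\<in>D. f d < c + 1 / Suc k)"
proof
  assume "\<exists>b\<in>K. f b \<le> c"
  then obtain b where b: "b \<in> K" "f b \<le> c" by blast
  show "\<forall>k::nat. \<exists>d\<in>D. f d < c + 1 / Suc k"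
  proof
    fix k :: nat
    obtain \<delta> where \<delta>: "\<delta> > 0" "\<And>d. d \<in> K \<Longrightarrow> dist d b < \<delta> \<Longrightarrow> dist (f d) (f b) < 1 / Suc k"
      using cont[unfolded continuous_on_iff, rule_format, OF b(1), of "1 / Suc k"] by auto
    obtain d where d: "d \<in> D" "dist d b < \<delta>"
      using D(2) b(1) \<delta>(1) by (meson closure_approachable subsetD)
    have "dist (f d) (f b) < 1 / Suc k" using \<delta>(2) d D(1) by blast
    then show "\<exists>d\<in>D. f d < c + 1 / Suc k"
      using d(1) b(2) by (intro bexI[of _ d]) (auto simp: dist_real_def)
  qed
next
  assume approx: "\<forall>k::nat. \<exists>d\<in>D. f d < c + 1 / Suc k"
  then have "K \<noteq> {}" using D(1) by blast
  then obtain b where b: "b \<in> K" "\<And>d. d \<in> K \<Longrightarrow> f b \<le> f d"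
    using continuous_attains_inf[OF K _ cont] by blast
  have le: "f b \<le> c + 1 / Suc k" for k
    using approx b(2) D(1) by (meson less_imp_le order_trans subsetD)
  have "f b \<le> c"
  proof (rule field_le_epsilon)
    fix \<epsilon> :: real assume "0 < \<epsilon>"
    then obtain k where "1 / real (Suc k) < \<epsilon>" by (rule nat_approx_posE)
    then show "f b \<le> c + \<epsilon>" using le[of k] by linarith
  qed
  then show "\<exists>b\<in>K. f b \<le> c" using b(1) by blast
qed

lemma sets_ex_le_compact:
  fixes K :: "'b :: {metric_space, second_countable_topology} set" and F :: "'a \<Rightarrow> 'b \<Rightarrow> real"
  assumes K: "compact K"
    and cont: "\<And>w. w \<in> space M \<Longrightarrow> continuous_on K (F w)"
    and meas: "\<And>b. b \<in> K \<Longrightarrow> (\<lambda>w. F w b) \<in> borel_measurable M"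
  shows "{w \<in> space M. \<exists>b\<in>K. F w b \<le> c} \<in> sets M"
proof -
  obtain D where D: "countable D" "D \<subseteq> K" "K \<subseteq> closure D" by (rule separable)
  have "(\<exists>b\<in>K. F w b \<le> c) \<longleftrightarrow> (\<forall>k::nat. \<exists>d\<in>D. F w d < c + 1 / Suc k)" if "w \<in> space M" for w
    by (rule compact_ex_le_iff_dense[OF K D(2,3) cont[OF that]])
  then have "{w \<in> space M. \<exists>b\<in>K. F w b \<le> c} = {w \<in> space M. \<forall>k::nat. \<exists>d\<in>D. F w d < c + 1 / Suc k}"
    by (intro Collect_cong conj_cong refl)
  also have "\<dots> = (\<Inter>k::nat. \<Union>d\<in>D. {w \<in> space M. F w d < c + 1 / Suc k})" by auto
  also have "\<dots> \<in> sets M"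
  proof (intro sets.countable_INT sets.countable_UN' image_subsetI D(1))
    fix k d assume "d \<in> D"
    then have [measurable]: "(\<lambda>w. F w d) \<in> borel_measurable M" using D(2) by (intro meas) auto
    show "{w \<in> space M. F w d < c + 1 / Suc k} \<in> sets M" by measurable
  qed simp
  finally show ?thesis .
qed

lemma compact_product_UNIV:
  fixes K :: "'a \<Rightarrow> 'b :: topological_space set"
  assumes "\<And>j. compact (K j)"
  shows "compact {b. \<forall>j. b j \<in> K j}"
proof -
  have "{b. \<forall>j. b j \<in> K j} = PiE UNIV K" by (auto simp: PiE_UNIV_domain)
  moreover have "compactin (product_topology (\<lambda>_. euclidean) UNIV) (PiE UNIV K)"
    unfolding compactin_PiE using assms by auto
  ultimately show ?thesis by (simp add: euclidean_product_topology)
qed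

definition sgn_interval :: "nat \<Rightarrow> real \<Rightarrow> real set" where
  "sgn_interval m b = (\<lambda>t. sgn b * t) ` {1 / Suc m..Suc m}"

definition sgn_box :: "nat \<Rightarrow> ('a \<Rightarrow> real) \<Rightarrow> ('a \<Rightarrow> real) set" where
  "sgn_box m \<beta> = {b. \<forall>j. b j \<in> sgn_interval m (\<beta> j)}"

lemma sgn_eq_of_mem_sgn_interval: "t \<in> sgn_interval m b \<Longrightarrow> sgn t = sgn b"
proof -
  assume "t \<in> sgn_interval m b"
  then obtain r where r: "1 / Suc m \<le> r" "t = sgn b * r" by (auto simp: sgn_interval_def)
  have "0 < 1 / real (Suc m)" by simp
  then have "r > 0" using r(1) by linarith
  then show ?thesis by (simp add: r(2) sgn_mult)
qed

lemma zero_mem_sgn_interval: "0 \<in> sgn_interval m 0"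
  unfolding sgn_interval_def by (rule image_eqI[of _ _ 1]) (simp_all add: divide_le_eq)

lemma eventually_mem_sgn_interval:
  assumes "sgn t = sgn b" "b \<noteq> 0"
  shows "\<forall>\<^sub>F m in sequentially. t \<in> sgn_interval m b"
proof -
  have "t \<noteq> 0" using assms by (metis sgn_0_0)
  then have "\<forall>\<^sub>F m in sequentially. 1 / real (Suc m) < \<bar>t\<bar>"
    by (intro order_tendstoD(2)[OF LIMSEQ_Suc[OF lim_1_over_n]]) simp
  moreover have "\<forall>\<^sub>F m in sequentially. \<bar>t\<bar> \<le> real m"
    using filterlim_real_sequentially unfolding filterlim_at_top by blast
  ultimately show ?thesis
  proof eventually_elim
    case (elim m)
    have "t = sgn b * \<bar>t\<bar>" using assms(1) by (simp add: sgn_mult_abs flip: assms(1))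
    then show ?case unfolding sgn_interval_def using elim by (intro image_eqI[of _ _ "\<bar>t\<bar>"]) auto
  qed
qed

lemma compact_sgn_box: "compact (sgn_box m \<beta>)"
  unfolding sgn_box_def sgn_interval_def
  by (intro compact_product_UNIV compact_continuous_image continuous_intros compact_Icc)

lemma UN_sgn_box_eq:
  assumes fin: "finite {j. \<beta> j \<noteq> 0}"
  shows "(\<Union>m. sgn_box m \<beta>) = {b. \<forall>j. sgn (b j) = sgn (\<beta> j)}"
proof (intro equalityI subsetI)
  fix b assume "b \<in> (\<Union>m. sgn_box m \<beta>)"
  then show "b \<in> {b. \<forall>j. sgn (b j) = sgn (\<beta> j)}"
    using sgn_eq_of_mem_sgn_interval by (auto simp: sgn_box_def)
next
  fix b assume "b \<in> {b. \<forall>j. sgn (b j) = sgn (\<beta> j)}"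
  then have b: "sgn (b j) = sgn (\<beta> j)" for j by simp
  have "\<forall>\<^sub>F m in sequentially. \<forall>j\<in>{j. \<beta> j \<noteq> 0}. b j \<in> sgn_interval m (\<beta> j)"
    using b by (intro eventually_ball_finite fin ballI eventually_mem_sgn_interval) auto
  then obtain m where m: "\<And>j. \<beta> j \<noteq> 0 \<Longrightarrow> b j \<in> sgn_interval m (\<beta> j)"
    by (auto simp: eventually_sequentially)
  have "b j \<in> sgn_interval m (\<beta> j)" for j
  proof (cases "\<beta> j = 0")
    case True
    then have "b j = 0" using b[of j] by (simp add: sgn_0_0)
    then show ?thesis using True zero_mem_sgn_interval by simp
  qed (rule m)
  then show "b \<in> (\<Union>m. sgn_box m \<beta>)" by (auto simp: sgn_box_def)
qed

lemma borel_measurable_mat_vec: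
  assumes "\<And>j. j \<in> S \<Longrightarrow> (\<lambda>w. X w (i, j)) \<in> borel_measurable M"
  shows "(\<lambda>w. mat_vec (X w) S v i) \<in> borel_measurable M"
  unfolding mat_vec_def using assms by (intro borel_measurable_sum borel_measurable_times) auto

lemma borel_measurable_transp_mat_vec:
  assumes "\<And>i. i \<in> R \<Longrightarrow> (\<lambda>w. X w (i, j)) \<in> borel_measurable M"
    "\<And>i. i \<in> R \<Longrightarrow> (\<lambda>w. r w i) \<in> borel_measurable M"
  shows "(\<lambda>w. transp_mat_vec (X w) R (r w) j) \<in> borel_measurable M"
  unfolding transp_mat_vec_def using assms
  by (intro borel_measurable_sum borel_measurable_times) auto

definition kkt_violation ::
  "nat \<Rightarrow> nat \<Rightarrow> (nat \<times> nat \<Rightarrow> real) \<Rightarrow> (nat \<Rightarrow> real) \<Rightarrow> real \<Rightarrow> (nat \<Rightarrow> real) \<Rightarrow> real" where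
  "kkt_violation n p X r lam \<beta> =
     (\<Sum>j<p. max 0 (\<bar>transp_mat_vec X {..<n} r j - real n * lam * sgn (\<beta> j)\<bar>
       - (if \<beta> j = 0 then real n * lam else 0)))"

lemma lasso_kkt_iff_violation: "lasso_kkt n p X r lam \<beta> \<longleftrightarrow> kkt_violation n p X r lam \<beta> \<le> 0"
proof -
  have "kkt_violation n p X r lam \<beta> \<ge> 0" unfolding kkt_violation_def by (intro sum_nonneg) simp
  then have "kkt_violation n p X r lam \<beta> \<le> 0 \<longleftrightarrow> kkt_violation n p X r lam \<beta> = 0" by linarith
  also have "\<dots> \<longleftrightarrow> (\<forall>j<p. \<bar>transp_mat_vec X {..<n} r j - real n * lam * sgn (\<beta> j)\<bar>
      \<le> (if \<beta> j = 0 then real n * lam else 0))"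
  proof -
    have "max 0 a = 0 \<longleftrightarrow> a \<le> 0" for a :: real by linarith
    then show ?thesis unfolding kkt_violation_def by (subst sum_nonneg_eq_0_iff) auto
  qed
  also have "\<dots> \<longleftrightarrow> lasso_kkt n p X r lam \<beta>"
    unfolding lasso_kkt_def by (intro all_cong1 imp_cong) auto
  finally show ?thesis ..
qed

lemma borel_measurable_kkt_violation:
  assumes "\<And>i j. i < n \<Longrightarrow> j < p \<Longrightarrow> (\<lambda>w. X w (i, j)) \<in> borel_measurable M"
    and "\<And>i. i < n \<Longrightarrow> (\<lambda>w. r w i) \<in> borel_measurable M"
  shows "(\<lambda>w. kkt_violation n p (X w) (r w) lam \<beta>) \<in> borel_measurable M"
  unfolding kkt_violation_def using assms
  by (intro borel_measurable_sum borel_measurable_max borel_measurable_diff borel_measurable_abs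
      borel_measurable_const borel_measurable_transp_mat_vec) auto

lemma recovery_iff_sgn_box:
  fixes n p :: nat and lam :: real and \<beta>s :: "nat \<Rightarrow> real"
  assumes n: "n > 0" and lam: "lam \<ge> 0"
  defines "S \<equiv> support p \<beta>s"
  shows "recovery n p X \<beta>s Z lam \<longleftrightarrow>
    (\<exists>m. \<exists>b\<in>sgn_box m (\<lambda>j. if j \<in> S then \<beta>s j else 0).
      kkt_violation n p X (residual X S Z (\<lambda>j. b j - \<beta>s j)) lam \<beta>s \<le> 0)"
    (is "_ \<longleftrightarrow> (\<exists>m. \<exists>b\<in>sgn_box m ?\<beta>. ?ok b)")
proof -
  have "finite {j. ?\<beta> j \<noteq> 0}" by (rule finite_subset[of _ S]) (auto simp: S_def)
  note boxes = UN_sgn_box_eq[OF this]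
  have "(\<exists>w. (\<forall>j\<in>S. sgn (\<beta>s j + w j) = sgn (\<beta>s j)) \<and> lasso_kkt n p X (residual X S Z w) lam \<beta>s)
      \<longleftrightarrow> (\<exists>b. (\<forall>j. sgn (b j) = sgn (?\<beta> j)) \<and> ?ok b)"
  proof
    assume "\<exists>w. (\<forall>j\<in>S. sgn (\<beta>s j + w j) = sgn (\<beta>s j)) \<and> lasso_kkt n p X (residual X S Z w) lam \<beta>s"
    then obtain w where w: "\<forall>j\<in>S. sgn (\<beta>s j + w j) = sgn (\<beta>s j)"
      "lasso_kkt n p X (residual X S Z w) lam \<beta>s" by blast
    define b where "b = (\<lambda>j. if j \<in> S then \<beta>s j + w j else 0)"
    have "mat_vec X S (\<lambda>j. b j - \<beta>s j) = mat_vec X S w" by (simp add: mat_vec_def b_def fun_eq_iff)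
    then have "?ok b" using w(2) by (simp flip: lasso_kkt_iff_violation)
    moreover have "\<forall>j. sgn (b j) = sgn (?\<beta> j)" using w(1) by (simp add: b_def)
    ultimately show "\<exists>b. (\<forall>j. sgn (b j) = sgn (?\<beta> j)) \<and> ?ok b" by blast
  next
    assume "\<exists>b. (\<forall>j. sgn (b j) = sgn (?\<beta> j)) \<and> ?ok b"
    then obtain b where b: "\<forall>j. sgn (b j) = sgn (?\<beta> j)" "?ok b" by blast
    have "\<forall>j\<in>S. sgn (\<beta>s j + (b j - \<beta>s j)) = sgn (\<beta>s j)" using b(1) by simp
    with b(2) show "\<exists>w. (\<forall>j\<in>S. sgn (\<beta>s j + w j) = sgn (\<beta>s j))
        \<and> lasso_kkt n p X (residual X S Z w) lam \<beta>s"
      unfolding lasso_kkt_iff_violation by (intro exI[of _ "\<lambda>j. b j - \<beta>s j"]) simp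
  qed
  also have "\<dots> \<longleftrightarrow> (\<exists>b\<in>(\<Union>m. sgn_box m ?\<beta>). ?ok b)" unfolding boxes by blast
  also have "\<dots> \<longleftrightarrow> (\<exists>m. \<exists>b\<in>sgn_box m ?\<beta>. ?ok b)" by blast
  finally show ?thesis unfolding recovery_iff_kkt[OF n lam] S_def .
qed

text \<open>Since \<^const>\<open>measure\<close> vanishes on non-measurable sets, a lower bound on the recovery probability
  needs measurability of the event, which is a countable union of projections along compact boxes
  exhausting the open orthant of \<open>\<beta>\<^sup>*\<close>.\<close>

lemma sets_recovery:
  fixes c :: "nat \<Rightarrow> real" and n p :: nat
  assumes n: "n > 0" and lam: "lam \<ge> 0"
  defines "M \<equiv> std_gauss_vec ({..<n} \<times> {..<p}) \<Otimes>\<^sub>M std_gauss_vec {..<n}"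
  shows "{w \<in> space M. recovery n p (fst w) \<beta>s (\<lambda>i. c i * snd w i) lam} \<in> sets M"
proof -
  define S where "S = support p \<beta>s"
  define r where "r = (\<lambda>w b i. c i * snd w i - mat_vec (fst w) S (\<lambda>j. b j - \<beta>s j) i)"
  define F where "F = (\<lambda>w b. kkt_violation n p (fst w) (r w b) lam \<beta>s)"
  define K where "K = (\<lambda>m. sgn_box m (\<lambda>j. if j \<in> S then \<beta>s j else 0))"
  have "{w \<in> space M. recovery n p (fst w) \<beta>s (\<lambda>i. c i * snd w i) lam}
      = (\<Union>m. {w \<in> space M. \<exists>b\<in>K m. F w b \<le> 0})"
    unfolding recovery_iff_sgn_box[OF n lam] K_def F_def r_def S_def by blast
  also have "\<dots> \<in> sets M"
  proof (intro sets.countable_UN image_subsetI sets_ex_le_compact)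
    fix m
    show "compact (K m)" unfolding K_def by (rule compact_sgn_box)
    have [continuous_intros]: "continuous_on (K m) (\<lambda>b. b k)" for k
      by (rule continuous_on_subset[OF continuous_on_product_coordinates]) simp
    show "continuous_on (K m) (F w)" for w
      unfolding F_def kkt_violation_def r_def mat_vec_def transp_mat_vec_def
      by (intro continuous_intros)
  next
    fix b
    have X: "(\<lambda>w. fst w (i, j)) \<in> borel_measurable M" if "i < n" "j < p" for i j
      unfolding M_def using that
      by (intro measurable_compose[OF measurable_fst borel_measurable_component]) simp
    have W: "(\<lambda>w. snd w i) \<in> borel_measurable M" if "i < n" for i
      unfolding M_def using that
      by (intro measurable_compose[OF measurable_snd borel_measurable_component]) simp
    have r: "(\<lambda>w. r w b i) \<in> borel_measurable M" if "i < n" for i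
      unfolding r_def using that
      by (intro borel_measurable_diff borel_measurable_times borel_measurable_const W
          borel_measurable_mat_vec X)
        (auto simp: S_def support_def)
    show "(\<lambda>w. F w b) \<in> borel_measurable M"
      unfolding F_def by (intro borel_measurable_kkt_violation X r)
  qed
  finally show ?thesis .
qed

subsection \<open>Conditioning on a block of coordinates\<close>

lemma measurable_merge_std_gauss_vec:
  "merge I J \<in> std_gauss_vec I \<Otimes>\<^sub>M std_gauss_vec J \<rightarrow>\<^sub>M std_gauss_vec (I \<union> J)"
  unfolding std_gauss_vec_def by (rule measurable_merge)

lemma emeasure_std_gauss_vec_iterated:
  assumes fin: "finite I" "finite J" "I \<inter> J = {}" and N: "prob_space N"
    and A: "A \<in> sets (std_gauss_vec (I \<union> J) \<Otimes>\<^sub>M N)"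
  defines "slice \<equiv> \<lambda>x w. {y \<in> space (std_gauss_vec J). (merge I J (x, y), w) \<in> A}"
  shows "emeasure (std_gauss_vec (I \<union> J) \<Otimes>\<^sub>M N) A
    = (\<integral>\<^sup>+x. \<integral>\<^sup>+w. emeasure (std_gauss_vec J) (slice x w) \<partial>N \<partial>std_gauss_vec I)"
proof -
  interpret N: prob_space N by (rule N)
  interpret J: prob_space "std_gauss_vec J" by (rule prob_space_std_gauss_vec)
  interpret JN: pair_sigma_finite "std_gauss_vec J" N ..
  interpret D: prob_space "density lborel std_normal_density"
    by (rule prob_space_normal_density) simp
  interpret prod: product_sigma_finite "\<lambda>_. density lborel std_normal_density" by standard
  have "emeasure (std_gauss_vec (I \<union> J) \<Otimes>\<^sub>M N) A
      = (\<integral>\<^sup>+z. emeasure N (Pair z -` A) \<partial>std_gauss_vec (I \<union> J))"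
    by (rule N.emeasure_pair_measure_alt[OF A])
  also have "\<dots> = (\<integral>\<^sup>+x. \<integral>\<^sup>+y. emeasure N (Pair (merge I J (x, y)) -` A)
      \<partial>std_gauss_vec J \<partial>std_gauss_vec I)"
    using prod.product_nn_integral_fold[OF fin(3,1,2)] N.measurable_emeasure_Pair[OF A]
    by (simp flip: std_gauss_vec_def)
  also have "\<dots> = (\<integral>\<^sup>+x. \<integral>\<^sup>+w. emeasure (std_gauss_vec J) (slice x w) \<partial>N \<partial>std_gauss_vec I)"
  proof (rule nn_integral_cong)
    fix x assume x: "x \<in> space (std_gauss_vec I)"
    let ?E = "{z \<in> space (std_gauss_vec J \<Otimes>\<^sub>M N). (merge I J (x, fst z), snd z) \<in> A}"
    note [measurable] = measurable_merge_std_gauss_vec A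
    have "(\<lambda>z. (merge I J (x, fst z), snd z))
        \<in> std_gauss_vec J \<Otimes>\<^sub>M N \<rightarrow>\<^sub>M std_gauss_vec (I \<union> J) \<Otimes>\<^sub>M N"
      using x by measurable
    then have E: "?E \<in> sets (std_gauss_vec J \<Otimes>\<^sub>M N)" by measurable
    have "Pair y -` ?E = Pair (merge I J (x, y)) -` A" if "y \<in> space (std_gauss_vec J)" for y
      using that sets.sets_into_space[OF A] by (auto simp: space_pair_measure)
    then have "(\<integral>\<^sup>+y. emeasure N (Pair (merge I J (x, y)) -` A) \<partial>std_gauss_vec J)
        = emeasure (std_gauss_vec J \<Otimes>\<^sub>M N) ?E"
      unfolding N.emeasure_pair_measure_alt[OF E] by (intro nn_integral_cong) simp
    also have "\<dots> = (\<integral>\<^sup>+w. emeasure (std_gauss_vec J) ((\<lambda>y. (y, w)) -` ?E) \<partial>N)"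
      by (rule JN.emeasure_pair_measure_alt2[OF E])
    also have "\<dots> = (\<integral>\<^sup>+w. emeasure (std_gauss_vec J) (slice x w) \<partial>N)"
      by (intro nn_integral_cong arg_cong[of _ _ "emeasure (std_gauss_vec J)"])
        (auto simp: slice_def space_pair_measure)
    finally show "(\<integral>\<^sup>+y. emeasure N (Pair (merge I J (x, y)) -` A) \<partial>std_gauss_vec J)
        = (\<integral>\<^sup>+w. emeasure (std_gauss_vec J) (slice x w) \<partial>N)" .
  qed
  finally show ?thesis .
qed

lemma (in prob_space) nn_integral_le_add_prob:
  assumes B: "B \<in> events" and e: "0 \<le> e"
    and f: "\<And>x. x \<in> space M \<Longrightarrow> f x \<le> 1" "\<And>x. x \<in> space M \<Longrightarrow> x \<notin> B \<Longrightarrow> f x \<le> ennreal e"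
  shows "(\<integral>\<^sup>+x. f x \<partial>M) \<le> ennreal (e + prob B)"
proof -
  have "(\<integral>\<^sup>+x. f x \<partial>M) \<le> (\<integral>\<^sup>+x. ennreal e + indicator B x \<partial>M)"
    using f by (intro nn_integral_mono) (auto simp: indicator_def add_increasing)
  also have "\<dots> = ennreal e + emeasure M B"
    using B by (subst nn_integral_add) (auto simp: emeasure_space_1)
  also have "\<dots> = ennreal (e + prob B)" using e by (simp add: emeasure_eq_measure)
  finally show ?thesis .
qed

subsection \<open>Independent Gaussian columns against a fixed vector\<close>

lemma transp_mat_vec_eq_linear_form:
  "transp_mat_vec y R r j = (\<Sum>z\<in>R \<times> {j}. r (fst z) * y z)"
  by (simp add: transp_mat_vec_def sum_column mult.commute)

lemma L2_set_column: "L2_set (\<lambda>z. r (fst z)) (R \<times> {j}) = L2_set r R"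
  by (simp add: L2_set_def sum_column)

lemma borel_measurable_column:
  assumes "j \<in> T"
  shows "(\<lambda>y. transp_mat_vec y R r j) \<in> borel_measurable (std_gauss_vec (R \<times> T))"
  unfolding transp_mat_vec_eq_linear_form using assms by (intro borel_measurable_linear_form) auto

lemma prob_ex_column_ge:
  assumes fin: "finite R" "finite T" and V: "V > 0" "(L2_set r R)\<^sup>2 \<le> V" and b: "b \<ge> 0"
  defines "E \<equiv> {y \<in> space (std_gauss_vec (R \<times> T)). \<exists>j\<in>T. b \<le> \<bar>transp_mat_vec y R r j\<bar>}"
  shows "E \<in> sets (std_gauss_vec (R \<times> T))"
    and "measure (std_gauss_vec (R \<times> T)) E \<le> card T * (2 * exp (- b\<^sup>2 / (2 * V)))"
  unfolding E_def transp_mat_vec_eq_linear_form using assms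
  by (intro prob_ex_linear_form_ge; auto simp: L2_set_column)+

lemma prob_all_columns_le:
  assumes fin: "finite R" "finite T" and v: "0 < v" "v \<le> L2_set r R" and b: "b \<ge> 0"
  defines "E \<equiv> {y \<in> space (std_gauss_vec (R \<times> T)). \<forall>j\<in>T. \<bar>transp_mat_vec y R r j\<bar> \<le> b}"
  shows "E \<in> sets (std_gauss_vec (R \<times> T))"
    and "measure (std_gauss_vec (R \<times> T)) E \<le> (1 - normal_tail_lower (b / v)) ^ card T"
proof -
  let ?M = "std_gauss_vec (R \<times> T)"
  interpret prob_space ?M by (rule prob_space_std_gauss_vec)
  define A where "A = (\<lambda>j. (\<lambda>y. transp_mat_vec y R r j) -` {- b..b} \<inter> space ?M)"
  have A: "A j \<in> events" if "j \<in> T" for j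
    unfolding A_def using borel_measurable_column[OF that] by (rule measurable_sets) simp
  have E: "E = space ?M \<inter> (\<Inter>j\<in>T. A j)" by (auto simp: E_def A_def abs_le_iff)
  then show "E \<in> events" using A fin(2) by (cases "T = {}") (auto intro!: sets.Int sets.finite_INT)
  show "prob E \<le> (1 - normal_tail_lower (b / v)) ^ card T"
  proof (cases "T = {}")
    case False
    have "indep_vars (\<lambda>_. borel) (\<lambda>j y. transp_mat_vec y R r j) T"
      unfolding transp_mat_vec_eq_linear_form
      by (intro indep_vars_linear_forms[where a = "\<lambda>_ z. r (fst z)"])
        (auto simp: disjoint_family_on_def)
    then have "prob (\<Inter>j\<in>T. A j) = (\<Prod>j\<in>T. prob (A j))"
      unfolding A_def using False fin(2) by (intro indep_varsD_finite) auto
    moreover have "E = (\<Inter>j\<in>T. A j)" using False unfolding E by (auto simp: A_def)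
    moreover have "prob (A j) \<le> 1 - normal_tail_lower (b / v)" if "j \<in> T" for j
    proof -
      have "A j = {y \<in> space ?M. \<bar>\<Sum>z\<in>R \<times> {j}. r (fst z) * y z\<bar> \<le> b}"
        by (auto simp: A_def transp_mat_vec_eq_linear_form abs_le_iff)
      then show ?thesis
        using prob_linear_form_le[of "R \<times> {j}" "R \<times> T" v "\<lambda>z. r (fst z)" b] that fin v b
        by (auto simp: L2_set_column)
    qed
    then have "(\<Prod>j\<in>T. prob (A j)) \<le> (\<Prod>j\<in>T. 1 - normal_tail_lower (b / v))" by (intro prod_mono) auto
    ultimately show ?thesis by simp
  qed (use prob_le_1[of E] in simp)
qed

subsection \<open>Finite-sample bounds\<close>

locale lasso_instance =
  fixes n1 n2 p :: nat and \<sigma>1 \<sigma>2 lam :: real and \<beta>s :: "nat \<Rightarrow> real"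
  assumes n1_pos: "n1 > 0" and lam_pos: "lam > 0"
begin

abbreviation "n \<equiv> n1 + n2"
abbreviation "S \<equiv> support p \<beta>s"
abbreviation "T \<equiv> zeros p \<beta>s"
abbreviation "signal_cols \<equiv> std_gauss_vec ({..<n} \<times> S)"
abbreviation "null_cols \<equiv> std_gauss_vec ({..<n} \<times> T)"
abbreviation "noise_vec \<equiv> std_gauss_vec {..<n}"

definition noise_scale :: "nat \<Rightarrow> real" where
  "noise_scale i = (if i < n1 then \<sigma>1 else \<sigma>2)"

definition noise :: "(nat \<Rightarrow> real) \<Rightarrow> nat \<Rightarrow> real" where
  "noise W i = noise_scale i * W i"

definition noise_var :: real where
  "noise_var = (real n1 * \<sigma>1\<^sup>2 + real n2 * \<sigma>2\<^sup>2) / real n"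

definition recovers :: "(nat \<times> nat \<Rightarrow> real) \<Rightarrow> (nat \<times> nat \<Rightarrow> real) \<Rightarrow> (nat \<Rightarrow> real) \<Rightarrow> bool" where
  "recovers x y W \<longleftrightarrow> recovery n p (merge ({..<n} \<times> S) ({..<n} \<times> T) (x, y)) \<beta>s (noise W) lam"

abbreviation "prob_recovery \<equiv> recovery_prob n1 n2 p \<sigma>1 \<sigma>2 \<beta>s lam"

definition sign_target :: "nat \<Rightarrow> real" where
  "sign_target j = real n * lam * sgn (\<beta>s j)"

definition oracle_stationary :: "(nat \<times> nat \<Rightarrow> real) \<Rightarrow> (nat \<Rightarrow> real) \<Rightarrow> (nat \<Rightarrow> real) \<Rightarrow> bool" where
  "oracle_stationary x W w \<longleftrightarrow>
     (\<forall>j\<in>S. transp_mat_vec x {..<n} (residual x S (noise W) w) j = sign_target j)"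

lemma n_pos: "n > 0" and n_lam_pos: "real n * lam > 0"
  using n1_pos lam_pos by auto

lemma n_noise_var: "real n * noise_var = real n1 * \<sigma>1\<^sup>2 + real n2 * \<sigma>2\<^sup>2"
  using n_pos by (simp add: noise_var_def del: of_nat_add)

lemma card_zeros: "card T = p - card S"
proof -
  have "T = {..<p} - S" "S \<subseteq> {..<p}" by (auto simp: support_def zeros_def)
  then show ?thesis by (simp add: card_Diff_subset)
qed

lemma L2_set_sgn_signal: "L2_set (\<lambda>j. sgn (\<beta>s j)) S = sqrt (card S)"
proof -
  have "(\<Sum>j\<in>S. (sgn (\<beta>s j))\<^sup>2) = (\<Sum>j\<in>S. 1)" by (intro sum.cong) (auto simp: support_def sgn_if)
  then show ?thesis by (simp add: L2_set_def)
qed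

lemma L2_set_sign_target: "L2_set sign_target S = real n * (lam * sqrt (card S))"
  unfolding sign_target_def[abs_def] L2_set_scale L2_set_sgn_signal using n_lam_pos by simp

lemma recovers_iff:
  "recovers x y W \<longleftrightarrow>
    (\<exists>w. (\<forall>j\<in>S. sgn (\<beta>s j + w j) = sgn (\<beta>s j)) \<and> oracle_stationary x W w \<and>
      (\<forall>j\<in>T. \<bar>transp_mat_vec y {..<n} (residual x S (noise W) w) j\<bar> \<le> real n * lam))"
  using n_pos lam_pos
  by (simp add: recovers_def recovery_merge_iff oracle_stationary_def sign_target_def)

lemma iterated_recovery_prob:
  defines "fails \<equiv> \<lambda>x W. emeasure null_cols {y \<in> space null_cols. \<not> recovers x y W}"
    and "succeeds \<equiv> \<lambda>x W. emeasure null_cols {y \<in> space null_cols. recovers x y W}"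
  shows "ennreal prob_recovery = (\<integral>\<^sup>+x. \<integral>\<^sup>+W. succeeds x W \<partial>noise_vec \<partial>signal_cols)"
    and "ennreal (1 - prob_recovery) = (\<integral>\<^sup>+x. \<integral>\<^sup>+W. fails x W \<partial>noise_vec \<partial>signal_cols)"
proof -
  let ?I = "{..<n} \<times> S" and ?J = "{..<n} \<times> T"
  let ?M = "std_gauss_vec (?I \<union> ?J) \<Otimes>\<^sub>M noise_vec"
  interpret M: prob_space ?M by (intro prob_space_pair prob_space_std_gauss_vec)
  have IJ: "?I \<union> ?J = {..<n} \<times> {..<p}" "?I \<inter> ?J = {}" by (auto simp: support_def zeros_def)
  define A where "A = {z \<in> space ?M. recovery n p (fst z) \<beta>s (noise (snd z)) lam}"
  have A: "A \<in> M.events"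
    unfolding A_def IJ noise_def using n_pos lam_pos by (intro sets_recovery) auto
  have "{(X, W). recovery n p X \<beta>s (\<lambda>i. (if i < n1 then \<sigma>1 else \<sigma>2) * W i) lam} \<inter> space ?M = A"
    by (auto simp: A_def noise_def[abs_def] noise_scale_def)
  then have prob: "prob_recovery = M.prob A"
    unfolding recovery_prob_def Let_def IJ by simp
  have merge: "(merge ?I ?J (x, y), W) \<in> space ?M"
    if "x \<in> space signal_cols" "y \<in> space null_cols" "W \<in> space noise_vec" for x y W
    using that measurable_space[OF measurable_merge_std_gauss_vec, of "(x, y)" ?I ?J]
    by (simp add: space_pair_measure)
  note iterated = emeasure_std_gauss_vec_iterated[OF _ _ IJ(2) prob_space_std_gauss_vec]
  have "emeasure ?M A = (\<integral>\<^sup>+x. \<integral>\<^sup>+W. succeeds x W \<partial>noise_vec \<partial>signal_cols)"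
    unfolding iterated[OF finite_SigmaI finite_SigmaI A, simplified] succeeds_def
    using merge
    by (intro nn_integral_cong arg_cong[of _ _ "emeasure null_cols"])
      (auto simp: A_def recovers_def)
  then show "ennreal prob_recovery = (\<integral>\<^sup>+x. \<integral>\<^sup>+W. succeeds x W \<partial>noise_vec \<partial>signal_cols)"
    by (simp add: prob M.emeasure_eq_measure)
  have "emeasure ?M (space ?M - A) = (\<integral>\<^sup>+x. \<integral>\<^sup>+W. fails x W \<partial>noise_vec \<partial>signal_cols)"
    unfolding iterated[OF finite_SigmaI finite_SigmaI sets.compl_sets[OF A], simplified] fails_def
    using merge
    by (intro nn_integral_cong arg_cong[of _ _ "emeasure null_cols"])
      (auto simp: A_def recovers_def)
  then show "ennreal (1 - prob_recovery) = (\<integral>\<^sup>+x. \<integral>\<^sup>+W. fails x W \<partial>noise_vec \<partial>signal_cols)"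
    by (simp add: prob M.emeasure_eq_measure M.prob_compl[OF A])
qed

lemma recovery_prob_le_of_conditional:
  assumes B: "B \<in> sets signal_cols" and e: "e \<ge> 0"
    and cond: "\<And>x W. x \<in> space signal_cols - B \<Longrightarrow>
      measure null_cols {y \<in> space null_cols. recovers x y W} \<le> e"
  shows "prob_recovery \<le> e + measure signal_cols B"
proof -
  interpret signal: prob_space signal_cols by (rule prob_space_std_gauss_vec)
  interpret null: prob_space null_cols by (rule prob_space_std_gauss_vec)
  interpret noise: prob_space noise_vec by (rule prob_space_std_gauss_vec)
  have "ennreal prob_recovery \<le> ennreal (e + signal.prob B)"
    unfolding iterated_recovery_prob
  proof (rule signal.nn_integral_le_add_prob[OF B e])
    fix x
    let ?succeeds = "\<lambda>W. emeasure null_cols {y \<in> space null_cols. recovers x y W}"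
    show "(\<integral>\<^sup>+W. ?succeeds W \<partial>noise_vec) \<le> 1"
      using nn_integral_mono[of noise_vec ?succeeds "\<lambda>_. 1"] null.emeasure_le_1
      by (simp add: noise.emeasure_space_1)
    assume "x \<in> space signal_cols" "x \<notin> B"
    then have "?succeeds W \<le> ennreal e" for W
      using cond by (auto simp: null.emeasure_eq_measure intro: ennreal_leI)
    then show "(\<integral>\<^sup>+W. ?succeeds W \<partial>noise_vec) \<le> ennreal e"
      using nn_integral_mono[of noise_vec ?succeeds "\<lambda>_. ennreal e"]
      by (simp add: noise.emeasure_space_1)
  qed
  then show ?thesis using e by (subst (asm) ennreal_le_iff) auto
qed

lemma recovery_prob_ge_of_conditional:
  assumes B: "B \<in> sets signal_cols" and e: "e1 \<ge> 0" "e2 \<ge> 0"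
    and cond: "\<And>x. x \<in> space signal_cols - B \<Longrightarrow> \<exists>C\<in>sets noise_vec. measure noise_vec C \<le> e1 \<and>
      (\<forall>W\<in>space noise_vec - C. \<exists>D\<in>sets null_cols. measure null_cols D \<le> e2 \<and>
        (\<forall>y\<in>space null_cols - D. recovers x y W))"
  shows "1 - (measure signal_cols B + e1 + e2) \<le> prob_recovery"
proof -
  interpret signal: prob_space signal_cols by (rule prob_space_std_gauss_vec)
  interpret null: prob_space null_cols by (rule prob_space_std_gauss_vec)
  interpret noise: prob_space noise_vec by (rule prob_space_std_gauss_vec)
  have "ennreal (1 - prob_recovery) \<le> ennreal ((e1 + e2) + signal.prob B)"
    unfolding iterated_recovery_prob
  proof (rule signal.nn_integral_le_add_prob[OF B])
    fix x
    let ?fails = "\<lambda>W. emeasure null_cols {y \<in> space null_cols. \<not> recovers x y W}"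
    show "(\<integral>\<^sup>+W. ?fails W \<partial>noise_vec) \<le> 1"
      using nn_integral_mono[of noise_vec ?fails "\<lambda>_. 1"] null.emeasure_le_1
      by (simp add: noise.emeasure_space_1)
    assume "x \<in> space signal_cols" "x \<notin> B"
    then obtain C where C: "C \<in> noise.events" "noise.prob C \<le> e1"
      "\<And>W. W \<in> space noise_vec - C \<Longrightarrow> \<exists>D\<in>sets null_cols. null.prob D \<le> e2 \<and>
        (\<forall>y\<in>space null_cols - D. recovers x y W)"
      using cond[of x] by blast
    have "(\<integral>\<^sup>+W. ?fails W \<partial>noise_vec) \<le> ennreal (e2 + noise.prob C)"
    proof (rule noise.nn_integral_le_add_prob[OF C(1) e(2)])
      fix W assume "W \<in> space noise_vec" "W \<notin> C"
      then obtain D where D: "D \<in> null.events" "null.prob D \<le> e2"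
        "\<forall>y\<in>space null_cols - D. recovers x y W"
        using C(3)[of W] by blast
      have "?fails W \<le> emeasure null_cols D" using D by (intro emeasure_mono) auto
      also have "\<dots> \<le> ennreal e2" using D(2) by (simp add: null.emeasure_eq_measure ennreal_leI)
      finally show "?fails W \<le> ennreal e2" .
    qed (rule null.emeasure_le_1)
    also have "\<dots> \<le> ennreal (e1 + e2)" using C(2) by (intro ennreal_leI) simp
    finally show "(\<integral>\<^sup>+W. ?fails W \<partial>noise_vec) \<le> ennreal (e1 + e2)" .
  qed (use e in simp)
  then have "1 - prob_recovery \<le> (e1 + e2) + signal.prob B"
    using e by (subst (asm) ennreal_le_iff) auto
  then show ?thesis by linarith
qed

lemma oracle_residual_norm_ge:
  assumes "oracle_stationary x W w"
  shows "real n * lam * card S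
    \<le> L2_set (mat_vec x S (\<lambda>j. sgn (\<beta>s j))) {..<n} * L2_set (residual x S (noise W) w) {..<n}"
proof -
  have "real n * lam * card S = (\<Sum>j\<in>S. sgn (\<beta>s j) * sign_target j)"
  proof -
    have "(\<Sum>j\<in>S. sgn (\<beta>s j) * sign_target j) = (\<Sum>j\<in>S. real n * lam)"
      by (intro sum.cong) (auto simp: sign_target_def support_def sgn_if)
    then show ?thesis by simp
  qed
  also have "\<dots> = (\<Sum>i<n. mat_vec x S (\<lambda>j. sgn (\<beta>s j)) i * residual x S (noise W) w i)"
    unfolding mat_vec_adjoint using assms by (simp add: oracle_stationary_def)
  also have "\<dots>
      \<le> L2_set (mat_vec x S (\<lambda>j. sgn (\<beta>s j))) {..<n} * L2_set (residual x S (noise W) w) {..<n}"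
    by (rule order_trans[OF abs_ge_self abs_sum_mult_le_L2_set])
  finally show ?thesis .
qed

lemma null_correlations_le_of_recovers:
  assumes recovers: "recovers x y W" and w: "oracle_stationary x W w" and j: "j \<in> T"
  shows "\<bar>transp_mat_vec y {..<n} (residual x S (noise W) w) j\<bar> \<le> real n * lam"
proof -
  obtain w' where w': "oracle_stationary x W w'"
    and null: "\<forall>j\<in>T. \<bar>transp_mat_vec y {..<n} (residual x S (noise W) w') j\<bar> \<le> real n * lam"
    using recovers unfolding recovers_iff by blast
  have "mat_vec x S w' i = mat_vec x S w i" if "i < n" for i
    by (rule normal_equations_fit_unique[of "{..<n}" S x "noise W"])
      (use w w' that in \<open>simp_all add: oracle_stationary_def\<close>)
  then show ?thesis using bspec[OF null j] by (simp add: transp_mat_vec_def)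
qed

lemma conditional_recovery_le:
  assumes D: "0 < D" "L2_set (mat_vec x S (\<lambda>j. sgn (\<beta>s j))) {..<n} \<le> D" and S: "S \<noteq> {}"
  shows "measure null_cols {y \<in> space null_cols. recovers x y W}
    \<le> (1 - normal_tail_lower (D / card S)) ^ card T"
proof (cases "\<exists>w. oracle_stationary x W w")
  case False
  then have "{y \<in> space null_cols. recovers x y W} = {}" by (simp add: recovers_iff)
  then have "measure null_cols {y \<in> space null_cols. recovers x y W} = 0"
    by (simp only: measure_empty)
  then show ?thesis using normal_tail_lower_le_1[of "D / card S"] by simp
next
  case True
  then obtain w where w: "oracle_stationary x W w" by blast
  define r where "r = residual x S (noise W) w"
  interpret null: prob_space null_cols by (rule prob_space_std_gauss_vec)
  define v where "v = real n * lam * card S / D"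
  have s: "card S > 0" using S by (simp add: card_gt_0_iff)
  have "real n * lam * card S \<le> D * L2_set r {..<n}"
    using oracle_residual_norm_ge[OF w] mult_right_mono[OF D(2), of "L2_set r {..<n}"]
    by (simp add: r_def)
  then have v: "v \<le> L2_set r {..<n}" using D(1) by (simp add: v_def pos_divide_le_eq mult.commute)
  have v_pos: "0 < v"
    unfolding v_def using D(1) s n1_pos lam_pos by (intro divide_pos_pos mult_pos_pos) auto
  let ?E = "{y \<in> space null_cols. \<forall>j\<in>T. \<bar>transp_mat_vec y {..<n} r j\<bar> \<le> real n * lam}"
  note E = prob_all_columns_le[OF finite_lessThan finite_zeros v_pos v less_imp_le[OF n_lam_pos],
      of p \<beta>s]
  have "{y \<in> space null_cols. recovers x y W} \<subseteq> ?E"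
    using null_correlations_le_of_recovers[OF _ w] by (auto simp: r_def)
  then have "measure null_cols {y \<in> space null_cols. recovers x y W} \<le> null.prob ?E"
    using E(1) by (rule null.finite_measure_mono)
  also have "\<dots> \<le> (1 - normal_tail_lower (real n * lam / v)) ^ card T" by (rule E(2))
  also have "real n * lam / v = D / card S"
    using D(1) s n1_pos lam_pos by (simp add: v_def)
  finally show ?thesis .
qed

proposition recovery_prob_upper_bound:
  fixes \<eta> :: real
  assumes S: "S \<noteq> {}" and \<eta>: "0 < \<eta>" "\<eta> \<le> 1"
  shows "prob_recovery \<le> (1 - normal_tail_lower (sqrt ((1 + \<eta>) * n / card S))) ^ (p - card S)
    + 2 * exp (- \<eta>\<^sup>2 * n / 16)"
proof -
  let ?u = "\<lambda>j. sgn (\<beta>s j)"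
  interpret signal: prob_space signal_cols by (rule prob_space_std_gauss_vec)
  have s: "card S > 0" using S by (simp add: card_gt_0_iff)
  define B where "B = {x \<in> space signal_cols.
    \<eta> * (L2_set ?u S)\<^sup>2 * n \<le> \<bar>(L2_set (mat_vec x S ?u) {..<n})\<^sup>2 - (L2_set ?u S)\<^sup>2 * n\<bar>}"
  have "L2_set ?u S > 0" using s by (simp add: L2_set_sgn_signal)
  note concentration =
    mat_vec_norm_concentration[OF finite_lessThan finite_support subset_refl this \<eta>]
  have B: "B \<in> signal.events" using concentration(1) unfolding B_def card_lessThan .
  have "signal.prob B \<le> 2 * exp (- \<eta>\<^sup>2 * n / 16)"
    using concentration(2) unfolding B_def card_lessThan .
  moreover have "prob_recovery
      \<le> (1 - normal_tail_lower (sqrt ((1 + \<eta>) * n / card S))) ^ card T + signal.prob B"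
  proof (rule recovery_prob_le_of_conditional[OF B])
    fix x W assume x: "x \<in> space signal_cols - B"
    define D where "D = sqrt ((1 + \<eta>) * card S * n)"
    have "\<not> \<eta> * (L2_set ?u S)\<^sup>2 * n \<le> \<bar>(L2_set (mat_vec x S ?u) {..<n})\<^sup>2 - (L2_set ?u S)\<^sup>2 * n\<bar>"
      using x unfolding B_def by blast
    moreover have "(1 + \<eta>) * (L2_set ?u S)\<^sup>2 * n = (L2_set ?u S)\<^sup>2 * n + \<eta> * (L2_set ?u S)\<^sup>2 * n"
      by (simp add: algebra_simps)
    ultimately have "(L2_set (mat_vec x S ?u) {..<n})\<^sup>2 \<le> (1 + \<eta>) * (L2_set ?u S)\<^sup>2 * n" by linarith
    then have "(L2_set (mat_vec x S ?u) {..<n})\<^sup>2 \<le> (1 + \<eta>) * card S * n"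
      by (simp add: L2_set_sgn_signal)
    then have "L2_set (mat_vec x S ?u) {..<n} \<le> D" unfolding D_def by (rule real_le_rsqrt)
    moreover have "D > 0"
      unfolding D_def real_sqrt_gt_0_iff using \<eta> s n1_pos by (intro mult_pos_pos) auto
    moreover have "D / card S = sqrt ((1 + \<eta>) * n / card S)"
    proof -
      have "D / card S = sqrt ((1 + \<eta>) * card S * n / (real (card S))\<^sup>2)"
        by (simp only: D_def real_sqrt_divide real_sqrt_abs abs_of_nat)
      then show ?thesis using s by (simp add: power2_eq_square)
    qed
    ultimately show "measure null_cols {y \<in> space null_cols. recovers x y W}
        \<le> (1 - normal_tail_lower (sqrt ((1 + \<eta>) * n / card S))) ^ card T"
      using conditional_recovery_le[of D x W] S by simp
  qed (use normal_tail_lower_le_1 in simp)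
  ultimately show ?thesis unfolding card_zeros by linarith
qed

lemma L2_set_noise_scale_power2:
  "(L2_set (\<lambda>i. noise_scale i * f i) {..<n})\<^sup>2
      = \<sigma>1\<^sup>2 * (L2_set f {..<n1})\<^sup>2 + \<sigma>2\<^sup>2 * (L2_set f {n1..<n})\<^sup>2"
proof -
  have "{..<n} = {..<n1} \<union> {n1..<n}" "{..<n1} \<inter> {n1..<n} = {}" by auto
  then have "(L2_set (\<lambda>i. noise_scale i * f i) {..<n})\<^sup>2
      = (\<Sum>i<n1. (noise_scale i * f i)\<^sup>2) + (\<Sum>i\<in>{n1..<n}. (noise_scale i * f i)\<^sup>2)"
    unfolding L2_set_power2 by (simp add: sum.union_disjoint)
  then show ?thesis by (simp add: L2_set_power2 noise_scale_def power_mult_distrib sum_distrib_left)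
qed

lemma noise_scale_mat_vec_norm_le:
  assumes x: "approx_isometry \<delta> {..<n1} S x" "approx_isometry \<delta> {n1..<n} S x"
  shows "(L2_set (\<lambda>i. noise_scale i * mat_vec x S u i) {..<n})\<^sup>2
    \<le> (1 + \<delta>)\<^sup>2 * (L2_set u S)\<^sup>2 * (real n * noise_var)"
proof -
  have block: "(L2_set (mat_vec x S u) R)\<^sup>2 \<le> (1 + \<delta>)\<^sup>2 * (L2_set u S)\<^sup>2 * card R"
    if "approx_isometry \<delta> R S x" for R
  proof -
    have "(L2_set (mat_vec x S u) R)\<^sup>2 \<le> ((1 + \<delta>) * sqrt (card R) * L2_set u S)\<^sup>2"
      using that by (intro power_mono) (auto simp: approx_isometry_def)
    also have "\<dots> = (1 + \<delta>)\<^sup>2 * (L2_set u S)\<^sup>2 * card R" by (simp add: power_mult_distrib)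
    finally show ?thesis .
  qed
  have "(L2_set (\<lambda>i. noise_scale i * mat_vec x S u i) {..<n})\<^sup>2
      \<le> \<sigma>1\<^sup>2 * ((1 + \<delta>)\<^sup>2 * (L2_set u S)\<^sup>2 * n1) + \<sigma>2\<^sup>2 * ((1 + \<delta>)\<^sup>2 * (L2_set u S)\<^sup>2 * n2)"
    unfolding L2_set_noise_scale_power2 using block[OF x(1)] block[OF x(2)]
    by (intro add_mono mult_left_mono) auto
  also have "\<dots> = (1 + \<delta>)\<^sup>2 * (L2_set u S)\<^sup>2 * (real n * noise_var)"
    unfolding n_noise_var by (simp add: algebra_simps)
  finally show ?thesis .
qed

lemma prob_noise_norm_gt:
  defines "E \<equiv> {W \<in> space noise_vec. 2 * real n * noise_var < (L2_set (noise W) {..<n})\<^sup>2}"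
  shows "E \<in> sets noise_vec"
    and "measure noise_vec E \<le> 2 * exp (- real n1 / 16) + 2 * exp (- real n2 / 16)"
proof -
  interpret prob_space noise_vec by (rule prob_space_std_gauss_vec)
  have blocks: "{..<n1} \<subseteq> {..<n}" "{n1..<n} \<subseteq> {..<n}" by auto
  note [measurable] = borel_measurable_L2_set[OF blocks(1)] borel_measurable_L2_set[OF blocks(2)]
  have norm: "(L2_set (noise W) {..<n})\<^sup>2
      = \<sigma>1\<^sup>2 * (L2_set W {..<n1})\<^sup>2 + \<sigma>2\<^sup>2 * (L2_set W {n1..<n})\<^sup>2" for W
    unfolding noise_def[abs_def] by (rule L2_set_noise_scale_power2)
  show "E \<in> events" unfolding E_def norm by measurable
  define A where "A = (\<lambda>R. {W \<in> space noise_vec. card R \<le> \<bar>(L2_set W R)\<^sup>2 - card R\<bar>})"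
  have A: "A {..<n1} \<in> events" "A {n1..<n} \<in> events" unfolding A_def by measurable
  have "E \<subseteq> A {..<n1} \<union> A {n1..<n}"
  proof (intro subsetI, rule ccontr)
    fix W assume W: "W \<in> E" "W \<notin> A {..<n1} \<union> A {n1..<n}"
    then have "(L2_set W {..<n1})\<^sup>2 \<le> 2 * real n1" "(L2_set W {n1..<n})\<^sup>2 \<le> 2 * real n2"
      by (auto simp: A_def E_def)
    then have "\<sigma>1\<^sup>2 * (L2_set W {..<n1})\<^sup>2 + \<sigma>2\<^sup>2 * (L2_set W {n1..<n})\<^sup>2
        \<le> \<sigma>1\<^sup>2 * (2 * real n1) + \<sigma>2\<^sup>2 * (2 * real n2)"
      by (intro add_mono mult_left_mono) auto
    also have "\<dots> = 2 * real n * noise_var"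
      unfolding mult.assoc n_noise_var by (simp add: algebra_simps)
    finally show False using W(1) by (simp add: E_def norm)
  qed
  then have "prob E \<le> prob (A {..<n1} \<union> A {n1..<n})" using A by (intro finite_measure_mono) auto
  also have "\<dots> \<le> prob (A {..<n1}) + prob (A {n1..<n})" using A by (intro measure_Un_le)
  also have "\<dots> \<le> 2 * exp (- real n1 / 16) + 2 * exp (- real n2 / 16)"
    using std_gauss_vec_norm_concentration[OF blocks(1), of 1]
      std_gauss_vec_norm_concentration[OF blocks(2), of 1]
    by (simp add: A_def)
  finally show "prob E \<le> 2 * exp (- real n1 / 16) + 2 * exp (- real n2 / 16)" .
qed

lemma recovers_of_least_squares:
  assumes v: "least_squares_fit x {..<n} S (noise W) v"
    and g: "gram_solution x {..<n} S sign_target g"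
    and small: "\<And>j. j \<in> S \<Longrightarrow> \<bar>v j - g j\<bar> < \<bar>\<beta>s j\<bar>"
    and null: "\<And>j. j \<in> T \<Longrightarrow>
      \<bar>transp_mat_vec y {..<n} (\<lambda>i. residual x S (noise W) v i + mat_vec x S g i) j\<bar> \<le> real n * lam"
  shows "recovers x y W"
proof -
  have residual: "residual x S (noise W) (\<lambda>j. v j - g j)
      = (\<lambda>i. residual x S (noise W) v i + mat_vec x S g i)"
    by (simp add: mat_vec_diff fun_eq_iff)
  have "oracle_stationary x W (\<lambda>j. v j - g j)"
    unfolding oracle_stationary_def residual
    by (simp add: transp_mat_vec_add transp_mat_vec_diff gram_solutionD[OF v] gram_solutionD[OF g])
  moreover have "sgn (\<beta>s j + (v j - g j)) = sgn (\<beta>s j)" if "j \<in> S" for j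
    using small[OF that] by (auto simp: sgn_if abs_if split: if_splits)
  ultimately show ?thesis
    unfolding recovers_iff using null by (intro exI[of _ "\<lambda>j. v j - g j"]) (simp add: residual)
qed

lemma null_cols_recovery:
  assumes v: "least_squares_fit x {..<n} S (noise W) v"
    and g: "gram_solution x {..<n} S sign_target g"
    and small: "\<And>j. j \<in> S \<Longrightarrow> \<bar>v j - g j\<bar> < \<bar>\<beta>s j\<bar>"
    and V: "0 < V" "(L2_set (noise W) {..<n})\<^sup>2 + (L2_set (mat_vec x S g) {..<n})\<^sup>2 \<le> V"
  shows "\<exists>D\<in>sets null_cols. measure null_cols D \<le> card T * (2 * exp (- (real n * lam)\<^sup>2 / (2 * V))) \<and>
    (\<forall>y\<in>space null_cols - D. recovers x y W)"
proof -
  define r where "r = (\<lambda>i. residual x S (noise W) v i + mat_vec x S g i)"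
  define D where "D = {y \<in> space null_cols. \<exists>j\<in>T. real n * lam \<le> \<bar>transp_mat_vec y {..<n} r j\<bar>}"
  have "(L2_set r {..<n})\<^sup>2 \<le> V"
    unfolding r_def by (rule order_trans[OF least_squares_residual_norm_le[OF v] V(2)])
  note D = prob_ex_column_ge[OF finite_lessThan finite_zeros V(1) this less_imp_le[OF n_lam_pos],
      of p \<beta>s, folded D_def]
  have "recovers x y W" if y: "y \<in> space null_cols - D" for y
  proof (rule recovers_of_least_squares[OF v g small])
    fix j assume "j \<in> T"
    then show "\<bar>transp_mat_vec y {..<n} (\<lambda>i. residual x S (noise W) v i + mat_vec x S g i) j\<bar>
        \<le> real n * lam"
      using y by (auto simp: D_def r_def not_le)
  qed
  then show ?thesis using D by blast
qed

lemma approx_isometry_all_rows: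
  assumes x: "approx_isometry \<delta> {..<n1} S x" "approx_isometry \<delta> {n1..<n} S x" and \<delta>: "0 \<le> \<delta>" "\<delta> \<le> 1"
  shows "approx_isometry \<delta> {..<n} S x"
proof -
  have "approx_isometry \<delta> ({..<n1} \<union> {n1..<n}) S x" using \<delta> by (intro approx_isometry_Un x) auto
  moreover have "{..<n1} \<union> {n1..<n} = {..<n}" by auto
  ultimately show ?thesis by simp
qed

lemma shrinkage_exists:
  assumes x: "approx_isometry \<delta> {..<n} S x" and \<delta>: "\<delta> \<le> 1 / 4"
  obtains g where
    "gram_solution x {..<n} S sign_target g"
    and "\<And>j. j \<in> S \<Longrightarrow> \<bar>g j\<bar> \<le> 2 * (lam * sqrt (card S))"
    and "(L2_set (mat_vec x S g) {..<n})\<^sup>2 \<le> real n * (lam\<^sup>2 * card S / (1 - \<delta>)\<^sup>2)"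
proof -
  have \<delta>1: "\<delta> < 1" "card {..<n} > 0" using \<delta> n_pos by simp_all
  have n: "real n > 0" using n_pos by (simp only: of_nat_0_less_iff)
  obtain g where g: "gram_solution x {..<n} S sign_target g"
    using approx_isometry_gram_solvable[OF x finite_support \<delta>1] by blast
  note bounds =
    approx_isometry_gram_solution_bounds[OF x \<delta>1 g, unfolded L2_set_sign_target card_lessThan]
  have "\<bar>g j\<bar> \<le> 2 * (lam * sqrt (card S))" if "j \<in> S" for j
  proof -
    have "\<bar>g j\<bar> \<le> L2_set (\<lambda>j. \<bar>g j\<bar>) S" using that by (intro member_le_L2_set) auto
    also have "\<dots> = L2_set g S" by (simp add: L2_set_def)
    also have "\<dots> \<le> real n * (lam * sqrt (card S)) / ((1 - \<delta>)\<^sup>2 * real n)" by (rule bounds(1))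
    also have "\<dots> = lam * sqrt (card S) / (1 - \<delta>)\<^sup>2" using n by (simp del: of_nat_add)
    also have "\<dots> \<le> lam * sqrt (card S) / (1 / 2)"
      using power_mono[of "3 / 4" "1 - \<delta>" 2] \<delta> lam_pos
      by (intro divide_left_mono mult_pos_pos mult_nonneg_nonneg) (auto simp: power_divide)
    finally show ?thesis by simp
  qed
  moreover have "(L2_set (mat_vec x S g) {..<n})\<^sup>2 \<le> real n * (lam\<^sup>2 * card S / (1 - \<delta>)\<^sup>2)"
  proof -
    have "(real n * (lam * sqrt (card S)))\<^sup>2 / ((1 - \<delta>)\<^sup>2 * real n)
        = real n * (lam\<^sup>2 * card S / (1 - \<delta>)\<^sup>2)"
      using n by (simp add: power_mult_distrib power2_eq_square[of "real n"] del: of_nat_add)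
    then show ?thesis using bounds(2) by (simp only:)
  qed
  ultimately show thesis using g by (intro that)
qed

lemma dual_noise_norm_le:
  assumes x: "approx_isometry \<delta> {..<n1} S x" "approx_isometry \<delta> {n1..<n} S x"
    and \<delta>: "0 \<le> \<delta>" "\<delta> \<le> 1 / 4" and u: "L2_set u S \<le> 1 / ((1 - \<delta>)\<^sup>2 * real n)"
  shows "(L2_set (\<lambda>i. noise_scale i * mat_vec x S u i) {..<n})\<^sup>2 \<le> 8 * noise_var / n"
proof -
  have n: "real n > 0" using n1_pos by simp
  have "9 / 16 * real n \<le> (1 - \<delta>)\<^sup>2 * real n"
    using power_mono[of "3 / 4" "1 - \<delta>" 2] \<delta> by (intro mult_right_mono) (auto simp: power_divide)
  then have "1 / ((1 - \<delta>)\<^sup>2 * real n) \<le> 1 / (9 / 16 * real n)"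
    using n by (intro divide_left_mono mult_pos_pos) auto
  then have "(L2_set u S)\<^sup>2 \<le> (1 / (9 / 16 * real n))\<^sup>2" using u by (intro power_mono) auto
  moreover have "(1 + \<delta>)\<^sup>2 \<le> (5 / 4)\<^sup>2" using \<delta> by (intro power_mono) auto
  ultimately have "(1 + \<delta>)\<^sup>2 * (L2_set u S)\<^sup>2 \<le> (5 / 4)\<^sup>2 * (1 / (9 / 16 * real n))\<^sup>2"
    by (intro mult_mono) auto
  also have "\<dots> = 400 / 81 / (real n)\<^sup>2"
    by (simp add: power_divide power_mult_distrib del: of_nat_add)
  also have "\<dots> \<le> 8 / (real n)\<^sup>2" by (rule divide_right_mono) simp_all
  finally have "(1 + \<delta>)\<^sup>2 * (L2_set u S)\<^sup>2 * (real n * noise_var)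
      \<le> 8 / (real n)\<^sup>2 * (real n * noise_var)"
    unfolding n_noise_var by (intro mult_right_mono) auto
  also have "\<dots> = 8 * noise_var / n" using n by (simp add: power2_eq_square)
  finally show ?thesis using noise_scale_mat_vec_norm_le[OF x, of u] by linarith
qed

lemma noise_var_pos: "\<sigma>1 \<noteq> 0 \<Longrightarrow> noise_var > 0"
  using n1_pos unfolding noise_var_def by (intro divide_pos_pos add_pos_nonneg mult_pos_pos) auto

lemma noise_fit_small:
  fixes \<rho> :: real
  assumes x: "approx_isometry \<delta> {..<n1} S x" "approx_isometry \<delta> {n1..<n} S x"
    and \<delta>: "0 \<le> \<delta>" "\<delta> \<le> 1 / 4"
    and \<sigma>1: "\<sigma>1 \<noteq> 0" and \<rho>: "\<rho> \<ge> 0"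
  obtains C where "C \<in> sets noise_vec"
    and "measure noise_vec C \<le> 2 * card S * exp (- \<rho>\<^sup>2 * n / (64 * noise_var))"
    and "\<And>W v j. \<lbrakk>W \<in> space noise_vec - C; least_squares_fit x {..<n} S (noise W) v; j \<in> S\<rbrakk>
      \<Longrightarrow> \<bar>v j\<bar> < \<rho> / 2"
proof -
  have \<delta>1: "\<delta> < 1" "\<delta> \<le> 1" "card {..<n} > 0" using \<delta> n_pos by simp_all
  have iso: "approx_isometry \<delta> {..<n} S x" by (rule approx_isometry_all_rows[OF x \<delta>(1) \<delta>1(2)])
  have "\<forall>j. \<exists>u. gram_solution x {..<n} S (\<lambda>k. if k = j then 1 else 0) u"
    by (intro allI approx_isometry_gram_solvable[OF iso finite_support \<delta>1(1,3)])
  then obtain u where u: "gram_solution x {..<n} S (\<lambda>k. if k = j then 1 else 0) (u j)" for j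
    unfolding choice_iff by blast
  let ?a = "\<lambda>j i. noise_scale i * mat_vec x S (u j) i"
  define C where "C = {W \<in> space noise_vec. \<exists>j\<in>S. \<rho> / 2 \<le> \<bar>\<Sum>i<n. ?a j i * W i\<bar>}"
  have norm: "(L2_set (?a j) {..<n})\<^sup>2 \<le> 8 * noise_var / n" if "j \<in> S" for j
  proof (rule dual_noise_norm_le[OF x \<delta>])
    have "L2_set (\<lambda>k. if k = j then 1 else 0 :: real) S = 1"
      using that by (simp add: L2_set_def if_distrib[of "\<lambda>t. t\<^sup>2"] cong: if_cong)
    then show "L2_set (u j) S \<le> 1 / ((1 - \<delta>)\<^sup>2 * real n)"
      using approx_isometry_gram_solution_bounds(1)[OF iso \<delta>1(1,3) u[of j]] unfolding card_lessThan
      by simp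
  qed
  have "8 * noise_var / n > 0" "\<rho> / 2 \<ge> 0" using noise_var_pos[OF \<sigma>1] n1_pos \<rho> by simp_all
  with norm have C: "C \<in> sets noise_vec"
    "measure noise_vec C \<le> card S * (2 * exp (- (\<rho> / 2)\<^sup>2 / (2 * (8 * noise_var / n))))"
    unfolding C_def
    by (intro prob_ex_linear_form_ge[of S "\<lambda>_. {..<n}"] finite_support subset_refl finite_lessThan;
        blast)+
  show thesis
  proof (rule that)
    show "C \<in> sets noise_vec" by (rule C(1))
    have "(\<rho> / 2)\<^sup>2 / (2 * (8 * noise_var / n)) = \<rho>\<^sup>2 * n / (64 * noise_var)"
      by (simp add: power_divide)
    then show "measure noise_vec C \<le> 2 * card S * exp (- \<rho>\<^sup>2 * n / (64 * noise_var))"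
      using C(2) by simp
  next
    fix W v j
    assume W: "W \<in> space noise_vec - C" and v: "least_squares_fit x {..<n} S (noise W) v"
      and j: "j \<in> S"
    have "v j = (\<Sum>i<n. mat_vec x S (u j) i * noise W i)"
      by (rule gram_dual_coordinate[OF finite_support j u v])
    also have "\<dots> = (\<Sum>i<n. ?a j i * W i)" by (simp add: noise_def mult_ac)
    finally show "\<bar>v j\<bar> < \<rho> / 2" using W j by (auto simp: C_def not_le)
  qed
qed

lemma conditional_recovery_ge:
  fixes \<rho> :: real
  assumes x: "approx_isometry \<delta> {..<n1} S x" "approx_isometry \<delta> {n1..<n} S x"
    and \<delta>: "0 \<le> \<delta>" "\<delta> \<le> 1 / 4"
    and \<sigma>1: "\<sigma>1 \<noteq> 0" and \<rho>: "\<rho> \<ge> 0" "\<And>j. j \<in> S \<Longrightarrow> \<rho> \<le> \<bar>\<beta>s j\<bar>" "4 * (lam * sqrt (card S)) \<le> \<rho>"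
  defines "V \<equiv> real n * (2 * noise_var + lam\<^sup>2 * card S / (1 - \<delta>)\<^sup>2)"
  shows "\<exists>C\<in>sets noise_vec.
    measure noise_vec C \<le> 2 * exp (- real n1 / 16) + 2 * exp (- real n2 / 16)
      + 2 * card S * exp (- \<rho>\<^sup>2 * n / (64 * noise_var)) \<and>
    (\<forall>W\<in>space noise_vec - C. \<exists>D\<in>sets null_cols.
      measure null_cols D \<le> card T * (2 * exp (- (real n * lam)\<^sup>2 / (2 * V))) \<and>
      (\<forall>y\<in>space null_cols - D. recovers x y W))"
proof -
  have \<delta>1: "\<delta> < 1" "\<delta> \<le> 1" "card {..<n} > 0" using \<delta> n_pos by simp_all
  have iso: "approx_isometry \<delta> {..<n} S x" by (rule approx_isometry_all_rows[OF x \<delta>(1) \<delta>1(2)])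
  obtain g where g: "gram_solution x {..<n} S sign_target g"
    and g_small: "\<And>j. j \<in> S \<Longrightarrow> \<bar>g j\<bar> \<le> 2 * (lam * sqrt (card S))"
    and g_norm: "(L2_set (mat_vec x S g) {..<n})\<^sup>2 \<le> real n * (lam\<^sup>2 * card S / (1 - \<delta>)\<^sup>2)"
    using shrinkage_exists[OF iso \<delta>(2)] by blast
  obtain C1 where C1: "C1 \<in> sets noise_vec"
    "measure noise_vec C1 \<le> 2 * card S * exp (- \<rho>\<^sup>2 * n / (64 * noise_var))"
    and fit_small: "\<And>W v j. \<lbrakk>W \<in> space noise_vec - C1;
      least_squares_fit x {..<n} S (noise W) v; j \<in> S\<rbrakk> \<Longrightarrow> \<bar>v j\<bar> < \<rho> / 2"
    using noise_fit_small[OF x \<delta> \<sigma>1 \<rho>(1)] by blast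
  define C2 where "C2 = {W \<in> space noise_vec. 2 * real n * noise_var < (L2_set (noise W) {..<n})\<^sup>2}"
  note C2 = prob_noise_norm_gt[folded C2_def]
  have V_pos: "V > 0"
    unfolding V_def using n1_pos noise_var_pos[OF \<sigma>1] by (intro mult_pos_pos add_pos_nonneg) auto
  have "\<exists>D\<in>sets null_cols. measure null_cols D \<le> card T * (2 * exp (- (real n * lam)\<^sup>2 / (2 * V))) \<and>
      (\<forall>y\<in>space null_cols - D. recovers x y W)" if W: "W \<in> space noise_vec - (C1 \<union> C2)" for W
  proof -
    obtain v where v: "least_squares_fit x {..<n} S (noise W) v"
      using approx_isometry_gram_solvable[OF iso finite_support \<delta>1(1,3)] by blast
    have "\<bar>v j - g j\<bar> < \<bar>\<beta>s j\<bar>" if j: "j \<in> S" for j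
    proof -
      have "\<bar>v j\<bar> < \<rho> / 2" using fit_small[OF _ v j] W by blast
      then show ?thesis using g_small[OF j] \<rho>(3) \<rho>(2)[OF j] by linarith
    qed
    moreover have "(L2_set (noise W) {..<n})\<^sup>2 \<le> real n * (2 * noise_var)"
      using W by (simp add: C2_def not_less mult_ac del: of_nat_add)
    then have "(L2_set (noise W) {..<n})\<^sup>2 + (L2_set (mat_vec x S g) {..<n})\<^sup>2 \<le> V"
      unfolding V_def distrib_left using g_norm by (rule add_mono)
    ultimately show ?thesis using null_cols_recovery[OF v g _ V_pos] by blast
  qed
  moreover have "measure noise_vec (C1 \<union> C2) \<le> measure noise_vec C1 + measure noise_vec C2"
    using C1(1) C2(1) by (rule measure_Un_le)
  ultimately show ?thesis using C1 C2 by (intro bexI[of _ "C1 \<union> C2"] conjI ballI) auto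
qed

proposition recovery_prob_lower_bound:
  fixes \<rho> \<delta> :: real
  assumes S: "S \<noteq> {}" and \<delta>: "0 < \<delta>" "\<delta> \<le> 1 / 4" and \<sigma>1: "\<sigma>1 \<noteq> 0"
    and \<rho>: "\<rho> \<ge> 0" "\<And>j. j \<in> S \<Longrightarrow> \<rho> \<le> \<bar>\<beta>s j\<bar>" "4 * (lam * sqrt (card S)) \<le> \<rho>"
  shows "1 - (non_isometry_bound \<delta> (card S) n1 + non_isometry_bound \<delta> (card S) n2
      + 2 * exp (- real n1 / 16) + 2 * exp (- real n2 / 16)
      + 2 * card S * exp (- \<rho>\<^sup>2 * n / (64 * noise_var))
      + 2 * (p - card S) * exp (- (n * lam\<^sup>2 / (2 * (2 * noise_var + lam\<^sup>2 * card S / (1 - \<delta>)\<^sup>2)))))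
    \<le> prob_recovery"
proof -
  have blocks: "{..<n1} \<times> S \<subseteq> {..<n} \<times> S" "{n1..<n} \<times> S \<subseteq> {..<n} \<times> S" by auto
  have "\<delta> \<le> 1" using \<delta> by simp
  note isometry = std_gauss_approx_isometry[OF _ finite_support S _ \<delta>(1) this]
  obtain B1 where B1: "B1 \<in> sets signal_cols"
    "measure signal_cols B1 \<le> non_isometry_bound \<delta> (card S) n1"
    "\<And>x. x \<in> space signal_cols - B1 \<Longrightarrow> approx_isometry \<delta> {..<n1} S x"
    using isometry[OF finite_lessThan blocks(1)] by (metis card_lessThan)
  obtain B2 where B2: "B2 \<in> sets signal_cols"
    "measure signal_cols B2 \<le> non_isometry_bound \<delta> (card S) n2"
    "\<And>x. x \<in> space signal_cols - B2 \<Longrightarrow> approx_isometry \<delta> {n1..<n} S x"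
    using isometry[OF finite_atLeastLessThan blocks(2)]
    by (metis card_atLeastLessThan diff_add_inverse)
  define e1 where "e1 = 2 * exp (- real n1 / 16) + 2 * exp (- real n2 / 16)
      + 2 * card S * exp (- \<rho>\<^sup>2 * n / (64 * noise_var))"
  define V where "V = real n * (2 * noise_var + lam\<^sup>2 * card S / (1 - \<delta>)\<^sup>2)"
  define e2 where "e2 = card T * (2 * exp (- (real n * lam)\<^sup>2 / (2 * V)))"
  have "1 - (measure signal_cols (B1 \<union> B2) + e1 + e2) \<le> prob_recovery"
  proof (rule recovery_prob_ge_of_conditional)
    fix x assume "x \<in> space signal_cols - (B1 \<union> B2)"
    then have "approx_isometry \<delta> {..<n1} S x" "approx_isometry \<delta> {n1..<n} S x"
      using B1(3) B2(3) by auto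
    from conditional_recovery_ge[OF this less_imp_le[OF \<delta>(1)] \<delta>(2) \<sigma>1 \<rho>]
    show "\<exists>C\<in>sets noise_vec. measure noise_vec C \<le> e1 \<and> (\<forall>W\<in>space noise_vec - C. \<exists>D\<in>sets null_cols.
        measure null_cols D \<le> e2 \<and> (\<forall>y\<in>space null_cols - D. recovers x y W))"
      unfolding e1_def e2_def V_def .
  qed (use B1 B2 in \<open>auto simp: e1_def e2_def\<close>)
  moreover have "measure signal_cols (B1 \<union> B2) \<le> measure signal_cols B1 + measure signal_cols B2"
    using B1(1) B2(1) by (rule measure_Un_le)
  moreover have "e2
      = 2 * (p - card S) * exp (- (n * lam\<^sup>2 / (2 * (2 * noise_var + lam\<^sup>2 * card S / (1 - \<delta>)\<^sup>2))))"
  proof -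
    have "(real n * lam)\<^sup>2 / (2 * V) = n * lam\<^sup>2 / (2 * (2 * noise_var + lam\<^sup>2 * card S / (1 - \<delta>)\<^sup>2))"
      using n_pos by (simp add: V_def power2_eq_square)
    then show ?thesis by (simp add: e2_def card_zeros)
  qed
  ultimately show ?thesis using B1(2) B2(2) unfolding e1_def by linarith
qed

end

subsection \<open>Asymptotics\<close>

lemma recovery_prob_range:
  "0 \<le> recovery_prob n1 n2 p \<sigma>1 \<sigma>2 \<beta>s lam" "recovery_prob n1 n2 p \<sigma>1 \<sigma>2 \<beta>s lam \<le> 1"
proof -
  interpret prob_space "std_gauss_vec ({..<n1 + n2} \<times> {..<p}) \<Otimes>\<^sub>M std_gauss_vec {..<n1 + n2}"
    by (intro prob_space_pair prob_space_std_gauss_vec)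
  show "0 \<le> recovery_prob n1 n2 p \<sigma>1 \<sigma>2 \<beta>s lam" "recovery_prob n1 n2 p \<sigma>1 \<sigma>2 \<beta>s lam \<le> 1"
    by (auto simp: recovery_prob_def Let_def)
qed

lemma exp_times_normal_tail_lower_at_top:
  fixes a :: real
  assumes a: "0 < a" "a < 1"
  shows "filterlim (\<lambda>l. exp l * normal_tail_lower (sqrt (a * (2 * l + 2)))) at_top at_top"
proof (rule filterlim_mono_eventually[OF _ order_refl order_refl])
  define d where "d = 1 - a"
  have "d > 0" using a by (simp add: d_def)
  then show "filterlim
      (\<lambda>l. exp (d * l - (a + 1 / 2) - sqrt (a * (2 * l + 2))) / sqrt (2 * pi)) at_top at_top"
    using a(1) by real_asymp
  show "\<forall>\<^sub>F l in at_top. exp (d * l - (a + 1 / 2) - sqrt (a * (2 * l + 2))) / sqrt (2 * pi)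
      = exp l * normal_tail_lower (sqrt (a * (2 * l + 2)))"
    using eventually_ge_at_top[of 0]
  proof eventually_elim
    case (elim l)
    have "(sqrt (a * (2 * l + 2)) + 1)\<^sup>2 = a * (2 * l + 2) + 2 * sqrt (a * (2 * l + 2)) + 1"
      using a elim by (simp add: power2_sum)
    then have "d * l - (a + 1 / 2) - sqrt (a * (2 * l + 2))
        = l + - (sqrt (a * (2 * l + 2)) + 1)\<^sup>2 / 2"
      by (simp add: d_def field_simps)
    then show ?case by (simp only: normal_tail_lower_def exp_add times_divide_eq_right)
  qed
qed

lemma one_minus_power_le_exp:
  fixes q :: real
  assumes "q \<le> 1"
  shows "(1 - q) ^ m \<le> exp (- (m * q))"
proof -
  have "(1 - q) ^ m \<le> exp (- q) ^ m"
    using assms exp_ge_add_one_self[of "- q"] by (intro power_mono) auto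
  then show ?thesis by (simp flip: exp_of_nat_mult)
qed

lemma non_isometry_bound_tendsto_0:
  fixes s m :: "nat \<Rightarrow> nat"
  assumes s: "filterlim (\<lambda>p. real (s p)) at_top sequentially"
    and m: "(\<lambda>p. real (m p)) \<in> \<omega>(\<lambda>p. real (s p))" and \<delta>: "\<delta> > 0"
  shows "(\<lambda>p. non_isometry_bound \<delta> (s p) (m p)) \<longlonglongrightarrow> 0"
proof (rule tendsto_sandwich[OF _ _ tendsto_const])
  define a where "a = ln 3 + 16 / \<delta>\<^sup>2"
  define c where "c = 256 * (a + 1) / \<delta>\<^sup>2"
  have a: "a > 0" using \<delta> by (simp add: a_def add_pos_nonneg)
  then have "c > 0" using \<delta> by (simp add: c_def)
  have "\<forall>\<^sub>F p in sequentially. c * norm (real (s p)) \<le> norm (real (m p))"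
    by (rule landau_omega.smallD[OF m \<open>c > 0\<close>])
  then show "\<forall>\<^sub>F p in sequentially. non_isometry_bound \<delta> (s p) (m p) \<le> 2 * exp (- real (s p))"
  proof eventually_elim
    case (elim p)
    have "\<delta>\<^sup>2 / 256 * (c * real (s p)) \<le> \<delta>\<^sup>2 / 256 * real (m p)"
      using elim by (intro mult_left_mono) auto
    moreover have "\<delta>\<^sup>2 / 256 * (c * real (s p)) = (a + 1) * real (s p)" using \<delta> by (simp add: c_def)
    ultimately have "real (s p) * a + - \<delta>\<^sup>2 * real (m p) / 256 \<le> - real (s p)"
      by (simp add: algebra_simps)
    then have "exp (real (s p) * a + - \<delta>\<^sup>2 * real (m p) / 256) \<le> exp (- real (s p))"
      by (simp only: exp_le_cancel_iff)
    moreover have "exp (real (s p) * a) = (3 * exp (16 / \<delta>\<^sup>2)) ^ s p"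
      by (simp add: a_def exp_of_nat_mult exp_add)
    ultimately have "(3 * exp (16 / \<delta>\<^sup>2)) ^ s p * exp (- \<delta>\<^sup>2 * real (m p) / 256) \<le> exp (- real (s p))"
      by (simp only: exp_add)
    then show ?case unfolding non_isometry_bound_def mult.assoc by (rule mult_left_mono) simp
  qed
  show "\<forall>\<^sub>F p in sequentially. 0 \<le> non_isometry_bound \<delta> (s p) (m p)"
    by (simp add: non_isometry_bound_def)
  have "((\<lambda>x::real. 2 * exp (- x)) \<longlongrightarrow> 0) at_top" by real_asymp
  then show "(\<lambda>p. 2 * exp (- real (s p))) \<longlonglongrightarrow> 0" by (rule filterlim_compose[OF _ s])
qed

lemma smallomega_at_top:
  fixes s m :: "nat \<Rightarrow> nat"
  assumes s: "filterlim (\<lambda>p. real (s p)) at_top sequentially"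
    and m: "(\<lambda>p. real (m p)) \<in> \<omega>(\<lambda>p. real (s p))"
  shows "filterlim (\<lambda>p. real (m p)) at_top sequentially"
  by (rule filterlim_at_top_mono[OF s]) (use landau_omega.smallD[OF m, of 1] in simp)

lemma below_threshold:
  fixes n s L \<epsilon> \<eta> :: real
  assumes n: "n \<le> (1 - \<epsilon>) * (2 * s * L + s + 1)" and "1 \<le> s" "0 \<le> L"
    and \<eta>: "0 < \<eta>" "\<eta> \<le> 1 / 2" "2 * \<eta> \<le> \<epsilon>"
  shows "(1 + \<eta>) * n / s \<le> (1 - \<eta>) * (2 * L + 2)"
proof -
  note n
  also have "(1 - \<epsilon>) * (2 * s * L + s + 1) \<le> (1 - 2 * \<eta>) * (2 * s * L + s + 1)"
    using assms by (intro mult_right_mono) auto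
  also have "\<dots> \<le> (1 - 2 * \<eta>) * (s * (2 * L + 2))"
    using assms by (intro mult_left_mono) (auto simp: algebra_simps)
  finally have "(1 + \<eta>) * n \<le> (1 + \<eta>) * ((1 - 2 * \<eta>) * (s * (2 * L + 2)))"
    using \<eta> by (intro mult_left_mono) auto
  also have "\<dots> = ((1 + \<eta>) * (1 - 2 * \<eta>)) * (s * (2 * L + 2))" by simp
  also have "\<dots> \<le> (1 - \<eta>) * (s * (2 * L + 2))"
    using assms by (intro mult_right_mono) (auto simp: algebra_simps)
  finally show ?thesis using \<open>1 \<le> s\<close> by (simp add: divide_le_eq mult_ac)
qed

lemma above_threshold_contraction:
  fixes \<epsilon> :: real
  assumes \<epsilon>: "0 < \<epsilon>" "\<epsilon> \<le> 1"
  shows "1 + \<epsilon> / 2 \<le> (1 + \<epsilon>) * (1 - \<epsilon> / 8)\<^sup>2" and "1 + \<epsilon> / 8 \<le> (1 - \<epsilon> / 8) * (1 + \<epsilon> / 2)"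
proof -
  have sq: "\<epsilon> * \<epsilon> \<le> \<epsilon>" using \<epsilon> by (simp add: mult_left_le)
  have "(1 + \<epsilon>) * (1 - \<epsilon> / 4) = 1 + 3 / 4 * \<epsilon> - \<epsilon> * \<epsilon> / 4" by (simp add: field_simps)
  then have "1 + \<epsilon> / 2 \<le> (1 + \<epsilon>) * (1 - \<epsilon> / 4)" using sq by linarith
  also have "\<dots> \<le> (1 + \<epsilon>) * (1 - \<epsilon> / 8)\<^sup>2"
    using \<epsilon> by (intro mult_left_mono) (auto simp: power2_diff)
  finally show "1 + \<epsilon> / 2 \<le> (1 + \<epsilon>) * (1 - \<epsilon> / 8)\<^sup>2" .
  have "(1 - \<epsilon> / 8) * (1 + \<epsilon> / 2) = 1 + 3 / 8 * \<epsilon> - \<epsilon> * \<epsilon> / 16" by (simp add: field_simps)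
  then show "1 + \<epsilon> / 8 \<le> (1 - \<epsilon> / 8) * (1 + \<epsilon> / 2)" using sq \<epsilon> by linarith
qed

lemma above_threshold:
  fixes n s L \<tau> lam \<epsilon> :: real
  assumes n: "(1 + \<epsilon>) * (2 * s * L) \<le> n" and noise: "40 * (\<tau> * L) \<le> \<epsilon> * (n * lam\<^sup>2)"
    and \<tau>: "\<tau> > 0" and nonneg: "s \<ge> 0" "L \<ge> 0" and \<epsilon>: "0 < \<epsilon>" "\<epsilon> \<le> 1"
  shows "(1 + \<epsilon> / 8) * L \<le> n * lam\<^sup>2 / (2 * (2 * \<tau> + lam\<^sup>2 * s / (1 - \<epsilon> / 8)\<^sup>2))"
proof -
  define z where "z = lam\<^sup>2 * s / (1 - \<epsilon> / 8)\<^sup>2"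
  have z: "z \<ge> 0" "lam\<^sup>2 * s = (1 - \<epsilon> / 8)\<^sup>2 * z" using nonneg \<epsilon> by (simp_all add: z_def)
  note contraction = above_threshold_contraction[OF \<epsilon>]
  have "(1 + \<epsilon> / 8) * (2 * (z * L)) \<le> (1 - \<epsilon> / 8) * (1 + \<epsilon> / 2) * (2 * (z * L))"
    using contraction(2) z nonneg by (intro mult_right_mono) auto
  also have "\<dots> = (1 - \<epsilon> / 8) * ((1 + \<epsilon> / 2) * (2 * (z * L)))" by (rule mult.assoc)
  also have "\<dots> \<le> (1 - \<epsilon> / 8) * (n * lam\<^sup>2)"
  proof (rule mult_left_mono)
    have "(1 + \<epsilon> / 2) * (2 * (z * L)) \<le> (1 + \<epsilon>) * (1 - \<epsilon> / 8)\<^sup>2 * (2 * (z * L))"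
      using contraction(1) z nonneg by (intro mult_right_mono) auto
    also have "\<dots> = 2 * (1 + \<epsilon>) * ((1 - \<epsilon> / 8)\<^sup>2 * z) * L" by (simp only: mult_ac)
    also have "\<dots> = (1 + \<epsilon>) * (2 * s * L) * lam\<^sup>2" unfolding z(2)[symmetric] by (simp only: mult_ac)
    also have "\<dots> \<le> n * lam\<^sup>2" using n by (intro mult_right_mono) auto
    finally show "(1 + \<epsilon> / 2) * (2 * (z * L)) \<le> n * lam\<^sup>2" .
  qed (use \<epsilon> in simp)
  finally have bias: "(1 + \<epsilon> / 8) * (2 * (z * L)) \<le> (1 - \<epsilon> / 8) * (n * lam\<^sup>2)" .
  have "(1 + \<epsilon> / 8) * 4 * (\<tau> * L) \<le> 5 * (\<tau> * L)" using \<tau> nonneg \<epsilon> by (intro mult_right_mono) auto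
  then have "(1 + \<epsilon> / 8) * 4 * (\<tau> * L) \<le> \<epsilon> / 8 * (n * lam\<^sup>2)" using noise by simp
  moreover have "(1 + \<epsilon> / 8) * L * (2 * (2 * \<tau> + z))
      = (1 + \<epsilon> / 8) * 4 * (\<tau> * L) + (1 + \<epsilon> / 8) * (2 * (z * L))"
    by (simp add: algebra_simps)
  moreover have "(1 - \<epsilon> / 8) * (n * lam\<^sup>2) = n * lam\<^sup>2 - \<epsilon> / 8 * (n * lam\<^sup>2)"
    by (simp add: left_diff_distrib)
  ultimately have "(1 + \<epsilon> / 8) * L * (2 * (2 * \<tau> + z)) \<le> n * lam\<^sup>2" using bias by linarith
  moreover have "2 * (2 * \<tau> + z) > 0" using \<tau> z by simp
  ultimately show ?thesis by (simp only: pos_le_divide_eq z_def)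
qed

locale lasso_sequence =
  fixes s n1 n2 :: "nat \<Rightarrow> nat" and \<sigma>1 \<sigma>2 :: "nat \<Rightarrow> real" and \<beta>s :: "nat \<Rightarrow> nat \<Rightarrow> real"
  assumes card_support: "\<And>p. card (support p (\<beta>s p)) = s p"
    and s_at_top: "filterlim (\<lambda>p. real (s p)) at_top sequentially"
    and s_small: "(\<lambda>p. real (s p)) \<in> o(\<lambda>p. real p)"
    and n1_large: "(\<lambda>p. real (n1 p)) \<in> \<omega>(\<lambda>p. real (s p))"
begin

definition log_null :: "nat \<Rightarrow> real" where
  "log_null p = ln (real p - real (s p))"

definition avg_var :: "nat \<Rightarrow> real" where
  "avg_var p = (real (n1 p) * (\<sigma>1 p)\<^sup>2 + real (n2 p) * (\<sigma>2 p)\<^sup>2) / real (n1 p + n2 p)"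

abbreviation recovery_probs :: "(nat \<Rightarrow> real) \<Rightarrow> nat \<Rightarrow> real" where
  "recovery_probs lam p \<equiv> recovery_prob (n1 p) (n2 p) p (\<sigma>1 p) (\<sigma>2 p) (\<beta>s p) (lam p)"

lemma n1_at_top: "filterlim (\<lambda>p. real (n1 p)) at_top sequentially"
  by (rule smallomega_at_top[OF s_at_top n1_large])

lemma eventually_half_le: "\<forall>\<^sub>F p in sequentially. real p / 2 \<le> real p - real (s p)"
  using landau_o.smallD[OF s_small, of "1 / 2"] by (auto elim: eventually_mono)

lemma log_null_at_top: "filterlim log_null at_top sequentially"
proof -
  have "filterlim (\<lambda>p::nat. real p / 2) at_top sequentially" by real_asymp
  then have "filterlim (\<lambda>p. real p - real (s p)) at_top sequentially"
    using eventually_half_le by (rule filterlim_at_top_mono)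
  then show ?thesis unfolding log_null_def[abs_def] by (rule filterlim_compose[OF ln_at_top])
qed

lemma eventually_exp_log_null: "\<forall>\<^sub>F p in sequentially. real (p - s p) = exp (log_null p)"
  using eventually_half_le eventually_gt_at_top[of 0]
  by eventually_elim (simp add: log_null_def of_nat_diff)

lemma eventually_large:
  "\<forall>\<^sub>F p in sequentially. 1 \<le> real (s p)" "\<forall>\<^sub>F p in sequentially. 1 \<le> real (n1 p)"
  "\<forall>\<^sub>F p in sequentially. 1 \<le> log_null p"
  using s_at_top n1_at_top log_null_at_top unfolding filterlim_at_top by blast+

theorem recovery_prob_tendsto_0:
  assumes \<epsilon>: "\<epsilon> > 0" and lam: "\<And>p. lam p > 0"
    and n: "\<forall>\<^sub>F p in sequentially. real (n1 p + n2 p)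
        < (1 - \<epsilon>) * (2 * real (s p) * log_null p + real (s p) + 1)"
  shows "recovery_probs lam \<longlonglongrightarrow> 0"
proof (rule tendsto_sandwich[OF _ _ tendsto_const])
  define \<eta> where "\<eta> = min \<epsilon> (1 / 2) / 2"
  have \<eta>: "0 < \<eta>" "\<eta> \<le> 1 / 4" "2 * \<eta> \<le> \<epsilon>" using \<epsilon> by (auto simp: \<eta>_def)
  define q where "q = (\<lambda>l. normal_tail_lower (sqrt ((1 - \<eta>) * (2 * l + 2))))"
  show "\<forall>\<^sub>F p in sequentially. recovery_probs lam p
      \<le> exp (- (exp (log_null p) * q (log_null p))) + 2 * exp (- \<eta>\<^sup>2 * real (n1 p) / 16)"
    using eventually_large eventually_exp_log_null n
  proof eventually_elim
    case (elim p)
    interpret lasso_instance "n1 p" "n2 p" p "\<sigma>1 p" "\<sigma>2 p" "lam p" "\<beta>s p"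
      by unfold_locales (use elim lam in auto)
    define t where "t = sqrt ((1 + \<eta>) * real n / real (s p))"
    have "S \<noteq> {}" using elim card_support[of p] by auto
    then have bound: "recovery_probs lam p
        \<le> (1 - normal_tail_lower t) ^ (p - s p) + 2 * exp (- \<eta>\<^sup>2 * real n / 16)"
      using recovery_prob_upper_bound[of \<eta>] \<eta> by (simp add: card_support t_def)
    have "(1 + \<eta>) * real n / real (s p) \<le> (1 - \<eta>) * (2 * log_null p + 2)"
      using elim \<eta> by (intro below_threshold[of _ \<epsilon>]) auto
    then have "q (log_null p) \<le> normal_tail_lower t"
      unfolding q_def t_def using \<eta> by (intro normal_tail_lower_antimono) auto
    then have "exp (log_null p) * q (log_null p) \<le> real (p - s p) * normal_tail_lower t"
      using elim by simp
    then have "(1 - normal_tail_lower t) ^ (p - s p) \<le> exp (- (exp (log_null p) * q (log_null p)))"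
      using one_minus_power_le_exp[OF normal_tail_lower_le_1, of t "p - s p"]
      by (meson exp_le_cancel_iff neg_le_iff_le order_trans)
    moreover have "exp (- \<eta>\<^sup>2 * real n / 16) \<le> exp (- \<eta>\<^sup>2 * real (n1 p) / 16)"
      by (simp add: mult_left_mono)
    ultimately show ?case using bound by linarith
  qed
  have "filterlim (\<lambda>l. exp l * q l) at_top at_top"
    unfolding q_def using \<eta> by (intro exp_times_normal_tail_lower_at_top) auto
  then have "((\<lambda>l. exp (- (exp l * q l))) \<longlongrightarrow> 0) at_top"
    by (intro filterlim_compose[OF exp_at_bot] filterlim_compose[OF filterlim_uminus_at_bot_at_top])
  moreover have "((\<lambda>x::real. 2 * exp (- \<eta>\<^sup>2 * x / 16)) \<longlongrightarrow> 0) at_top" using \<eta> by real_asymp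
  ultimately show "(\<lambda>p. exp (- (exp (log_null p) * q (log_null p)))
      + 2 * exp (- \<eta>\<^sup>2 * real (n1 p) / 16)) \<longlonglongrightarrow> 0"
    by (intro tendsto_add_zero)
      (rule filterlim_compose[OF _ log_null_at_top] filterlim_compose[OF _ n1_at_top], assumption)+
qed (simp add: recovery_prob_range)

end

locale lasso_achievable = lasso_sequence +
  fixes \<rho> lam :: "nat \<Rightarrow> real" and \<epsilon> :: real
  assumes n2_large: "(\<lambda>p. real (n2 p)) \<in> \<omega>(\<lambda>p. real (s p))"
    and \<sigma>1_nonzero: "\<And>p. \<sigma>1 p \<noteq> 0"
    and \<rho>_pos: "\<And>p. \<rho> p > 0"
    and \<rho>_le: "\<And>p j. j \<in> support p (\<beta>s p) \<Longrightarrow> \<rho> p \<le> \<bar>\<beta>s p j\<bar>"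
    and \<epsilon>_pos: "\<epsilon> > 0"
    and lam_pos: "\<And>p. lam p > 0"
    and n_large: "\<forall>\<^sub>F p in sequentially.
      real (n1 p + n2 p) > (1 + \<epsilon>) * (2 * real (s p) * log_null p + real (s p) + 1)"
    and penalty_large: "filterlim (\<lambda>p. real (n1 p + n2 p) * (lam p)\<^sup>2 / (avg_var p * log_null p))
      at_top sequentially"
    and signal_large: "(\<lambda>p. (1 / \<rho> p) * (lam p * sqrt (real (s p))
      + sqrt (avg_var p * ln (real (s p)) / real (n1 p + n2 p)))) \<longlonglongrightarrow> 0"
begin

lemma avg_var_pos:
  assumes "1 \<le> real (n1 p)"
  shows "avg_var p > 0"
  using assms \<sigma>1_nonzero[of p] unfolding avg_var_def
  by (intro divide_pos_pos add_pos_nonneg mult_pos_pos) auto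

lemma eventually_signal_large:
  "\<forall>\<^sub>F p in sequentially. 4 * (lam p * sqrt (real (s p))) \<le> \<rho> p \<and>
    2 * ln (real (s p)) \<le> (\<rho> p)\<^sup>2 * real (n1 p + n2 p) / (64 * avg_var p)"
proof -
  have "\<forall>\<^sub>F p in sequentially. (1 / \<rho> p) * (lam p * sqrt (real (s p))
      + sqrt (avg_var p * ln (real (s p)) / real (n1 p + n2 p))) < 1 / 16"
    using order_tendstoD(2)[OF signal_large, of "1 / 16"] by simp
  then show ?thesis using eventually_large(1,2)
  proof eventually_elim
    case (elim p)
    define x where "x = avg_var p * ln (real (s p)) / real (n1 p + n2 p)"
    have n: "real (n1 p + n2 p) > 0" using elim by simp
    have var: "avg_var p > 0" using elim by (simp add: avg_var_pos)
    have x: "sqrt x \<ge> 0" "x \<ge> 0" using elim var by (simp_all add: x_def)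
    have "lam p * sqrt (real (s p)) + sqrt x \<le> \<rho> p / 16"
      using elim(1) \<rho>_pos[of p] unfolding x_def by (simp add: field_simps del: of_nat_add)
    moreover have "lam p * sqrt (real (s p)) \<ge> 0" using lam_pos[of p] by simp
    ultimately have bias: "lam p * sqrt (real (s p)) \<le> \<rho> p / 16" and "sqrt x \<le> \<rho> p / 16"
      using x by linarith+
    then have "x \<le> (\<rho> p / 16)\<^sup>2" using x by (simp add: sqrt_le_D)
    then have "256 * ln (real (s p)) \<le> (\<rho> p)\<^sup>2 * real (n1 p + n2 p) / avg_var p"
      using n var by (simp add: x_def power_divide field_simps del: of_nat_add)
    moreover have "0 \<le> ln (real (s p))" using elim by simp
    moreover have "(\<rho> p)\<^sup>2 * real (n1 p + n2 p) / (64 * avg_var p)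
        = (\<rho> p)\<^sup>2 * real (n1 p + n2 p) / avg_var p / 64" by simp
    ultimately show ?case using bias \<rho>_pos[of p] by linarith
  qed
qed

lemma eventually_fit_bound:
  "\<forall>\<^sub>F p in sequentially. 2 * real (s p) * exp (- (\<rho> p)\<^sup>2 * real (n1 p + n2 p) / (64 * avg_var p))
      \<le> 2 / real (s p)"
  using eventually_signal_large eventually_large(1)
proof eventually_elim
  case (elim p)
  have "exp (- (\<rho> p)\<^sup>2 * real (n1 p + n2 p) / (64 * avg_var p)) \<le> exp (- (2 * ln (real (s p))))"
    using elim by simp
  also have "\<dots> = 1 / (real (s p))\<^sup>2" using elim by (simp add: exp_minus exp_double inverse_eq_divide)
  finally have "2 * real (s p) * exp (- (\<rho> p)\<^sup>2 * real (n1 p + n2 p) / (64 * avg_var p))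
      \<le> 2 * real (s p) * (1 / (real (s p))\<^sup>2)"
    by (intro mult_left_mono) auto
  then show ?case using elim by (simp add: power2_eq_square)
qed

lemma eventually_null_bound:
  assumes \<epsilon>': "0 < \<epsilon>'" "\<epsilon>' \<le> 1" "\<epsilon>' \<le> \<epsilon>"
  shows "\<forall>\<^sub>F p in sequentially.
    2 * real (p - s p) * exp (- (real (n1 p + n2 p) * (lam p)\<^sup>2
      / (2 * (2 * avg_var p + (lam p)\<^sup>2 * real (s p) / (1 - \<epsilon>' / 8)\<^sup>2))))
    \<le> 2 * exp (- (\<epsilon>' / 8) * log_null p)"
proof -
  have "\<forall>\<^sub>F p in sequentially. 40 / \<epsilon>' \<le> real (n1 p + n2 p) * (lam p)\<^sup>2 / (avg_var p * log_null p)"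
    using penalty_large unfolding filterlim_at_top by blast
  then show ?thesis using n_large eventually_large eventually_exp_log_null
  proof eventually_elim
    case (elim p)
    define n where "n = real (n1 p + n2 p)"
    have "(1 + \<epsilon>' / 8) * log_null p
        \<le> n * (lam p)\<^sup>2 / (2 * (2 * avg_var p + (lam p)\<^sup>2 * real (s p) / (1 - \<epsilon>' / 8)\<^sup>2))"
    proof (rule above_threshold)
      have "(1 + \<epsilon>') * (2 * real (s p) * log_null p)
          \<le> (1 + \<epsilon>) * (2 * real (s p) * log_null p + real (s p) + 1)"
        using elim \<epsilon>' by (intro mult_mono) auto
      then show "(1 + \<epsilon>') * (2 * real (s p) * log_null p) \<le> n" using elim by (simp add: n_def)
      show "40 * (avg_var p * log_null p) \<le> \<epsilon>' * (n * (lam p)\<^sup>2)"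
        using elim(1) avg_var_pos[of p] elim \<epsilon>' unfolding n_def[symmetric]
        by (simp add: field_simps)
    qed (use elim avg_var_pos[of p] \<epsilon>' in auto)
    then have "2 * real (p - s p)
        * exp (- (n * (lam p)\<^sup>2 / (2 * (2 * avg_var p + (lam p)\<^sup>2 * real (s p) / (1 - \<epsilon>' / 8)\<^sup>2))))
        \<le> 2 * exp (log_null p) * exp (- ((1 + \<epsilon>' / 8) * log_null p))"
      using elim by simp
    also have "\<dots> = 2 * exp (- (\<epsilon>' / 8) * log_null p)" by (simp add: algebra_simps flip: exp_add)
    finally show ?case unfolding n_def .
  qed
qed

theorem recovery_prob_tendsto_1: "recovery_probs lam \<longlonglongrightarrow> 1"
proof -
  define \<epsilon>' where "\<epsilon>' = min \<epsilon> 1"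
  have \<epsilon>': "0 < \<epsilon>'" "\<epsilon>' \<le> 1" "\<epsilon>' \<le> \<epsilon>" using \<epsilon>_pos by (auto simp: \<epsilon>'_def)
  define \<delta> where "\<delta> = \<epsilon>' / 8"
  have \<delta>: "0 < \<delta>" "\<delta> \<le> 1 / 4" using \<epsilon>' by (auto simp: \<delta>_def)
  define b where "b = (\<lambda>p. non_isometry_bound \<delta> (s p) (n1 p) + non_isometry_bound \<delta> (s p) (n2 p)
    + 2 * exp (- real (n1 p) / 16) + 2 * exp (- real (n2 p) / 16)
    + 2 / real (s p) + 2 * exp (- (\<epsilon>' / 8) * log_null p))"
  have lower: "\<forall>\<^sub>F p in sequentially. 1 - b p \<le> recovery_probs lam p"
    using eventually_signal_large eventually_fit_bound eventually_null_bound[OF \<epsilon>'] eventually_large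
  proof eventually_elim
    case (elim p)
    interpret lasso_instance "n1 p" "n2 p" p "\<sigma>1 p" "\<sigma>2 p" "lam p" "\<beta>s p"
      by unfold_locales (use elim lam_pos in auto)
    have "noise_var = avg_var p" by (simp add: noise_var_def avg_var_def)
    moreover have "S \<noteq> {}" using elim card_support[of p] by auto
    ultimately show ?case
      using recovery_prob_lower_bound[OF _ \<delta> \<sigma>1_nonzero less_imp_le[OF \<rho>_pos] \<rho>_le] elim
      unfolding b_def card_support \<delta>_def by fastforce
  qed
  have noise_tail: "((\<lambda>x::real. 2 * exp (- x / 16)) \<longlongrightarrow> 0) at_top"
    and fit_tail: "((\<lambda>x::real. 2 / x) \<longlongrightarrow> 0) at_top"
    and null_tail: "((\<lambda>x. 2 * exp (- (\<epsilon>' / 8) * x)) \<longlongrightarrow> 0) at_top"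
    using \<epsilon>' by real_asymp+
  have "b \<longlonglongrightarrow> 0" unfolding b_def
    by (intro tendsto_add_zero non_isometry_bound_tendsto_0 s_at_top n1_large n2_large \<delta>
        filterlim_compose[OF noise_tail n1_at_top] filterlim_compose[OF fit_tail s_at_top]
        filterlim_compose[OF noise_tail smallomega_at_top[OF s_at_top n2_large]]
        filterlim_compose[OF null_tail log_null_at_top])
  then have lim: "(\<lambda>p. 1 - b p) \<longlonglongrightarrow> 1" using tendsto_diff[OF tendsto_const, of b 0 _ 1] by simp
  show ?thesis
    by (rule tendsto_sandwich[OF lower _ lim tendsto_const]) (simp add: recovery_prob_range)
qed

end

theorem theorem3:
  fixes s n1 n2 :: "nat \<Rightarrow> nat"
    and \<sigma>1 \<sigma>2 \<rho> :: "nat \<Rightarrow> real"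
    and \<beta>s :: "nat \<Rightarrow> nat \<Rightarrow> real"
  assumes sigma: "\<And>p. 0 < (\<sigma>1 p)\<^sup>2 \<and> (\<sigma>1 p)\<^sup>2 < (\<sigma>2 p)\<^sup>2"
    and rho_pos: "\<And>p. \<rho> p > 0"
    and supp: "\<And>p. card {j. j < p \<and> \<beta>s p j \<noteq> 0} = s p"
    and rho_bd: "\<And>p j. j < p \<Longrightarrow> \<beta>s p j \<noteq> 0 \<Longrightarrow> \<bar>\<beta>s p j\<bar> \<ge> \<rho> p"
    and s_inf: "filterlim (\<lambda>p. real (s p)) at_top sequentially"
    and s_small: "(\<lambda>p. real (s p)) \<in> o(\<lambda>p. real p)"
    and n1_big: "(\<lambda>p. real (n1 p)) \<in> \<omega>(\<lambda>p. real (s p))"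
    and n2_big: "(\<lambda>p. real (n2 p)) \<in> \<omega>(\<lambda>p. real (s p))"
  defines "nALG \<equiv> (\<lambda>p. 2 * real (s p) * ln (real p - real (s p)) + real (s p) + 1)"
    and "n \<equiv> (\<lambda>p. n1 p + n2 p)"
    and "\<sigma>avg2 \<equiv> (\<lambda>p. (real (n1 p) * (\<sigma>1 p)\<^sup>2 + real (n2 p) * (\<sigma>2 p)\<^sup>2) / real (n1 p + n2 p))"
  shows
    "((\<exists>\<epsilon>>0. \<forall>\<^sub>F p in sequentially. real (n p) < (1 - \<epsilon>) * nALG p) \<longrightarrow>
        (\<forall>lam :: nat \<Rightarrow> real. (\<forall>p. lam p > 0) \<longrightarrow>
           ((\<exists>L. (\<lambda>p. (real (n1 p) * (\<sigma>1 p)\<^sup>2 + real (n2 p) * (\<sigma>2 p)\<^sup>2)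
                        / ((lam p)\<^sup>2 * (real (n p))\<^sup>2)) \<longlonglongrightarrow> L)
            \<or> filterlim (\<lambda>p. (real (n1 p) * (\<sigma>1 p)\<^sup>2 + real (n2 p) * (\<sigma>2 p)\<^sup>2)
                        / ((lam p)\<^sup>2 * (real (n p))\<^sup>2)) at_top sequentially) \<longrightarrow>
           (\<lambda>p. recovery_prob (n1 p) (n2 p) p (\<sigma>1 p) (\<sigma>2 p) (\<beta>s p) (lam p)) \<longlonglongrightarrow> 0))
     \<and>
     ((\<exists>\<epsilon>>0. \<forall>\<^sub>F p in sequentially. real (n p) > (1 + \<epsilon>) * nALG p) \<longrightarrow>
        (\<forall>lam :: nat \<Rightarrow> real. (\<forall>p. lam p > 0) \<longrightarrow> lam \<longlonglongrightarrow> 0 \<longrightarrow>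
           filterlim (\<lambda>p. real (n p) * (lam p)\<^sup>2 / (\<sigma>avg2 p * ln (real p - real (s p))))
             at_top sequentially \<longrightarrow>
           (\<lambda>p. (1 / \<rho> p) * (lam p * sqrt (real (s p))
                 + sqrt (\<sigma>avg2 p * ln (real (s p)) / real (n p)))) \<longlonglongrightarrow> 0 \<longrightarrow>
           (\<lambda>p. recovery_prob (n1 p) (n2 p) p (\<sigma>1 p) (\<sigma>2 p) (\<beta>s p) (lam p)) \<longlonglongrightarrow> 1))"
proof -
  interpret lasso_sequence s n1 n2 \<sigma>1 \<sigma>2 \<beta>s
    using supp s_inf s_small n1_big by unfold_locales (simp_all add: support_def)
  show ?thesis
  proof (intro conjI impI allI; elim exE conjE)
    fix lam :: "nat \<Rightarrow> real" and \<epsilon> :: real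
    assume "\<forall>p. lam p > 0" "\<epsilon> > 0" "\<forall>\<^sub>F p in sequentially. real (n p) < (1 - \<epsilon>) * nALG p"
    then show "recovery_probs lam \<longlonglongrightarrow> 0"
      unfolding n_def nALG_def log_null_def[symmetric] by (intro recovery_prob_tendsto_0) auto
  next
    fix lam :: "nat \<Rightarrow> real" and \<epsilon> :: real
    assume "\<forall>p. lam p > 0" "\<epsilon> > 0" "\<forall>\<^sub>F p in sequentially. real (n p) > (1 + \<epsilon>) * nALG p"
      "filterlim (\<lambda>p. real (n p) * (lam p)\<^sup>2 / (\<sigma>avg2 p * ln (real p - real (s p))))
        at_top sequentially"
      "(\<lambda>p. (1 / \<rho> p) * (lam p * sqrt (real (s p))
         + sqrt (\<sigma>avg2 p * ln (real (s p)) / real (n p)))) \<longlonglongrightarrow> 0"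
    moreover have "\<sigma>1 p \<noteq> 0" for p using sigma[of p] by auto
    ultimately interpret lasso_achievable s n1 n2 \<sigma>1 \<sigma>2 \<beta>s \<rho> lam \<epsilon>
      using n2_big rho_pos rho_bd unfolding n_def nALG_def \<sigma>avg2_def
      by unfold_locales (auto simp: support_def log_null_def avg_var_def)
    show "recovery_probs lam \<longlonglongrightarrow> 1" by (rule recovery_prob_tendsto_1)
  qed
qed

end
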